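(* Let $\{Z_t\}_{t\ge 0}$ be a theta-positive branching process in varying environment with parameters $(\theta,\{\lambda_t\},\{a_t\})$, where $\theta\in(0,1]$. The process is supercritical if and only if $V_\theta<\infty$ and $\Lambda=\infty$. In this case, $\lim_{t\to\infty}\mu_t=\infty$, $$q=1-\big(V_\theta+(1+\theta)^{-1}\big)^{-1/\theta},$$ and, as $t\to\infty$, $\mu_t^{-1}Z_t$ converges almost surely to a random variable $W$ such that $$\mathrm{E}(e^{-wW})=1-\big(V_\theta+(1+\theta)^{-1}+w^{-\theta}\big)^{-1/\theta},\qquad w\ge0$$ (the right-hand side being read as $1$ for $w=0$).
   Context: Theta-positive branching process in varying environment with parameters $(\theta,\{\lambda_t\},\{a_t\})$: fix $\theta\in(0,1]$ and measurable functions $t\mapsto\lambda_t\ge0$ and $t\mapsto a_t$ on $[0,\infty)$ such that $\Lambda_t=\int_0^t\lambda_u\,du<\infty$ for all $t\ge0$ and $0\le a_t\le 1+1/\theta$ for all $t\ge 0$. The process $\{Z_t\}_{t\ge0}$ is the time-inhomogeneous continuous-time Markov branching process on $\{0,1,2,\dots\}$ with $Z_0=1$ (right-continuous sample paths) in which individuals live and reproduce independently; an individual alive at time $t$ dies during $(t,t+\delta)$ with probability $\lambda_t\delta+o(\delta)$ as $\delta\to0$, and an individual dying at time $t$ is instantaneously replaced by $k$ offspring with probability $p_t(k)$, where $k=0$ or $k\ge2$. (So from state $n$ the process jumps to $n-1+k$ at rate $n\lambda_tp_t(k)$ at time $t$.) The offspring probability generating function is $h_t(s)=p_t(0)+\sum_{k\ge2}p_t(k)s^k=1-a_t(1-s)+a_t(1+\theta)^{-1}(1-s)^{1+\theta}$,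 $0\le s\le 1$; in particular $a_t=\sum_{k\ge 2} kp_t(k)$ is the mean offspring number. Notation: $\mu_t=\mathrm{E}(Z_t)=\exp\{\int_0^t(a_u-1)\,d\Lambda_u\}$, where $d\Lambda_u=\lambda_u\,du$; $q=\lim_{t\to\infty}\mathrm{P}(Z_t=0)$ is the extinction probability; $\Lambda=\lim_{t\to\infty}\Lambda_t\in[0,\infty]$; $V_{t,\theta}=\theta(1+\theta)^{-1}\int_0^t\mu_u^{-\theta}\,d\Lambda_u$; $V_\theta=\lim_{t\to\infty}V_{t,\theta}\in[0,\infty]$. The process is called supercritical if $q<1$ and $\lim_{t\to\infty}\mu_t=\infty$. *)

theory Defs
  imports "HOL-Probability.Probability"
begin

definition Lam :: "(real \<Rightarrow> real) \<Rightarrow> real \<Rightarrow> ennreal" where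
  "Lam lam t = (\<integral>\<^sup>+u\<in>{0..t}. ennreal (lam u) \<partial>lborel)"

text \<open>\<open>Lam_incr lam s t\<close> is the increment of the cumulative rate over \<open>(s, t]\<close>; it is meaningful
  when \<open>Lam lam t < \<infinity>\<close>.\<close>

definition Lam_incr :: "(real \<Rightarrow> real) \<Rightarrow> real \<Rightarrow> real \<Rightarrow> real" where
  "Lam_incr lam s t = enn2real (Lam lam t) - enn2real (Lam lam s)"

definition Lam_lim :: "(real \<Rightarrow> real) \<Rightarrow> ennreal" where
  "Lam_lim lam = Lim at_top (Lam lam)"

definition nat_filtration :: "'w measure \<Rightarrow> (real \<Rightarrow> 'w \<Rightarrow> nat) \<Rightarrow> real \<Rightarrow> 'w measure" where
  "nat_filtration M Z s =
     sigma (space M) {Z u -` B \<inter> space M | u B. 0 \<le> u \<and> u \<le> s}"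

text \<open>Markov property together with independence of individuals: given the history up to time
  \<open>s\<close>, the population at time \<open>t\<close> is the sum of \<open>Z s\<close> independent copies of a variable with law
  \<open>G s t\<close>, the law of the number of descendants alive at time \<open>t\<close> (itself included) of one
  individual alive at time \<open>s\<close>.\<close>

definition markov_branching ::
    "'w measure \<Rightarrow> (real \<Rightarrow> 'w \<Rightarrow> nat) \<Rightarrow> bool" where
  "markov_branching M Z \<longleftrightarrow>
     (\<exists>G :: real \<Rightarrow> real \<Rightarrow> nat pmf. \<forall>s t j. 0 \<le> s \<and> s \<le> t \<longrightarrow>
        (AE \<omega> in M.
           real_cond_exp M (nat_filtration M Z s) (indicator {\<omega> \<in> space M. Z t \<omega> = j}) \<omega>
           = pmf (map_pmf sum_list (replicate_pmf (Z s \<omega>) (G s t))) j))"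

text \<open>The event that the first change of state after time \<open>s\<close> happens in \<open>(s, t]\<close> and, starting
  from a single individual, leads to state \<open>k\<close>.\<close>

definition dies_with_offspring ::
    "(real \<Rightarrow> 'w \<Rightarrow> nat) \<Rightarrow> real \<Rightarrow> real \<Rightarrow> nat \<Rightarrow> 'w \<Rightarrow> bool" where
  "dies_with_offspring Z s t k \<omega> \<longleftrightarrow>
     (\<exists>r\<in>{s<..t}. (\<forall>u\<in>{s..<r}. Z u \<omega> = 1) \<and> Z r \<omega> = k)"

text \<open>Death rate \<open>lam\<close> and offspring law \<open>p\<close> of an individual. For merely measurable \<open>lam\<close> and
  \<open>p\<close>, the infinitesimal description (death in \<open>(t, t + \<delta>)\<close> with probability
  \<open>lam t * \<delta> + o(\<delta>)\<close>, then \<open>k\<close> offspring with probability \<open>pmf (p t) k\<close>) is meaningful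
  only for almost every \<open>t\<close> and does not rule out singular jump times. It is therefore stated in
  the usual integrated form: \<open>lam\<close> is the hazard rate of the residual lifetime, and, jointly with
  the death time \<open>u\<close>, the offspring number has law \<open>p u\<close>. The individual is observed
  on the event \<open>Z s = 1\<close>, where it is alone; since \<open>k \<noteq> 1\<close>, its death is visible as
  a change of state. The conditioning event is never null, as \<open>Z 0 = 1\<close> almost surely and the
  case \<open>s = 0\<close> bounds its probability below by \<open>exp (- Lam_incr lam 0 s)\<close>.\<close>

definition individual_rates ::
    "'w measure \<Rightarrow> (real \<Rightarrow> real) \<Rightarrow> (real \<Rightarrow> nat pmf) \<Rightarrow> (real \<Rightarrow> 'w \<Rightarrow> nat) \<Rightarrow> bool" where
  "individual_rates M lam p Z \<longleftrightarrow>
     (\<forall>s t k. 0 \<le> s \<and> s \<le> t \<and> k \<noteq> 1 \<longrightarrow>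
        \<P>(\<omega> in M. dies_with_offspring Z s t k \<omega> \<bar> Z s \<omega> = 1)
        = (LINT u:{s..t}|lborel. lam u * exp (- Lam_incr lam s u) * pmf (p u) k))"

definition theta_offspring_law :: "real \<Rightarrow> real \<Rightarrow> nat pmf \<Rightarrow> bool" where
  "theta_offspring_law \<theta> m P \<longleftrightarrow>
     pmf P 1 = 0 \<and>
     (\<forall>x\<in>{0..1}. (\<lambda>k. pmf P k * x ^ k) sums
        (1 - m * (1 - x) + m / (1 + \<theta>) * (1 - x) powr (1 + \<theta>)))"

definition theta_positive_process ::
    "'w measure \<Rightarrow> real \<Rightarrow> (real \<Rightarrow> real) \<Rightarrow> (real \<Rightarrow> real) \<Rightarrow> (real \<Rightarrow> 'w \<Rightarrow> nat) \<Rightarrow> bool" where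
  "theta_positive_process M \<theta> lam a Z \<longleftrightarrow>
     0 < \<theta> \<and> \<theta> \<le> 1 \<and>
     lam \<in> borel_measurable (restrict_space borel {0..}) \<and>
     a \<in> borel_measurable (restrict_space borel {0..}) \<and>
     (\<forall>t\<ge>0. 0 \<le> lam t) \<and>
     (\<forall>t\<ge>0. Lam lam t < \<infinity>) \<and>
     (\<forall>t\<ge>0. 0 \<le> a t \<and> a t \<le> 1 + 1 / \<theta>) \<and>
     prob_space M \<and>
     (\<forall>t\<ge>0. Z t \<in> measurable M (count_space UNIV)) \<and>
     (AE \<omega> in M. Z 0 \<omega> = 1) \<and>
     (\<forall>\<omega>\<in>space M. \<forall>t\<ge>0. continuous (at_right t) (\<lambda>u. Z u \<omega>)) \<and>
     markov_branching M Z \<and>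
     (\<exists>p. (\<forall>t\<ge>0. theta_offspring_law \<theta> (a t) (p t)) \<and> individual_rates M lam p Z)"

definition mu :: "'w measure \<Rightarrow> (real \<Rightarrow> 'w \<Rightarrow> nat) \<Rightarrow> real \<Rightarrow> real" where
  "mu M Z t = (\<integral>\<omega>. real (Z t \<omega>) \<partial>M)"

definition ext_prob :: "'w measure \<Rightarrow> (real \<Rightarrow> 'w \<Rightarrow> nat) \<Rightarrow> real" where
  "ext_prob M Z = Lim at_top (\<lambda>t. \<P>(\<omega> in M. Z t \<omega> = 0))"

definition V :: "'w measure \<Rightarrow> real \<Rightarrow> (real \<Rightarrow> real) \<Rightarrow> (real \<Rightarrow> 'w \<Rightarrow> nat) \<Rightarrow> real \<Rightarrow> ennreal" where
  "V M \<theta> lam Z t =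
     ennreal (\<theta> / (1 + \<theta>)) * (\<integral>\<^sup>+u\<in>{0..t}. ennreal (mu M Z u powr (- \<theta>) * lam u) \<partial>lborel)"

definition V_lim :: "'w measure \<Rightarrow> real \<Rightarrow> (real \<Rightarrow> real) \<Rightarrow> (real \<Rightarrow> 'w \<Rightarrow> nat) \<Rightarrow> ennreal" where
  "V_lim M \<theta> lam Z = Lim at_top (V M \<theta> lam Z)"

definition supercritical :: "'w measure \<Rightarrow> (real \<Rightarrow> 'w \<Rightarrow> nat) \<Rightarrow> bool" where
  "supercritical M Z \<longleftrightarrow> ext_prob M Z < 1 \<and> filterlim (mu M Z) at_top at_top"

end

theory Submission
  imports Defs
begin

text \<open>Let \<open>F s t\<close> be the generating function of the number of descendants at time \<open>t\<close> of one
individual alive at time \<open>s\<close>, and put \<open>f s = 1 - F s t x\<close> for fixed \<open>t\<close> and \<open>x < 1\<close>. Heuristically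
the backward equation reads \<open>- f' = lam ((a - 1) f - a / (1 + \<theta>) f^(1 + \<theta>))\<close>, a Bernoulli equation:
after the substitution \<open>f^(- \<theta>)\<close> it is linear, and its solution is explicit (\<open>explicit_pgf\<close>):
\<open>(1 - F 0 t x)\<^sup>-\<^sup>\<theta> = (1 - x)\<^sup>-\<^sup>\<theta> \<mu>\<^sub>t\<^sup>-\<^sup>\<theta> + (1 - \<mu>\<^sub>t\<^sup>-\<^sup>\<theta>) / (1 + \<theta>) + V\<^sub>t\<close>.
Everything else is read off from this formula.

The rates are only measurable and the infinitesimal description is given in integrated form, so the
differential equation is replaced by estimates that are quadratic in the increment
\<open>L u - L s\<close> of the cumulative rate. Splitting \<open>F s u\<close> according to the first change of state, and
using that a second change in \<open>(s, u]\<close> costs another factor \<open>L u - L s\<close>, gives the expansion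
\<open>F_expansion\<close>; its only subtle point is to restart the process at the random time of the first
change, which is done by approximating that time from the right by deterministic grid points and using
right-continuity of the paths (\<open>second_jump_estimate\<close>). A function whose increments are bounded by
squares of the increments of a continuous monotone clock is constant
(\<open>square_small_increments_imp_const\<close>). Together with a sum rule and a chain rule
for such increments this turns the heuristic solution of the differential equation into a proof.

Consequences: letting \<open>x\<close> tend to 1 gives the mean; \<open>x = 0\<close> gives the extinction probability. If
\<open>q < 1\<close>, the formula at \<open>x = 0\<close> bounds \<open>V\<close>; if the mean tends to infinity, \<open>\<mu>\<^sub>t \<le> exp (L t / \<theta>)\<close> forces
\<open>\<Lambda> = \<infinity>\<close>. Conversely \<open>F \<ge> 0\<close> at \<open>x = 0\<close> says that \<open>\<mu>\<^sub>s\<^sup>-\<^sup>\<theta>\<close> is at most \<open>\<mu>\<^sub>t\<^sup>-\<^sup>\<theta>\<close> plus the integral of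
\<open>\<mu>\<^sup>-\<^sup>\<theta>\<close> over \<open>(s, t]\<close>; if that integral converges although \<open>\<Lambda> = \<infinity>\<close>, then \<open>\<mu>\<^sup>-\<^sup>\<theta>\<close> cannot stay away from 0.

For the almost sure limit one chooses \<open>y t\<close> with \<open>F s t (y t) = y s\<close> and \<open>\<mu>\<^sub>t (1 - y t) \<longlongrightarrow> 1\<close>. Then
\<open>y t ^ Z t\<close> is a bounded martingale, which converges by the Kolmogorov maximal inequality, and
\<open>Z t / \<mu>\<^sub>t\<close> is asymptotically minus its logarithm. The limit is finite by Fatou's lemma, and its Laplace
transform is the limit of \<open>F 0 t (exp (- w / \<mu>\<^sub>t))\<close>.\<close>

section \<open>Functions with second-order small increments\<close>

lemma exp_minus_second_order:
  assumes "0 \<le> (x::real)" shows "\<bar>exp (- x) - (1 - x)\<bar> \<le> x^2"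
proof -
  have "1 + - x \<le> exp (- x)" by (rule exp_ge_add_one_self)
  moreover have "exp (- x) \<le> 1 - x + x^2"
  proof -
    have "(1 + x) * exp (- x) \<le> exp x * exp (- x)"
      by (intro mult_right_mono exp_ge_add_one_self) auto
    also have "\<dots> = 1" by (simp flip: exp_add)
    also have "1 \<le> (1 + x) * (1 - x + x^2)"
      using zero_le_power[OF assms, of 3] by (simp add: algebra_simps power2_eq_square power3_eq_cube)
    finally show ?thesis using assms by simp
  qed
  ultimately show ?thesis by linarith
qed

text \<open>Cut \<open>[a, b]\<close> into \<open>n\<close> pieces of equal \<open>L\<close>-length \<open>d / n\<close>. The increments of \<open>X\<close> over them sum
to at most \<open>n C (d / n)\<^sup>2\<close>, which tends to 0. Continuity of \<open>L\<close> provides the cutting points. This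
replaces the statement that an absolutely continuous function with derivative 0 almost everywhere is
constant.\<close>

lemma square_small_increments_imp_const:
  fixes L X :: "real \<Rightarrow> real"
  assumes ab: "a \<le> b" and cont: "continuous_on {a..b} L" and mono: "mono_on {a..b} L"
    and small: "\<And>s u. a \<le> s \<Longrightarrow> s \<le> u \<Longrightarrow> u \<le> b \<Longrightarrow> \<bar>X s - X u\<bar> \<le> C * (L u - L s)^2"
  shows "X a = X b"
proof (cases "L a = L b")
  case True
  then show ?thesis using small[of a b] ab by simp
next
  case False
  with mono ab have less: "L a < L b" by (auto simp: mono_on_def order.strict_iff_order)
  define d where "d = L b - L a"
  have d0: "d > 0" using less by (simp add: d_def)
  have bound: "\<bar>X a - X b\<bar> \<le> C * d^2 / real (Suc n)" for n
  proof -
    define N where "N = real (Suc n)"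
    have N0: "N > 0" by (simp add: N_def)
    have "\<exists>s. s \<in> {a..b} \<and> L s = L a + d * real i / N" if "i \<le> Suc n" for i
    proof -
      have "d * (real i / N) \<le> d * 1" using that d0 N0 by (intro mult_left_mono) (auto simp: N_def)
      then have "L a + d * real i / N \<le> L b" by (simp add: d_def)
      moreover have "L a \<le> L a + d * real i / N" using d0 N0 by simp
      ultimately show ?thesis using IVT'[of L a "L a + d * real i / N" b] ab cont by auto
    qed
    then obtain s where s: "\<And>i. i \<le> Suc n \<Longrightarrow> s i \<in> {a..b} \<and> L (s i) = L a + d * real i / N"
      by metis
    have step: "\<bar>X (s i) - X (s (Suc i))\<bar> \<le> C * (d / N)^2" if "i < Suc n" for i
    proof -
      have 1: "s i \<in> {a..b}" "s (Suc i) \<in> {a..b}" using s that by auto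
      have 2: "L (s (Suc i)) - L (s i) = d / N"
        using s[of i] s[of "Suc i"] that by (simp add: distrib_left add_divide_distrib)
      then have "L (s i) < L (s (Suc i))" using d0 N0 by (smt (verit) divide_pos_pos)
      then have "s i \<le> s (Suc i)" using mono_onD[OF mono 1(2,1)] by linarith
      then show ?thesis using small[of "s i" "s (Suc i)"] 1 2 by simp
    qed
    have "\<bar>X (s 0) - X (s k)\<bar> \<le> real k * (C * (d / N)^2)" if "k \<le> Suc n" for k
      using that
    proof (induction k)
      case (Suc k)
      then show ?case using step[of k] by (simp add: algebra_simps)
    qed simp
    from this[of "Suc n"] have 3: "\<bar>X (s 0) - X (s (Suc n))\<bar> \<le> N * (C * (d / N)^2)" by (simp add: N_def)
    have "X a = X (s 0)" using small[of a "s 0"] s[of 0] by simp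
    moreover have "X (s (Suc n)) = X b"
    proof -
      have "L (s (Suc n)) = L b" using s[of "Suc n"] N0 by (simp add: d_def N_def del: of_nat_Suc)
      then show ?thesis using small[of "s (Suc n)" b] s[of "Suc n"] by simp
    qed
    ultimately show ?thesis using 3 N0 unfolding N_def[symmetric]
      by (simp add: power2_eq_square field_simps)
  qed
  have "(\<lambda>n. C * d^2 / real (Suc n)) \<longlonglongrightarrow> 0"
    by (rule LIMSEQ_Suc, rule lim_const_over_n)
  then have "\<bar>X a - X b\<bar> \<le> 0" by (rule LIMSEQ_le_const) (use bound in auto)
  then show ?thesis by simp
qed

text \<open>The role of \<open>H\<close> is that of the differential \<open>- dX\<close>, with order measured by the clock \<open>L\<close>:
\<open>H s u\<close> is of first order and the error of second order, uniformly on \<open>[0, t]\<close>. The sign is chosen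
because the equation to be solved runs backwards in time.\<close>

definition has_increments :: "(real \<Rightarrow> real) \<Rightarrow> real \<Rightarrow> (real \<Rightarrow> real) \<Rightarrow> (real \<Rightarrow> real \<Rightarrow> real) \<Rightarrow> bool" where
  "has_increments L t X H \<longleftrightarrow> (\<exists>C. \<forall>s u. 0 \<le> s \<and> s \<le> u \<and> u \<le> t \<longrightarrow>
     \<bar>X s - X u - H s u\<bar> \<le> C * (L u - L s)^2 \<and> \<bar>H s u\<bar> \<le> C * (L u - L s))"

lemma has_incrementsI:
  assumes mono: "mono_on {0..t} L"
    and "\<And>s u. 0 \<le> s \<Longrightarrow> s \<le> u \<Longrightarrow> u \<le> t \<Longrightarrow> \<bar>X s - X u - H s u\<bar> \<le> C * (L u - L s)^2"
    and "\<And>s u. 0 \<le> s \<Longrightarrow> s \<le> u \<Longrightarrow> u \<le> t \<Longrightarrow> \<bar>H s u\<bar> \<le> D * (L u - L s)"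
  shows "has_increments L t X H"
  unfolding has_increments_def
proof (intro exI allI impI conjI)
  fix s u assume su: "0 \<le> s \<and> s \<le> u \<and> u \<le> t"
  then have "L s \<le> L u" using mono by (auto simp: mono_on_def)
  then show "\<bar>H s u\<bar> \<le> max C D * (L u - L s)"
    by (intro order.trans[OF assms(3)] mult_right_mono) (use su in auto)
  show "\<bar>X s - X u - H s u\<bar> \<le> max C D * (L u - L s)^2"
    by (intro order.trans[OF assms(2)] mult_right_mono) (use su in auto)
qed

lemma has_increments_add:
  assumes "has_increments L t X H" "has_increments L t Y K"
  shows "has_increments L t (\<lambda>s. X s + Y s) (\<lambda>s u. H s u + K s u)"
proof -
  from assms obtain C D where *:
   "\<And>s u. 0 \<le> s \<and> s \<le> u \<and> u \<le> t \<Longrightarrow> \<bar>X s - X u - H s u\<bar> \<le> C * (L u - L s)^2 \<and> \<bar>H s u\<bar> \<le> C * (L u - L s)"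
   "\<And>s u. 0 \<le> s \<and> s \<le> u \<and> u \<le> t \<Longrightarrow> \<bar>Y s - Y u - K s u\<bar> \<le> D * (L u - L s)^2 \<and> \<bar>K s u\<bar> \<le> D * (L u - L s)"
    unfolding has_increments_def by metis
  show ?thesis unfolding has_increments_def
  proof (rule exI[of _ "C + D"], intro allI impI)
    fix s u assume su: "0 \<le> s \<and> s \<le> u \<and> u \<le> t"
    show "\<bar>X s + Y s - (X u + Y u) - (H s u + K s u)\<bar> \<le> (C + D) * (L u - L s)^2 \<and>
        \<bar>H s u + K s u\<bar> \<le> (C + D) * (L u - L s)"
      using *(1)[OF su] *(2)[OF su] unfolding distrib_right by linarith
  qed
qed

lemma has_increments_cmult:
  assumes "has_increments L t X H"
  shows "has_increments L t (\<lambda>s. c * X s) (\<lambda>s u. c * H s u)"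
proof -
  from assms obtain C where *:
   "\<And>s u. 0 \<le> s \<and> s \<le> u \<and> u \<le> t \<Longrightarrow> \<bar>X s - X u - H s u\<bar> \<le> C * (L u - L s)^2 \<and> \<bar>H s u\<bar> \<le> C * (L u - L s)"
    unfolding has_increments_def by metis
  show ?thesis unfolding has_increments_def
  proof (rule exI[of _ "\<bar>c\<bar> * C"], intro allI impI conjI)
    fix s u assume "0 \<le> s \<and> s \<le> u \<and> u \<le> t"
    note * = *[OF this]
    have "\<bar>c\<bar> * \<bar>X s - X u - H s u\<bar> \<le> \<bar>c\<bar> * (C * (L u - L s)^2)" "\<bar>c\<bar> * \<bar>H s u\<bar> \<le> \<bar>c\<bar> * (C * (L u - L s))"
      using * by (auto intro: mult_left_mono)
    then show "\<bar>c * X s - c * X u - c * H s u\<bar> \<le> \<bar>c\<bar> * C * (L u - L s)^2"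
      "\<bar>c * H s u\<bar> \<le> \<bar>c\<bar> * C * (L u - L s)"
      by (simp_all add: mult.assoc flip: abs_mult right_diff_distrib)
  qed
qed

text \<open>The chain rule: the second-order remainder of the Taylor formula of \<open>\<phi>\<close> is of the same order as
the error that the definition tolerates.\<close>

lemma has_increments_chain:
  assumes mono: "mono_on {0..t} L" and X: "has_increments L t X H"
    and range: "\<And>s. 0 \<le> s \<Longrightarrow> s \<le> t \<Longrightarrow> X s \<in> {c..d}"
    and deriv: "\<And>x. x \<in> {c..d} \<Longrightarrow> (\<phi> has_real_derivative \<phi>' x) (at x)"
      "\<And>x. x \<in> {c..d} \<Longrightarrow> (\<phi>' has_real_derivative \<phi>'' x) (at x)"
    and bound: "\<And>x. x \<in> {c..d} \<Longrightarrow> \<bar>\<phi>' x\<bar> \<le> K" "\<And>x. x \<in> {c..d} \<Longrightarrow> \<bar>\<phi>'' x\<bar> \<le> K"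
  shows "has_increments L t (\<lambda>s. \<phi> (X s)) (\<lambda>s u. \<phi>' (X u) * H s u)"
proof -
  from X obtain C where *:
   "\<And>s u. 0 \<le> s \<Longrightarrow> s \<le> u \<Longrightarrow> u \<le> t \<Longrightarrow> \<bar>X s - X u - H s u\<bar> \<le> C * (L u - L s)^2"
   "\<And>s u. 0 \<le> s \<Longrightarrow> s \<le> u \<Longrightarrow> u \<le> t \<Longrightarrow> \<bar>H s u\<bar> \<le> C * (L u - L s)"
    unfolding has_increments_def by metis
  define D where "D = \<bar>C\<bar> + \<bar>C\<bar> * (L t - L 0)"
  \<comment> \<open>Two applications of the mean value theorem, in place of a Taylor formula for either order of
the two points.\<close>
  have taylor: "\<bar>\<phi> y - \<phi> x - \<phi>' x * (y - x)\<bar> \<le> K * (y - x)^2" if xy: "x \<in> {c..d}" "y \<in> {c..d}" for x y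
  proof -
    obtain z where z: "z \<in> {c..d}" "\<bar>z - x\<bar> \<le> \<bar>y - x\<bar>" "\<phi> y - \<phi> x = (y - x) * \<phi>' z"
    proof (cases x y rule: linorder_cases)
      case less
      have "\<exists>z>x. z < y \<and> \<phi> y - \<phi> x = (y - x) * \<phi>' z"
        by (rule MVT2) (use less deriv xy in auto)
      then obtain z where "x < z" "z < y" "\<phi> y - \<phi> x = (y - x) * \<phi>' z" by blast
      then show ?thesis using xy by (intro that[of z]) auto
    next
      case greater
      have "\<exists>z>y. z < x \<and> \<phi> x - \<phi> y = (x - y) * \<phi>' z"
        by (rule MVT2) (use greater deriv xy in auto)
      then obtain z where "y < z" "z < x" "\<phi> x - \<phi> y = (x - y) * \<phi>' z" by blast
      then show ?thesis using xy by (intro that[of z]) (auto simp: algebra_simps)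
    qed (use xy in \<open>auto intro: that\<close>)
    have "\<bar>\<phi>' z - \<phi>' x\<bar> \<le> K * \<bar>z - x\<bar>"
    proof -
      have "norm (\<phi>' z - \<phi>' x) \<le> K * norm (z - x)"
        by (rule field_differentiable_bound[of "{c..d}"])
           (use z(1) xy(1) deriv(2) bound(2) in \<open>auto intro: has_field_derivative_at_within\<close>)
      then show ?thesis by simp
    qed
    also have "\<dots> \<le> K * \<bar>y - x\<bar>" using z(2) bound(1)[OF xy(1)] by (intro mult_left_mono) auto
    finally have 1: "\<bar>y - x\<bar> * \<bar>\<phi>' z - \<phi>' x\<bar> \<le> \<bar>y - x\<bar> * (K * \<bar>y - x\<bar>)" by (rule mult_left_mono) simp
    have "\<phi> y - \<phi> x - \<phi>' x * (y - x) = (y - x) * (\<phi>' z - \<phi>' x)" using z(3) by (simp add: algebra_simps)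
    then show ?thesis using 1 by (simp add: abs_mult power2_eq_square mult_ac)
  qed
  show ?thesis
  proof (rule has_incrementsI[OF mono, where C="K * D^2 + K * \<bar>C\<bar>" and D="K * \<bar>C\<bar>"])
    fix s u assume su: "0 \<le> s" "s \<le> u" "u \<le> t"
    let ?d = "L u - L s"
    have d: "0 \<le> ?d" "?d \<le> L t - L 0"
      using mono su by (auto simp: mono_on_def intro!: diff_mono)
    have K: "K \<ge> 0" using bound(1)[OF range[of s]] su by auto
    have H: "\<bar>H s u\<bar> \<le> \<bar>C\<bar> * ?d" using *(2)[OF su] d(1) mult_right_mono[OF abs_ge_self[of C] d(1)] by linarith
    have E: "\<bar>X s - X u - H s u\<bar> \<le> \<bar>C\<bar> * ?d^2"
      using *(1)[OF su] mult_right_mono[OF abs_ge_self[of C] zero_le_power2[of ?d]] by linarith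
    have "?d^2 \<le> (L t - L 0) * ?d" unfolding power2_eq_square using d by (intro mult_right_mono)
    then have "\<bar>C\<bar> * ?d^2 \<le> \<bar>C\<bar> * ((L t - L 0) * ?d)" by (rule mult_left_mono) simp
    then have "\<bar>X s - X u\<bar> \<le> D * ?d" using H E unfolding D_def distrib_right mult.assoc by linarith
    then have "\<bar>X s - X u\<bar>^2 \<le> (D * ?d)^2" by (intro power_mono) auto
    then have sq: "K * (X s - X u)^2 \<le> K * (D^2 * ?d^2)"
      using K unfolding power_mult_distrib by (intro mult_left_mono) auto
    have b: "\<bar>\<phi>' (X u)\<bar> \<le> K" by (rule bound, rule range) (use su in auto)
    have t: "\<bar>\<phi> (X s) - \<phi> (X u) - \<phi>' (X u) * (X s - X u)\<bar> \<le> K * (X s - X u)^2"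
      by (rule taylor; rule range) (use su in auto)
    have "\<bar>\<phi>' (X u) * (X s - X u - H s u)\<bar> \<le> K * (\<bar>C\<bar> * ?d^2)"
      unfolding abs_mult using b E K by (intro mult_mono) auto
    then show "\<bar>\<phi> (X s) - \<phi> (X u) - \<phi>' (X u) * H s u\<bar> \<le> (K * D^2 + K * \<bar>C\<bar>) * ?d^2"
      using t sq unfolding distrib_right right_diff_distrib mult.assoc by linarith
    show "\<bar>\<phi>' (X u) * H s u\<bar> \<le> K * \<bar>C\<bar> * ?d"
      unfolding abs_mult mult.assoc using b H K by (intro mult_mono) auto
  qed
qed

lemma has_increments_0_imp_const:
  assumes "0 \<le> t" "continuous_on {0..t} L" "mono_on {0..t} L"
    and X: "has_increments L t X H" and H: "\<And>s u. 0 \<le> s \<Longrightarrow> s \<le> u \<Longrightarrow> u \<le> t \<Longrightarrow> H s u = 0"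
    and s: "0 \<le> s" "s \<le> t"
  shows "X s = X t"
proof -
  from X H obtain C where
    C: "\<And>s u. 0 \<le> s \<Longrightarrow> s \<le> u \<Longrightarrow> u \<le> t \<Longrightarrow> \<bar>X s - X u\<bar> \<le> C * (L u - L s)^2"
    unfolding has_increments_def by (metis (no_types, opaque_lifting) diff_zero)
  show ?thesis
    by (rule square_small_increments_imp_const[OF s(2), of L X C])
       (use assms C in \<open>auto intro: continuous_on_subset mono_on_subset\<close>)
qed

text \<open>The two instances of the chain rule that solve the Bernoulli equation are the logarithm and the
exponential; both need a compact range on which their derivatives are bounded.\<close>

lemma has_increments_exp:
  assumes mono: "mono_on {0..t} L" and X: "has_increments L t X H"
    and bound: "\<And>s. 0 \<le> s \<Longrightarrow> s \<le> t \<Longrightarrow> \<bar>X s\<bar> \<le> c" and k: "\<bar>k\<bar> \<le> 1"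
  shows "has_increments L t (\<lambda>s. exp (k * X s)) (\<lambda>s u. k * exp (k * X u) * H s u)"
proof (rule has_increments_chain[OF mono X, where c="-c" and d=c and \<phi>''="\<lambda>x. k * (k * exp (k * x))" and K="exp c"])
  fix x assume x: "x \<in> {-c..c}"
  have "\<bar>k * x\<bar> \<le> 1 * c" unfolding abs_mult using x k by (intro mult_mono) auto
  then have e: "exp (k * x) \<le> exp c" by simp
  show "\<bar>k * exp (k * x)\<bar> \<le> exp c"
    using mult_mono[OF k e] by (simp add: abs_mult)
  then show "\<bar>k * (k * exp (k * x))\<bar> \<le> exp c"
    using mult_mono[OF k, of "\<bar>k * exp (k * x)\<bar>" "exp c"] by (simp add: abs_mult)
qed (use bound in \<open>force intro!: derivative_eq_intros simp: abs_le_iff\<close>)+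

lemma has_increments_ln:
  assumes mono: "mono_on {0..t} L" and X: "has_increments L t X H"
    and bound: "\<And>s. 0 \<le> s \<Longrightarrow> s \<le> t \<Longrightarrow> X s \<in> {c..1}" and c: "0 < c" "c \<le> 1"
  shows "has_increments L t (\<lambda>s. ln (X s)) (\<lambda>s u. inverse (X u) * H s u)"
proof (rule has_increments_chain[OF mono X bound, where \<phi>''="\<lambda>x. - (inverse x * inverse x)" and K="inverse c * inverse c"])
  fix x assume x: "x \<in> {c..1}"
  have i: "inverse x \<le> inverse c" "0 < inverse x" "1 \<le> inverse c" using x c by (auto simp: field_simps)
  show "\<bar>inverse x\<bar> \<le> inverse c * inverse c" using mult_mono[OF i(1) i(3)] i c by simp
  show "\<bar>- (inverse x * inverse x)\<bar> \<le> inverse c * inverse c" using mult_mono[OF i(1) i(1)] i c by simp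
  show "(ln has_real_derivative inverse x) (at x)"
    using x c by (intro DERIV_ln) auto
  show "(inverse has_real_derivative - (inverse x * inverse x)) (at x)"
    using x c DERIV_inverse[of x] by (simp add: power2_eq_square inverse_mult_distrib numeral_2_eq_2)
qed auto

lemma has_increments_imp_lipschitz:
  assumes mono: "mono_on {0..t} L" and X: "has_increments L t X H"
  obtains K where "\<And>s u. 0 \<le> s \<Longrightarrow> s \<le> u \<Longrightarrow> u \<le> t \<Longrightarrow> \<bar>X s - X u\<bar> \<le> K * (L u - L s)" "K \<ge> 0"
proof -
  from X obtain C where C:
   "\<And>s u. 0 \<le> s \<Longrightarrow> s \<le> u \<Longrightarrow> u \<le> t \<Longrightarrow> \<bar>X s - X u - H s u\<bar> \<le> C * (L u - L s)^2"
   "\<And>s u. 0 \<le> s \<Longrightarrow> s \<le> u \<Longrightarrow> u \<le> t \<Longrightarrow> \<bar>H s u\<bar> \<le> C * (L u - L s)"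
    unfolding has_increments_def by metis
  show ?thesis
  proof (rule that[of "\<bar>C\<bar> * \<bar>L t - L 0\<bar> + \<bar>C\<bar>"])
    fix s u assume su: "0 \<le> s" "s \<le> u" "u \<le> t"
    have d: "0 \<le> L u - L s" "L u - L s \<le> \<bar>L t - L 0\<bar>"
      using mono_onD[OF mono, of s u] mono_onD[OF mono, of 0 s] mono_onD[OF mono, of u t] su by auto
    have "C * (L u - L s)^2 \<le> \<bar>C\<bar> * (\<bar>L t - L 0\<bar> * (L u - L s))"
      unfolding power2_eq_square using d by (intro mult_mono mult_right_mono) auto
    moreover have "C * (L u - L s) \<le> \<bar>C\<bar> * (L u - L s)" using d by (intro mult_right_mono) auto
    ultimately show "\<bar>X s - X u\<bar> \<le> (\<bar>C\<bar> * \<bar>L t - L 0\<bar> + \<bar>C\<bar>) * (L u - L s)"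
      using C[OF su] unfolding distrib_right mult.assoc by linarith
  qed auto
qed

section \<open>Integration against the cumulative rate\<close>

locale rate =
  fixes lam :: "real \<Rightarrow> real"
  assumes lam_measurable: "lam \<in> borel_measurable (restrict_space borel {0..})"
    and lam_nonneg: "t \<ge> 0 \<Longrightarrow> lam t \<ge> 0"
    and Lam_finite: "t \<ge> 0 \<Longrightarrow> Lam lam t < \<infinity>"
begin

text \<open>Integrands for which \<open>\<integral> g d\<Lambda>\<close> exists over every bounded interval. Nothing is asked on the
negative half-line, where the parameters of the process are arbitrary.\<close>

definition admissible :: "(real \<Rightarrow> real) \<Rightarrow> bool" where
  "admissible g \<longleftrightarrow> set_borel_measurable lborel {0..} g \<and> (\<forall>t. \<exists>C. \<forall>u\<in>{0..t}. \<bar>g u\<bar> \<le> C)"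

text \<open>This is \<open>\<integral> g d\<Lambda>\<close> over \<open>[s, t]\<close>, so that \<open>L\<close> below is \<open>\<Lambda>\<close> as a real-valued function.\<close>

definition Lint :: "(real \<Rightarrow> real) \<Rightarrow> real \<Rightarrow> real \<Rightarrow> real" where
  "Lint g s t = (LINT u:{s..t}|lborel. g u * lam u)"

definition L :: "real \<Rightarrow> real" where
  "L t = Lint (\<lambda>_. 1) 0 t"

lemma lam_set_borel_measurable: "set_borel_measurable lborel {0..} lam"
  using lam_measurable unfolding set_borel_measurable_def
  by (subst (asm) borel_measurable_restrict_space_iff) auto

lemma set_borel_measurable_times:
  fixes f g :: "real \<Rightarrow> real"
  assumes "set_borel_measurable N A f" "set_borel_measurable N A g"
  shows "set_borel_measurable N A (\<lambda>x. f x * g x)"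
proof -
  have "(\<lambda>x. indicator A x *\<^sub>R (f x * g x)) = (\<lambda>x. (indicator A x *\<^sub>R f x) * (indicator A x *\<^sub>R g x))"
    by (auto simp: fun_eq_iff indicator_def)
  then show ?thesis using assms unfolding set_borel_measurable_def by simp
qed

lemma lam_set_integrable:
  assumes "0 \<le> s" shows "set_integrable lborel {s..t} lam"
proof (cases "0 \<le> t")
  case True
  have m: "set_borel_measurable lborel {s..t} lam"
    by (rule set_borel_measurable_subset[OF lam_set_borel_measurable]) (use assms in auto)
  have "(\<integral>\<^sup>+u. ennreal (norm (indicator {s..t} u *\<^sub>R lam u)) \<partial>lborel) \<le> Lam lam t"
    unfolding Lam_def
    by (rule nn_integral_mono) (use assms lam_nonneg in \<open>auto split: split_indicator\<close>)
  then show ?thesis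
    unfolding set_integrable_def integrable_iff_bounded
    using m Lam_finite[OF True] by (auto simp: set_borel_measurable_def intro: le_less_trans)
next
  case False
  then have "{s..t} = {}" using assms by auto
  then show ?thesis by (simp add: set_integrable_def)
qed

lemma admissibleI:
  assumes "set_borel_measurable lborel {0..} g" "\<And>t. \<exists>C. \<forall>u\<in>{0..t}. \<bar>g u\<bar> \<le> C"
  shows "admissible g"
  using assms unfolding admissible_def by blast

lemma admissible_continuous:
  assumes "continuous_on {0..} g" shows "admissible g"
proof (rule admissibleI)
  show "set_borel_measurable lborel {0..} g"
    using borel_measurable_continuous_on_indicator[OF _ assms] unfolding set_borel_measurable_def
    by simp
  fix t :: real
  have "compact (g ` {0..t})"
    by (rule compact_continuous_image) (use assms in \<open>auto intro: continuous_on_subset\<close>)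
  then show "\<exists>C. \<forall>u\<in>{0..t}. \<bar>g u\<bar> \<le> C"
    by (auto dest!: compact_imp_bounded simp: bounded_iff)
qed

lemma admissible_const: "admissible (\<lambda>_. c)"
  by (rule admissible_continuous) simp

lemma admissible_mult:
  assumes "admissible f" "admissible g" shows "admissible (\<lambda>u. f u * g u)"
proof (rule admissibleI)
  show "set_borel_measurable lborel {0..} (\<lambda>u. f u * g u)"
    using assms by (intro set_borel_measurable_times) (auto simp: admissible_def)
  fix t :: real
  obtain C D where "\<forall>u\<in>{0..t}. \<bar>f u\<bar> \<le> C" "\<forall>u\<in>{0..t}. \<bar>g u\<bar> \<le> D"
    using assms unfolding admissible_def by metis
  then have "\<bar>f u * g u\<bar> \<le> \<bar>C\<bar> * \<bar>D\<bar>" if "u \<in> {0..t}" for u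
    unfolding abs_mult using that by (intro mult_mono) force+
  then show "\<exists>C. \<forall>u\<in>{0..t}. \<bar>f u * g u\<bar> \<le> C" by blast
qed

lemma admissible_add:
  assumes "admissible f" "admissible g" shows "admissible (\<lambda>u. f u + g u)"
proof (rule admissibleI)
  show "set_borel_measurable lborel {0..} (\<lambda>u. f u + g u)"
    using assms unfolding admissible_def set_borel_measurable_def scaleR_add_right
    by (auto intro: borel_measurable_add)
  fix t :: real
  obtain C D where "\<forall>u\<in>{0..t}. \<bar>f u\<bar> \<le> C" "\<forall>u\<in>{0..t}. \<bar>g u\<bar> \<le> D"
    using assms unfolding admissible_def by metis
  then have "\<bar>f u + g u\<bar> \<le> C + D" if "u \<in> {0..t}" for u
    using that by force
  then show "\<exists>C. \<forall>u\<in>{0..t}. \<bar>f u + g u\<bar> \<le> C" by blast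
qed

lemma admissible_integrable:
  assumes g: "admissible g" and s: "0 \<le> s"
  shows "set_integrable lborel {s..t} (\<lambda>u. g u * lam u)"
proof -
  obtain C where C: "\<forall>u\<in>{0..t}. \<bar>g u\<bar> \<le> C" using g unfolding admissible_def by blast
  have m: "set_borel_measurable lborel {s..t} (\<lambda>u. g u * lam u)"
    by (rule set_borel_measurable_subset[OF set_borel_measurable_times[OF _ lam_set_borel_measurable]])
       (use g s in \<open>auto simp: admissible_def\<close>)
  show ?thesis
  proof (rule set_integrable_bound[where f="\<lambda>u. C * lam u"])
    show "set_integrable lborel {s..t} (\<lambda>u. C * lam u)"
      using lam_set_integrable[OF s] by simp
    show "AE u in lborel. u \<in> {s..t} \<longrightarrow> norm (g u * lam u) \<le> norm (C * lam u)"
    proof (intro AE_I2 impI)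
      fix u assume "u \<in> {s..t}"
      then have "\<bar>g u\<bar> \<le> C" using C s by auto
      then have "\<bar>g u\<bar> \<le> \<bar>C\<bar>" by simp
      then show "norm (g u * lam u) \<le> norm (C * lam u)"
        by (simp add: abs_mult mult_right_mono)
    qed
  qed (use m in auto)
qed

lemma Lint_split:
  assumes "admissible g" "0 \<le> s" "s \<le> u" "u \<le> t"
  shows "Lint g s t = Lint g s u + Lint g u t"
proof -
  have "{s..t} = {s..u} \<union> {u..t}" using assms by auto
  moreover have "AE x in lborel. \<not> (x \<in> {s..u} \<and> x \<in> {u..t})"
    using AE_lborel_singleton[of u] by eventually_elim auto
  ultimately show ?thesis unfolding Lint_def using assms
    by (simp add: set_integral_Un_AE admissible_integrable)
qed

lemma Lint_mono:
  assumes "admissible f" "admissible g" "0 \<le> s"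
    and "\<And>u. s \<le> u \<Longrightarrow> u \<le> t \<Longrightarrow> f u \<le> g u"
  shows "Lint f s t \<le> Lint g s t"
  unfolding Lint_def
  by (rule set_integral_mono[OF admissible_integrable admissible_integrable])
     (use assms lam_nonneg in \<open>auto intro!: mult_right_mono\<close>)

lemma Lint_add:
  assumes "admissible f" "admissible g" "0 \<le> s"
  shows "Lint (\<lambda>u. f u + g u) s t = Lint f s t + Lint g s t"
  unfolding Lint_def using assms
  by (simp add: distrib_right set_integral_add admissible_integrable)

lemma Lint_cmult: "Lint (\<lambda>u. c * f u) s t = c * Lint f s t"
  unfolding Lint_def by (simp add: mult.assoc)

lemma Lint_self: "Lint g s s = 0" if "admissible g" "0 \<le> s"
  using Lint_split[OF that, of s s] by simp

lemma L_diff: "0 \<le> s \<Longrightarrow> s \<le> t \<Longrightarrow> Lint (\<lambda>_. 1) s t = L t - L s"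
  using Lint_split[of "\<lambda>_. 1" 0 s t] by (simp add: L_def admissible_const)

lemma Lint_const: "0 \<le> s \<Longrightarrow> s \<le> t \<Longrightarrow> Lint (\<lambda>_. c) s t = c * (L t - L s)"
  using Lint_cmult[of c "\<lambda>_. 1" s t] L_diff by simp

lemma Lint_bound:
  assumes g: "admissible g" and "0 \<le> s" "s \<le> t" and "\<And>u. s \<le> u \<Longrightarrow> u \<le> t \<Longrightarrow> \<bar>g u\<bar> \<le> C"
  shows "\<bar>Lint g s t\<bar> \<le> C * (L t - L s)"
proof -
  have "Lint g s t \<le> Lint (\<lambda>_. C) s t" "Lint (\<lambda>_. - C) s t \<le> Lint g s t"
    by (rule Lint_mono; use assms admissible_const in force)+
  then show ?thesis using assms Lint_const by (simp add: abs_le_iff)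
qed

lemma Lint_nonneg:
  assumes "admissible g" "0 \<le> s" "\<And>u. s \<le> u \<Longrightarrow> u \<le> t \<Longrightarrow> 0 \<le> g u"
  shows "0 \<le> Lint g s t"
  using Lint_mono[of "\<lambda>_. 0" g s t] assms by (simp add: admissible_const Lint_def)

lemma Lint_near_const:
  assumes g: "admissible g" and st: "0 \<le> s" "s \<le> t" and "\<And>u. s \<le> u \<Longrightarrow> u \<le> t \<Longrightarrow> \<bar>g u - c\<bar> \<le> C"
  shows "\<bar>Lint g s t - c * (L t - L s)\<bar> \<le> C * (L t - L s)"
proof -
  have "Lint (\<lambda>u. g u + - c) s t = Lint g s t - c * (L t - L s)"
    using Lint_add[OF g admissible_const, of s "- c" t] Lint_const[OF st, of "-c"] st by simp
  then show ?thesis using Lint_bound[OF admissible_add[OF g admissible_const], of s t "-c" C] assms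
    by simp
qed

lemma Lint_continuous:
  assumes g: "admissible g"
  shows "continuous_on {0..} (Lint g 0)"
proof -
  have "continuous_on {0..b} (Lint g 0)" for b
  proof -
    have i: "(\<lambda>u. g u * lam u) integrable_on {0..b}"
      using set_borel_integral_eq_integral(1)[OF admissible_integrable[OF g]] by simp
    have "Lint g 0 t = integral {0..t} (\<lambda>u. g u * lam u)" for t
      unfolding Lint_def using set_borel_integral_eq_integral(2)[OF admissible_integrable[OF g]] by simp
    then show ?thesis using indefinite_integral_continuous_1[OF i] by presburger
  qed
  then have c: "continuous (at t within {0..t+1}) (Lint g 0)" if "t \<ge> 0" for t
    using that by (simp add: continuous_on_eq_continuous_within)
  show ?thesis unfolding continuous_on_eq_continuous_within
  proof
    fix t :: real assume "t \<in> {0..}"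
    moreover have "at t within {0..t+1} = at t within {0..}"
      by (rule at_within_nhd[of _ "{..<t+1}"]) auto
    ultimately show "continuous (at t within {0..}) (Lint g 0)" using c[of t] by simp
  qed
qed

lemma L_continuous: "continuous_on {0..} L"
  unfolding L_def using Lint_continuous[OF admissible_const] by simp

lemma L_mono: "0 \<le> s \<Longrightarrow> s \<le> t \<Longrightarrow> L s \<le> L t"
  using Lint_nonneg[OF admissible_const, of s t 1] L_diff[of s t] by simp

lemma L_mono_on: "A \<subseteq> {0..} \<Longrightarrow> mono_on A L"
  by (auto intro!: mono_onI L_mono)

lemma L_0: "L 0 = 0"
  unfolding L_def using Lint_self admissible_const by simp

lemma L_nonneg: "0 \<le> t \<Longrightarrow> 0 \<le> L t"
  using L_mono[of 0 t] L_0 by simp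

lemma Lint_eq_nn_integral:
  assumes g: "admissible g" "\<And>u. 0 \<le> u \<Longrightarrow> 0 \<le> g u" and s: "0 \<le> s"
  shows "(\<integral>\<^sup>+u\<in>{s..t}. ennreal (g u * lam u) \<partial>lborel) = ennreal (Lint g s t)"
proof -
  have "(\<integral>\<^sup>+u. ennreal (indicator {s..t} u *\<^sub>R (g u * lam u)) \<partial>lborel) = ennreal (Lint g s t)"
    unfolding Lint_def set_lebesgue_integral_def
    by (rule nn_integral_eq_integral)
       (use admissible_integrable[OF g(1) s] s g lam_nonneg in \<open>auto simp: set_integrable_def split: split_indicator\<close>)
  moreover have "ennreal (indicator {s..t} u *\<^sub>R (g u * lam u)) = ennreal (g u * lam u) * indicator {s..t} u" for u
    by (auto split: split_indicator)
  ultimately show ?thesis by simp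
qed

lemma Lam_eq: "Lam lam t = ennreal (L t)"
  using Lint_eq_nn_integral[OF admissible_const, of 1 0 t] by (simp add: Lam_def L_def)

lemma Lam_incr_eq: "0 \<le> s \<Longrightarrow> s \<le> t \<Longrightarrow> Lam_incr lam s t = L t - L s"
  by (simp add: Lam_incr_def Lam_eq L_nonneg)

lemma admissible_exp_L: "admissible (\<lambda>u. exp (- (L u - L s)))"
  by (rule admissible_continuous) (intro continuous_intros L_continuous)

text \<open>The lifetime density integrates to the lifetime distribution function. Both sides have the same
first-order increment, so their difference is constant.\<close>

lemma Lint_exp_L:
  assumes st: "0 \<le> s" "s \<le> t"
  shows "Lint (\<lambda>u. exp (- (L u - L s))) s t = 1 - exp (- (L t - L s))"
proof -
  let ?e = "\<lambda>u. exp (- (L u - L s))"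
  define X where "X = (\<lambda>u. Lint ?e s u + ?e u)"
  have "X s = X t"
  proof (rule square_small_increments_imp_const[OF st(2), of L _ 2])
    show "continuous_on {s..t} L" using L_continuous st by (auto intro: continuous_on_subset)
    show "mono_on {s..t} L" using st by (intro L_mono_on) auto
    fix r u assume ru: "s \<le> r" "r \<le> u" "u \<le> t"
    have d: "L s \<le> L r" "L r \<le> L u" using L_mono st ru by auto
    have *: "\<bar>?e v - ?e r\<bar> \<le> L u - L r" if "r \<le> v" "v \<le> u" for v
    proof -
      have v: "L r \<le> L v" "L v \<le> L u" using L_mono st ru that by auto
      have "?e v = ?e r * exp (- (L v - L r))" by (simp flip: exp_add)
      then have "?e r - ?e v = ?e r * (1 - exp (- (L v - L r)))" by (simp add: algebra_simps)
      also have "\<dots> \<le> 1 * (L v - L r)"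
        using exp_ge_add_one_self[of "-(L v - L r)"] v d by (intro mult_mono) (auto simp: algebra_simps)
      finally have "?e r - ?e v \<le> L v - L r" by simp
      moreover have "?e v \<le> ?e r" using v by simp
      ultimately show ?thesis using v by simp
    qed
    have 1: "\<bar>Lint ?e r u - ?e r * (L u - L r)\<bar> \<le> (L u - L r) * (L u - L r)"
      by (rule Lint_near_const[OF admissible_exp_L]) (use st ru * in auto)
    have "\<bar>?e r - ?e u - ?e r * (L u - L r)\<bar> \<le> (L u - L r)^2"
    proof -
      let ?x = "L u - L r"
      have "?e r - ?e u - ?e r * ?x = ?e r * (1 - ?x - exp (- ?x))" by (simp add: algebra_simps flip: exp_add)
      also have "\<bar>\<dots>\<bar> \<le> 1 * ?x^2" unfolding abs_mult
      proof (intro mult_mono)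
        show "\<bar>1 - ?x - exp (- ?x)\<bar> \<le> ?x^2"
          using exp_minus_second_order[of ?x] d by (simp add: abs_le_iff)
      qed (use d in auto)
      finally show ?thesis by simp
    qed
    moreover have "X r - X u = - Lint ?e r u + (?e r - ?e u)"
      unfolding X_def using Lint_split[OF admissible_exp_L[of s], of s r u] st ru by simp
    ultimately show "\<bar>X r - X u\<bar> \<le> 2 * (L u - L r)^2"
      using 1 unfolding power2_eq_square by linarith
  qed
  then show ?thesis unfolding X_def using Lint_self[OF admissible_exp_L, of s s] st by simp
qed

end

section \<open>Generating functions and the Markov property\<close>

definition pgf :: "nat pmf \<Rightarrow> real \<Rightarrow> real" where
  "pgf P x = measure_pmf.expectation P (\<lambda>k. x ^ k)"

lemma pgf_integrable: "x \<in> {0..1} \<Longrightarrow> integrable (measure_pmf P) (\<lambda>k. x ^ k :: real)"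
  by (rule measure_pmf.integrable_const_bound[where B=1]) (auto simp: power_le_one)

lemma ennreal_pgf: "x \<in> {0..1} \<Longrightarrow> ennreal (pgf P x) = (\<integral>\<^sup>+k. ennreal (x ^ k) \<partial>measure_pmf P)"
  unfolding pgf_def by (subst nn_integral_eq_integral[OF pgf_integrable]) auto

lemma nn_integral_pmf_nat:
  fixes P :: "nat pmf"
  shows "(\<integral>\<^sup>+k. f k \<partial>measure_pmf P) = (\<Sum>k. ennreal (pmf P k) * f k)"
  by (simp add: nn_integral_measure_pmf nn_integral_count_space_nat)

lemma pgf_bounds: "x \<in> {0..1} \<Longrightarrow> pgf P x \<in> {0..1}"
  unfolding pgf_def using integral_mono[OF pgf_integrable[of x P], of "\<lambda>_. 1"]
  by (auto simp: power_le_one intro!: integral_nonneg_AE)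

text \<open>Independence of individuals in terms of generating functions: the descendants of \<open>n\<close>
individuals have the \<open>n\<close>-th power of the generating function of one.\<close>

lemma pgf_sum_list_replicate:
  assumes x: "x \<in> {0..1}"
  shows "pgf (map_pmf sum_list (replicate_pmf n P)) x = pgf P x ^ n"
proof -
  have "ennreal (pgf (map_pmf sum_list (replicate_pmf n P)) x) = ennreal (pgf P x ^ n)"
  proof (induction n)
    case 0
    show ?case using x by (simp add: ennreal_pgf)
  next
    case (Suc n)
    have "ennreal (pgf (map_pmf sum_list (replicate_pmf (Suc n) P)) x) =
      (\<integral>\<^sup>+k. ennreal (x ^ k) * (\<integral>\<^sup>+ys. ennreal (x ^ sum_list ys) \<partial>replicate_pmf n P) \<partial>P)"
      using x by (simp add: ennreal_pgf power_add ennreal_mult nn_integral_cmult)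
    also have "\<dots> = ennreal (pgf P x) * ennreal (pgf (map_pmf sum_list (replicate_pmf n P)) x)"
      using x by (simp add: ennreal_pgf nn_integral_multc)
    finally show ?case using pgf_bounds[OF x, of P] by (simp add: Suc.IH ennreal_mult)
  qed
  then show ?thesis using pgf_bounds[OF x] by (subst (asm) ennreal_inj) auto
qed

lemma pgf_tail:
  assumes y: "y \<in> {0..1}"
  shows "pgf P y - (\<Sum>j\<le>k. pmf P j * y ^ j) \<in> {0..y ^ Suc k}"
proof -
  have i: "integrable (measure_pmf P) (\<lambda>n. y ^ n * indicator A n)" for A
    by (rule measure_pmf.integrable_const_bound[where B=1]) (use y in \<open>auto simp: power_le_one split: split_indicator\<close>)
  have "pgf P y = measure_pmf.expectation P (\<lambda>n. y ^ n * indicator {..k} n + y ^ n * indicator {k<..} n)"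
    unfolding pgf_def by (rule Bochner_Integration.integral_cong) (auto split: split_indicator)
  also have "\<dots> = measure_pmf.expectation P (\<lambda>n. y ^ n * indicator {..k} n) +
      measure_pmf.expectation P (\<lambda>n. y ^ n * indicator {k<..} n)"
    by (rule Bochner_Integration.integral_add[OF i i])
  also have "measure_pmf.expectation P (\<lambda>n. y ^ n * indicator {..k} n) = (\<Sum>j\<le>k. pmf P j * y ^ j)"
    by (subst integral_measure_pmf_real[where A="{..k}"]) (auto simp: indicator_def mult.commute)
  finally have eq: "pgf P y - (\<Sum>j\<le>k. pmf P j * y ^ j) = measure_pmf.expectation P (\<lambda>n. y ^ n * indicator {k<..} n)"
    by simp
  have "measure_pmf.expectation P (\<lambda>n. y ^ n * indicator {k<..} n) \<le> measure_pmf.expectation P (\<lambda>n. y ^ Suc k)"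
    by (rule integral_mono[OF i]) (use y in \<open>auto split: split_indicator intro!: power_decreasing[of "Suc k", simplified]\<close>)
  moreover have "0 \<le> measure_pmf.expectation P (\<lambda>n. y ^ n * indicator {k<..} n)"
    by (rule integral_nonneg_AE) (use y in auto)
  ultimately show ?thesis unfolding eq by simp
qed

text \<open>The coefficients of a generating function are limits of expressions that involve only its values
and the previous coefficients. Hence they inherit measurability in a parameter from the values, which
is how \<open>pmf_admissible\<close> below is obtained.\<close>

lemma pmf_eq_lim_pgf:
  "(\<lambda>n. (pgf P (inverse (real (Suc n))) - (\<Sum>j<k. pmf P j * inverse (real (Suc n)) ^ j)) / inverse (real (Suc n)) ^ k)
     \<longlonglongrightarrow> pmf P k"
proof (rule real_tendsto_sandwich[where f="\<lambda>_. pmf P k" and h="\<lambda>n. pmf P k + inverse (real (Suc n))"])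
  have *: "(pgf P y - (\<Sum>j<k. pmf P j * y ^ j)) / y ^ k \<in> {pmf P k .. pmf P k + y}" if y: "0 < y" "y \<le> 1" for y
  proof -
    have "pgf P y - (\<Sum>j<k. pmf P j * y ^ j) \<in> {pmf P k * y ^ k .. (pmf P k + y) * y ^ k}"
      using pgf_tail[of y P k] y by (simp add: lessThan_Suc_atMost[symmetric] algebra_simps)
    then show ?thesis using y by (simp add: field_simps)
  qed
  have "inverse (real (Suc n)) \<le> 1" for n by (simp add: field_simps)
  then show "\<forall>\<^sub>F n in sequentially. pmf P k \<le> (pgf P (inverse (real (Suc n))) - (\<Sum>j<k. pmf P j * inverse (real (Suc n)) ^ j)) / inverse (real (Suc n)) ^ k"
    "\<forall>\<^sub>F n in sequentially. (pgf P (inverse (real (Suc n))) - (\<Sum>j<k. pmf P j * inverse (real (Suc n)) ^ j)) / inverse (real (Suc n)) ^ k \<le> pmf P k + inverse (real (Suc n))"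
    using *[of "inverse (real (Suc _))"] by (auto intro!: always_eventually simp del: of_nat_Suc)
  show "(\<lambda>n. pmf P k + inverse (real (Suc n))) \<longlonglongrightarrow> pmf P k"
    using tendsto_add[OF tendsto_const LIMSEQ_inverse_real_of_nat] by simp
qed simp

lemma nn_integral_nat_valued:
  fixes N :: "'a \<Rightarrow> nat" and f :: "nat \<Rightarrow> ennreal"
  assumes [measurable]: "\<And>j. {\<omega>\<in>A. N \<omega> = j} \<in> sets M"
  shows "(\<integral>\<^sup>+\<omega>. indicator A \<omega> * f (N \<omega>) \<partial>M) = (\<Sum>j. f j * emeasure M {\<omega>\<in>A. N \<omega> = j})"
proof -
  have "(\<integral>\<^sup>+\<omega>. indicator A \<omega> * f (N \<omega>) \<partial>M) = (\<integral>\<^sup>+\<omega>. (\<Sum>j. f j * indicator {\<omega>\<in>A. N \<omega> = j} \<omega>) \<partial>M)"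
  proof (rule nn_integral_cong)
    fix \<omega>
    have "(\<Sum>j. f j * indicator {\<omega>\<in>A. N \<omega> = j} \<omega>) = (\<Sum>j\<in>{N \<omega>}. f j * indicator {\<omega>\<in>A. N \<omega> = j} \<omega>)"
      by (rule suminf_finite) auto
    then show "indicator A \<omega> * f (N \<omega>) = (\<Sum>j. f j * indicator {\<omega>\<in>A. N \<omega> = j} \<omega>)"
      by (simp add: indicator_def)
  qed
  also have "\<dots> = (\<Sum>j. f j * emeasure M {\<omega>\<in>A. N \<omega> = j})"
    by (subst nn_integral_suminf) (auto simp: nn_integral_cmult_indicator)
  finally show ?thesis .
qed

text \<open>The hypotheses of the theorem with the descendant laws \<open>G\<close> and the offspring laws \<open>p\<close> as
parameters.\<close>

locale theta_process = prob_space M + rate lam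
  for M :: "'w measure" and lam :: "real \<Rightarrow> real" +
  fixes \<theta> :: real and a :: "real \<Rightarrow> real" and Z :: "real \<Rightarrow> 'w \<Rightarrow> nat"
    and G :: "real \<Rightarrow> real \<Rightarrow> nat pmf" and p :: "real \<Rightarrow> nat pmf"
  assumes theta: "0 < \<theta>" "\<theta> \<le> 1"
    and a_measurable: "a \<in> borel_measurable (restrict_space borel {0..})"
    and a_range: "t \<ge> 0 \<Longrightarrow> a t \<in> {0..1 + 1 / \<theta>}"
    and Z_measurable: "t \<ge> 0 \<Longrightarrow> Z t \<in> measurable M (count_space UNIV)"
    and Z_0: "AE \<omega> in M. Z 0 \<omega> = 1"
    and right_continuous: "\<omega> \<in> space M \<Longrightarrow> t \<ge> 0 \<Longrightarrow> continuous (at_right t) (\<lambda>u. Z u \<omega>)"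
    and markov: "0 \<le> s \<Longrightarrow> s \<le> t \<Longrightarrow> AE \<omega> in M.
           real_cond_exp M (nat_filtration M Z s) (indicator {\<omega> \<in> space M. Z t \<omega> = j}) \<omega>
           = pmf (map_pmf sum_list (replicate_pmf (Z s \<omega>) (G s t))) j"
    and offspring: "t \<ge> 0 \<Longrightarrow> theta_offspring_law \<theta> (a t) (p t)"
    and rates: "individual_rates M lam p Z"
begin

lemma space_filtration [simp]: "space (nat_filtration M Z s) = space M"
  unfolding nat_filtration_def by (rule space_measure_of) auto

lemma sets_filtration: "sets (nat_filtration M Z s) =
    sigma_sets (space M) {Z u -` B \<inter> space M | u B. 0 \<le> u \<and> u \<le> s}"
  unfolding nat_filtration_def by (rule sets_measure_of) auto

lemma filtration_subalgebra: "subalgebra M (nat_filtration M Z s)"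
  unfolding subalgebra_def sets_filtration
  using Z_measurable by (auto intro!: sets.sigma_sets_subset intro: measurable_sets)

lemma filtration_mono: "s \<le> t \<Longrightarrow> sets (nat_filtration M Z s) \<subseteq> sets (nat_filtration M Z t)"
  unfolding sets_filtration by (rule sigma_sets_mono') (blast intro: order.trans)

lemma filtration_sets: "A \<in> sets (nat_filtration M Z s) \<Longrightarrow> A \<in> sets M"
  using filtration_subalgebra unfolding subalgebra_def by auto

lemma filtration_event:
  assumes "0 \<le> u" "u \<le> s" shows "{\<omega>\<in>space M. Q (Z u \<omega>)} \<in> sets (nat_filtration M Z s)"
proof -
  have "{\<omega>\<in>space M. Q (Z u \<omega>)} = Z u -` {k. Q k} \<inter> space M" by auto
  then show ?thesis using assms unfolding sets_filtration by (intro sigma_sets.Basic) blast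
qed

definition F :: "real \<Rightarrow> real \<Rightarrow> real \<Rightarrow> real" where
  "F s t x = pgf (G s t) x"

lemma F_bounds: "x \<in> {0..1} \<Longrightarrow> F s t x \<in> {0..1}"
  unfolding F_def by (rule pgf_bounds)

lemma markov_prob:
  assumes st: "0 \<le> s" "s \<le> t" and A: "A \<in> sets (nat_filtration M Z s)"
  shows "emeasure M {\<omega>\<in>A. Z t \<omega> = j} =
    (\<integral>\<^sup>+\<omega>. indicator A \<omega> * ennreal (pmf (map_pmf sum_list (replicate_pmf (Z s \<omega>) (G s t))) j) \<partial>M)"
proof -
  interpret S: finite_measure_subalgebra M "nat_filtration M Z s"
    by unfold_locales (rule filtration_subalgebra)
  note [measurable] = Z_measurable[OF st(1)] Z_measurable[OF order.trans[OF st]]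
  have [measurable]: "A \<in> sets M" by (rule filtration_sets[OF A])
  have AM: "A \<subseteq> space M" by (rule sets.sets_into_space) simp
  let ?Q = "\<lambda>\<omega>. pmf (map_pmf sum_list (replicate_pmf (Z s \<omega>) (G s t))) j"
  have Qm [measurable]: "?Q \<in> borel_measurable M"
    by (rule measurable_compose[OF Z_measurable[OF st(1)]]) simp
  have eq: "{\<omega>\<in>A. Z t \<omega> = j} = A \<inter> {\<omega>\<in>space M. Z t \<omega> = j}" using AM by auto
  have ev [measurable]: "{\<omega>\<in>space M. Z t \<omega> = j} \<in> sets M" by measurable
  have "prob {\<omega>\<in>A. Z t \<omega> = j} = (\<integral>\<omega>\<in>A. indicator {\<omega> \<in> space M. Z t \<omega> = j} \<omega> \<partial>M)"
    unfolding eq set_lebesgue_integral_def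
    by (simp add: indicator_inter_arith[symmetric] Int_assoc)
  also have "\<dots> = (\<integral>\<omega>\<in>A. real_cond_exp M (nat_filtration M Z s) (indicator {\<omega> \<in> space M. Z t \<omega> = j}) \<omega> \<partial>M)"
    by (rule S.real_cond_exp_intA) (use A ev in \<open>auto simp: less_top[symmetric]\<close>)
  also have "\<dots> = (\<integral>\<omega>\<in>A. ?Q \<omega> \<partial>M)"
    unfolding set_lebesgue_integral_def
    by (rule integral_cong_AE) (use markov[OF st, of j] in \<open>auto intro: measurable_from_subalg[OF filtration_subalgebra]\<close>)
  finally have "emeasure M {\<omega>\<in>A. Z t \<omega> = j} = ennreal (\<integral>\<omega>. indicator A \<omega> * ?Q \<omega> \<partial>M)"
    by (simp add: emeasure_eq_measure set_lebesgue_integral_def)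
  also have "\<dots> = (\<integral>\<^sup>+\<omega>. ennreal (indicator A \<omega> * ?Q \<omega>) \<partial>M)"
    by (rule nn_integral_eq_integral[symmetric], rule integrable_const_bound[where B=1])
       (auto split: split_indicator simp: pmf_le_1)
  finally show ?thesis by (simp add: ennreal_mult' ennreal_indicator)
qed

lemma power_integrable:
  assumes "0 \<le> t" "x \<in> {0..1}" and [measurable]: "A \<in> sets M"
  shows "integrable M (\<lambda>\<omega>. indicator A \<omega> * x ^ Z t \<omega> :: real)"
proof (rule integrable_const_bound[where B=1])
  have [measurable]: "(\<lambda>\<omega>. x ^ Z t \<omega>) \<in> borel_measurable M"
    by (rule measurable_compose[OF Z_measurable[OF assms(1)]]) simp
  show "(\<lambda>\<omega>. indicator A \<omega> * x ^ Z t \<omega>) \<in> borel_measurable M" by simp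
qed (use assms in \<open>auto simp: power_le_one split: split_indicator\<close>)

text \<open>The form in which the Markov branching property is used: on an event of the past of \<open>s\<close>, the
number of individuals at \<open>t\<close> may be replaced by that at \<open>s\<close> if the argument of the generating function is
transformed by \<open>F s t\<close>.\<close>

lemma markov_pgf:
  assumes st: "0 \<le> s" "s \<le> t" and A: "A \<in> sets (nat_filtration M Z s)" and x: "x \<in> {0..1}"
  shows "(\<integral>\<omega>. indicator A \<omega> * x ^ Z t \<omega> \<partial>M) = (\<integral>\<omega>. indicator A \<omega> * F s t x ^ Z s \<omega> \<partial>M)"
proof -
  have AM [measurable]: "A \<in> sets M" by (rule filtration_sets[OF A])
  let ?Q = "\<lambda>\<omega>. map_pmf sum_list (replicate_pmf (Z s \<omega>) (G s t))"
  have Qm [measurable]: "(\<lambda>\<omega>. pmf (?Q \<omega>) j) \<in> borel_measurable M" for j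
    by (rule measurable_compose[OF Z_measurable[OF st(1)]]) simp
  have "ennreal (\<integral>\<omega>. indicator A \<omega> * x ^ Z t \<omega> \<partial>M) = (\<integral>\<^sup>+\<omega>. indicator A \<omega> * ennreal (x ^ Z t \<omega>) \<partial>M)"
    using x st by (subst nn_integral_eq_integral[OF power_integrable[OF _ x AM], symmetric])
      (auto simp: ennreal_mult' ennreal_indicator)
  also have "\<dots> = (\<Sum>j. ennreal (x ^ j) * emeasure M {\<omega>\<in>A. Z t \<omega> = j})"
  proof (rule nn_integral_nat_valued)
    fix j
    have "{\<omega>\<in>A. Z t \<omega> = j} = A \<inter> {\<omega>\<in>space M. Z t \<omega> = j}"
      using sets.sets_into_space[OF AM] by auto
    then show "{\<omega>\<in>A. Z t \<omega> = j} \<in> sets M"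
      using filtration_sets[OF filtration_event[of t t "\<lambda>k. k = j"]] st by simp
  qed
  also have "\<dots> = (\<Sum>j. \<integral>\<^sup>+\<omega>. ennreal (x ^ j) * (indicator A \<omega> * ennreal (pmf (?Q \<omega>) j)) \<partial>M)"
    unfolding markov_prob[OF st A] by (simp add: nn_integral_cmult)
  also have "\<dots> = (\<integral>\<^sup>+\<omega>. (\<Sum>j. ennreal (x ^ j) * (indicator A \<omega> * ennreal (pmf (?Q \<omega>) j))) \<partial>M)"
    by (rule nn_integral_suminf[symmetric]) simp
  also have "\<dots> = (\<integral>\<^sup>+\<omega>. indicator A \<omega> * ennreal (F s t x ^ Z s \<omega>) \<partial>M)"
  proof (rule nn_integral_cong)
    fix \<omega>
    have "(\<Sum>j. ennreal (x ^ j) * (indicator A \<omega> * ennreal (pmf (?Q \<omega>) j)))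
      = indicator A \<omega> * (\<Sum>j. ennreal (pmf (?Q \<omega>) j) * ennreal (x ^ j))"
      by (subst ennreal_suminf_cmult[symmetric]) (simp add: mult_ac)
    also have "(\<Sum>j. ennreal (pmf (?Q \<omega>) j) * ennreal (x ^ j)) = ennreal (pgf (?Q \<omega>) x)"
      using x by (simp only: ennreal_pgf nn_integral_pmf_nat)
    finally show "(\<Sum>j. ennreal (x ^ j) * (indicator A \<omega> * ennreal (pmf (?Q \<omega>) j)))
      = indicator A \<omega> * ennreal (F s t x ^ Z s \<omega>)"
      using x by (simp add: F_def pgf_sum_list_replicate)
  qed
  also have "\<dots> = ennreal (\<integral>\<omega>. indicator A \<omega> * F s t x ^ Z s \<omega> \<partial>M)"
    using F_bounds[OF x, of s t]
    by (subst nn_integral_eq_integral[OF power_integrable[OF st(1) F_bounds[OF x] AM], symmetric])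
      (auto simp: ennreal_mult' ennreal_indicator)
  finally show ?thesis using x F_bounds[OF x, of s t]
    by (subst (asm) ennreal_inj) (auto intro!: integral_nonneg_AE)
qed

end

section \<open>The offspring law\<close>

context theta_process begin

definition h :: "real \<Rightarrow> real \<Rightarrow> real" where
  "h r x = 1 - a r * (1 - x) + a r / (1 + \<theta>) * (1 - x) powr (1 + \<theta>)"

lemma offspring_pgf:
  assumes "r \<ge> 0" "x \<in> {0..1}" shows "pgf (p r) x = h r x"
proof -
  have s: "(\<lambda>k. pmf (p r) k * x ^ k) sums h r x"
    using offspring[OF assms(1)] assms(2) unfolding theta_offspring_law_def h_def by blast
  have n: "0 \<le> pmf (p r) k * x ^ k" for k using assms by simp
  have "0 \<le> h r x" using sums_le[OF n sums_zero s] .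
  have "ennreal (pgf (p r) x) = (\<Sum>k. ennreal (pmf (p r) k * x ^ k))"
    unfolding ennreal_pgf[OF assms(2)] nn_integral_pmf_nat using assms by (simp add: ennreal_mult)
  also have "\<dots> = ennreal (h r x)" by (rule suminf_ennreal_eq[OF n s])
  finally show ?thesis using pgf_bounds[OF assms(2), of "p r"] \<open>0 \<le> h r x\<close> by (subst (asm) ennreal_inj) auto
qed

lemma offspring_not_1: "r \<ge> 0 \<Longrightarrow> pmf (p r) 1 = 0"
  using offspring unfolding theta_offspring_law_def by blast

text \<open>The difference quotient \<open>(1 - h(x)) / (1 - x)\<close> is at most \<open>a\<close>; its truncated version is a
polynomial in \<open>x\<close>, whose value at 1 is the truncated mean.\<close>

lemma offspring_mean:
  assumes r: "r \<ge> 0"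
  shows "(\<integral>\<^sup>+k. ennreal (real k) \<partial>measure_pmf (p r)) \<le> ennreal (a r)"
proof -
  have "(\<Sum>k<K. pmf (p r) k * real k) \<le> a r" for K
  proof -
    let ?f = "\<lambda>x::real. \<Sum>k<K. pmf (p r) k * (\<Sum>j<k. x ^ j)"
    have *: "?f x \<le> a r" if x: "0 \<le> x" "x < 1" for x
    proof -
      have i: "integrable (measure_pmf (p r)) (\<lambda>k. 1 - x ^ k)"
        using x by (intro Bochner_Integration.integrable_diff pgf_integrable) auto
      have "(1 - x) * ?f x = (\<Sum>k<K. pmf (p r) k * (1 - x ^ k))"
        unfolding sum_distrib_left[where A="{..<K}"]
        by (rule sum.cong) (simp_all only: one_diff_power_eq mult.left_commute)
      also have "\<dots> = measure_pmf.expectation (p r) (\<lambda>k. (1 - x ^ k) * indicator {..<K} k)"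
        by (subst integral_measure_pmf_real[where A="{..<K}"]) (auto simp: indicator_def mult.commute)
      also have "\<dots> \<le> measure_pmf.expectation (p r) (\<lambda>k. 1 - x ^ k)"
      proof (rule integral_mono[OF _ i])
        show "integrable (measure_pmf (p r)) (\<lambda>k. (1 - x ^ k) * indicator {..<K} k)"
          by (rule integrable_real_mult_indicator[OF _ i]) auto
      qed (use x in \<open>auto split: split_indicator simp: power_le_one\<close>)
      also have "\<dots> = 1 - h r x"
        using x r by (subst Bochner_Integration.integral_diff)
          (auto intro!: pgf_integrable simp: offspring_pgf[symmetric] pgf_def)
      also have "\<dots> \<le> (1 - x) * a r"
        using a_range[OF r] theta by (simp add: h_def algebra_simps)
      finally show ?thesis using x by simp
    qed
    have "(\<lambda>n. ?f (1 - inverse (real (Suc n)))) \<longlonglongrightarrow> ?f (1 - 0)"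
      by (intro tendsto_intros LIMSEQ_inverse_real_of_nat)
    then have "?f (1 - 0) \<le> a r"
    proof (rule LIMSEQ_le_const2, intro exI[of _ 0] allI impI *)
      fix n show "0 \<le> 1 - inverse (real (Suc n))" "1 - inverse (real (Suc n)) < 1" by (simp_all add: field_simps)
    qed
    then show ?thesis by simp
  qed
  then have "(\<Sum>k<K. ennreal (pmf (p r) k) * ennreal (real k)) \<le> ennreal (a r)" for K
    by (subst ennreal_mult[symmetric]) (auto simp: sum_ennreal simp flip: ennreal_mult intro!: ennreal_leI)
  then show ?thesis unfolding nn_integral_pmf_nat by (intro suminf_le_const) auto
qed

lemma a_admissible: "admissible a"
proof (rule admissibleI)
  show "set_borel_measurable lborel {0..} a"
    using a_measurable unfolding set_borel_measurable_def
    by (subst (asm) borel_measurable_restrict_space_iff) auto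
  show "\<exists>C. \<forall>u\<in>{0..t}. \<bar>a u\<bar> \<le> C" for t
    by (rule exI[of _ "1 + 1 / \<theta>"]) (use a_range in force)
qed

lemma h_admissible: "admissible (\<lambda>r. h r x)"
proof -
  have "admissible (\<lambda>r. 1 + a r * (- (1 - x) + (1 - x) powr (1 + \<theta>) / (1 + \<theta>)))"
    by (intro admissible_add admissible_mult admissible_const a_admissible)
  moreover have "1 + a r * (- (1 - x) + (1 - x) powr (1 + \<theta>) / (1 + \<theta>)) = h r x" for r
    by (simp add: h_def algebra_simps)
  ultimately show ?thesis by simp
qed

lemma pmf_admissible: "admissible (\<lambda>r. pmf (p r) k)"
proof (rule admissibleI)
  show "set_borel_measurable lborel {0..} (\<lambda>r. pmf (p r) k)"
  proof (induction k rule: less_induct)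
    case (less k)
    let ?y = "\<lambda>n. inverse (real (Suc n))"
    let ?i = "\<lambda>r::real. indicator {0..} r :: real"
    have m: "(\<lambda>r. (?i r * h r (?y n) - (\<Sum>j<k. ?i r * pmf (p r) j * ?y n ^ j)) / ?y n ^ k) \<in> borel_measurable lborel" for n
    proof -
      have "(\<lambda>r. ?i r * h r (?y n)) \<in> borel_measurable lborel"
        using h_admissible[of "?y n"] unfolding admissible_def set_borel_measurable_def by simp
      moreover have "(\<lambda>r. ?i r * pmf (p r) j * ?y n ^ j) \<in> borel_measurable lborel" if "j < k" for j
        by (rule borel_measurable_times[OF _ borel_measurable_const])
           (use less[OF that] in \<open>simp add: set_borel_measurable_def\<close>)
      ultimately show ?thesis
        by (intro borel_measurable_divide borel_measurable_diff borel_measurable_sum) auto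
    qed
    have "(\<lambda>n. (?i r * h r (?y n) - (\<Sum>j<k. ?i r * pmf (p r) j * ?y n ^ j)) / ?y n ^ k) \<longlonglongrightarrow> ?i r * pmf (p r) k" for r
    proof (cases "r \<ge> 0")
      case True
      then have "h r (?y n) = pgf (p r) (?y n)" for n
        by (subst offspring_pgf) (auto simp: field_simps)
      then show ?thesis using True pmf_eq_lim_pgf[of "p r" k] by simp
    qed simp
    then show ?case unfolding set_borel_measurable_def
      by (intro borel_measurable_LIMSEQ_real[OF _ m]) simp
  qed
  show "\<exists>C. \<forall>u\<in>{0..t}. \<bar>pmf (p u) k\<bar> \<le> C" for t by (rule exI[of _ 1]) (auto simp: pmf_le_1)
qed

end

section \<open>The first change of state of a single individual\<close>

context theta_process begin

definition stay :: "real \<Rightarrow> real \<Rightarrow> 'w set" where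
  "stay s u = {\<omega>\<in>space M. \<forall>r\<in>{s..u}. Z r \<omega> = 1}"

definition leave :: "real \<Rightarrow> real \<Rightarrow> 'w set" where
  "leave s u = {\<omega>\<in>space M. Z s \<omega> = 1} - stay s u"

definition exits :: "real \<Rightarrow> 'w \<Rightarrow> real \<Rightarrow> bool" where
  "exits s \<omega> r \<longleftrightarrow> s < r \<and> (\<forall>v\<in>{s..<r}. Z v \<omega> = 1) \<and> Z r \<omega> \<noteq> 1"

text \<open>The state entered at the first change of state after \<open>s\<close>. On the complement of \<open>leave s u\<close> the
description of that time may denote nothing, hence the factor \<open>indicator (leave s u)\<close> in front of
every function of \<open>\<kappa>\<close> below.\<close>

definition \<kappa> :: "real \<Rightarrow> 'w \<Rightarrow> nat" where
  "\<kappa> s \<omega> = Z (THE r. exits s \<omega> r) \<omega>"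

lemma right_const:
  assumes "\<omega> \<in> space M" "t \<ge> 0"
  obtains e where "e > 0" "\<And>u. t \<le> u \<Longrightarrow> u < t + e \<Longrightarrow> Z u \<omega> = Z t \<omega>"
proof -
  have "eventually (\<lambda>u. Z u \<omega> = Z t \<omega>) (at_right t)"
    using right_continuous[OF assms] by (simp add: continuous_within tendsto_discrete)
  then obtain b where "b > t" "\<And>u. u > t \<Longrightarrow> u < b \<Longrightarrow> Z u \<omega> = Z t \<omega>"
    unfolding eventually_at_right_field by auto
  then show ?thesis by (intro that[of "b - t"]) (auto simp: order.order_iff_strict)
qed

lemma exits_unique: "exits s \<omega> r \<Longrightarrow> exits s \<omega> r' \<Longrightarrow> r = r'"
  unfolding exits_def by (metis atLeastLessThan_iff less_eq_real_def linorder_neqE_linordered_idom)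

lemma kappa_eq: "exits s \<omega> r \<Longrightarrow> \<kappa> s \<omega> = Z r \<omega>"
  unfolding \<kappa>_def using exits_unique by (metis the_equality)

text \<open>Right-continuity makes the infimum of the times spent outside state 1 a time at which the state
is different from 1.\<close>

lemma leave_iff:
  assumes s: "0 \<le> s" and w: "\<omega> \<in> space M"
  shows "\<omega> \<in> leave s u \<longleftrightarrow> (\<exists>r\<le>u. exits s \<omega> r)"
proof
  assume "\<omega> \<in> leave s u"
  then obtain r0 where r0: "Z s \<omega> = 1" "r0 \<in> {s..u}" "Z r0 \<omega> \<noteq> 1"
    using w by (auto simp: leave_def stay_def)
  define A where "A = {r. s \<le> r \<and> Z r \<omega> \<noteq> 1}"
  define r where "r = Inf A"
  have A: "r0 \<in> A" "bdd_below A" using r0 by (auto simp: A_def)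
  have sr: "s \<le> r" unfolding r_def by (rule cInf_greatest) (use A in \<open>auto simp: A_def\<close>)
  have rr0: "r \<le> r0" unfolding r_def using A by (intro cInf_lower)
  have before: "Z v \<omega> = 1" if "s \<le> v" "v < r" for v
  proof (rule ccontr)
    assume "Z v \<omega> \<noteq> 1"
    then have "v \<in> A" using that by (simp add: A_def)
    then show False using cInf_lower[OF _ A(2), of v] that by (simp add: r_def)
  qed
  have "Z r \<omega> \<noteq> 1"
  proof
    assume Z1: "Z r \<omega> = 1"
    obtain e where e: "e > 0" "\<And>u. r \<le> u \<Longrightarrow> u < r + e \<Longrightarrow> Z u \<omega> = Z r \<omega>"
      using right_const[OF w, of r] s sr by auto
    have "r + e \<le> r" unfolding r_def
    proof (rule cInf_greatest)
      fix v assume v: "v \<in> A"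
      then have "r \<le> v" unfolding r_def using A by (intro cInf_lower)
      then show "Inf A + e \<le> v" using e(2)[of v] v Z1 by (force simp: A_def r_def)
    qed (use A in auto)
    then show False using e by simp
  qed
  moreover have "s \<noteq> r" using calculation r0 by auto
  ultimately show "\<exists>r\<le>u. exits s \<omega> r" using sr rr0 r0 before by (intro exI[of _ r]) (auto simp: exits_def)
next
  assume "\<exists>r\<le>u. exits s \<omega> r"
  then show "\<omega> \<in> leave s u" using w by (force simp: leave_def stay_def exits_def)
qed

lemma stay_iff:
  assumes "exits s \<omega> r" "\<omega> \<in> space M" "s \<le> v"
  shows "\<omega> \<in> stay s v \<longleftrightarrow> v < r"
  using assms by (force simp: exits_def stay_def)

text \<open>By right-continuity, staying in state 1 can be tested at the rational times and at the end
point.\<close>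

lemma stay_measurable:
  assumes "0 \<le> s" "s \<le> u"
  shows "stay s u \<in> sets (nat_filtration M Z u)"
proof -
  define D where "D = insert u (\<rat> \<inter> {s..u})"
  have D: "countable D" "D \<noteq> {}" "D \<subseteq> {s..u}"
    unfolding D_def using countable_rat assms by auto
  have "stay s u = (\<Inter>q\<in>D. {\<omega>\<in>space M. Z q \<omega> = 1})"
  proof (intro set_eqI iffI)
    fix \<omega> assume "\<omega> \<in> stay s u"
    then show "\<omega> \<in> (\<Inter>q\<in>D. {\<omega>\<in>space M. Z q \<omega> = 1})" using D(3) by (auto simp: stay_def)
  next
    fix \<omega> assume *: "\<omega> \<in> (\<Inter>q\<in>D. {\<omega>\<in>space M. Z q \<omega> = 1})"
    then have w: "\<omega> \<in> space M" "Z u \<omega> = 1" by (auto simp: D_def)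
    have "Z r \<omega> = 1" if r: "r \<in> {s..u}" for r
    proof (cases "r = u")
      case False
      obtain e where e: "e > 0" "\<And>u. r \<le> u \<Longrightarrow> u < r + e \<Longrightarrow> Z u \<omega> = Z r \<omega>"
        using right_const[OF w(1), of r] assms r by auto
      obtain q where q: "q \<in> \<rat>" "r < q" "q < min (r + e) u"
        using Rats_dense_in_real[of r "min (r + e) u"] False r e by auto
      then show ?thesis using * e(2)[of q] r by (auto simp: D_def)
    qed (use w in simp)
    then show "\<omega> \<in> stay s u" using w by (simp add: stay_def)
  qed
  also have "\<dots> \<in> sets (nat_filtration M Z u)"
    by (rule sets.countable_INT'[OF D(1,2)]) (use D(3) assms in \<open>auto intro!: filtration_event\<close>)
  finally show ?thesis .
qed

lemma stay_antimono: "u \<le> v \<Longrightarrow> stay s v \<subseteq> stay s u"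
  by (auto simp: stay_def)

lemma stay_sets: "0 \<le> s \<Longrightarrow> s \<le> u \<Longrightarrow> stay s u \<in> sets M"
  by (rule filtration_sets[OF stay_measurable])

lemma leave_sets:
  assumes "0 \<le> s" "s \<le> u" shows "leave s u \<in> sets M"
  unfolding leave_def
  by (intro sets.Diff stay_sets assms filtration_sets[OF filtration_event[of s s]]) auto

definition pt :: "real \<Rightarrow> real \<Rightarrow> nat \<Rightarrow> nat \<Rightarrow> real" where
  "pt s u n i = s + (u - s) * real i / real (Suc n)"

definition cell :: "real \<Rightarrow> real \<Rightarrow> nat \<Rightarrow> nat \<Rightarrow> 'w set" where
  "cell s u n i = stay s (pt s u n i) - stay s (pt s u n (Suc i))"

text \<open>At most one cell occurs, namely the piece of the grid in which the first change of state happens.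
So this is \<open>\<phi>\<close> of the state observed at the first grid point not before that change, an approximation
of \<open>\<phi> (\<kappa> s \<omega>)\<close> that refers to deterministic times only, where the Markov property is available.\<close>

definition grid_sum :: "real \<Rightarrow> real \<Rightarrow> (nat \<Rightarrow> real) \<Rightarrow> nat \<Rightarrow> 'w \<Rightarrow> real" where
  "grid_sum s u \<phi> n \<omega> = (\<Sum>i<Suc n. indicator (cell s u n i) \<omega> * \<phi> (Z (pt s u n (Suc i)) \<omega>))"

lemma pt_0 [simp]: "pt s u n 0 = s" and pt_Suc [simp]: "pt s u n (Suc n) = u"
  by (simp_all add: pt_def)

lemma pt_step: "pt s u n (Suc i) = pt s u n i + (u - s) * inverse (real (Suc n))"
proof -
  have "s + d * real (Suc i) / N = s + d * real i / N + d * inverse N" for d N :: real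
    by (simp add: distrib_left distrib_right add_divide_distrib divide_inverse)
  then show ?thesis unfolding pt_def .
qed

lemma pt_mono: "s \<le> u \<Longrightarrow> i \<le> j \<Longrightarrow> pt s u n i \<le> pt s u n j"
  unfolding pt_def by (intro add_left_mono divide_right_mono mult_left_mono) auto

lemma pt_ge: "s \<le> u \<Longrightarrow> s \<le> pt s u n i"
  using pt_mono[of s u 0 i n] by simp

lemma pt_le: "s \<le> u \<Longrightarrow> i \<le> Suc n \<Longrightarrow> pt s u n i \<le> u"
  using pt_mono[of s u i "Suc n" n] by simp

lemma cell_sets:
  assumes "0 \<le> s" "s \<le> u" shows "cell s u n i \<in> sets (nat_filtration M Z (pt s u n (Suc i)))"
  unfolding cell_def
  using stay_measurable[of s "pt s u n i"] stay_measurable[of s "pt s u n (Suc i)"] assms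
    filtration_mono[OF pt_mono, of s u i "Suc i" n] by (auto simp: pt_ge)

text \<open>Exactly one cell occurs if state 1 is left, and none otherwise: the sum telescopes.\<close>

lemma sum_cell:
  assumes "0 \<le> s" "s \<le> u"
  shows "(\<Sum>i<Suc n. indicator (cell s u n i) \<omega>) = (indicator (leave s u) \<omega> :: real)"
proof -
  have "indicator (cell s u n i) \<omega> = (indicator (stay s (pt s u n i)) \<omega> - indicator (stay s (pt s u n (Suc i))) \<omega> :: real)" for i
    unfolding cell_def using stay_antimono[OF pt_mono[of s u i "Suc i" n], of s] assms
    by (auto simp: indicator_def)
  then have "(\<Sum>i<Suc n. indicator (cell s u n i) \<omega>) =
      (\<Sum>i<Suc n. indicator (stay s (pt s u n i)) \<omega> - indicator (stay s (pt s u n (Suc i))) \<omega> :: real)"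
    by (intro sum.cong) auto
  also have "\<dots> = indicator (stay s (pt s u n 0)) \<omega> - indicator (stay s (pt s u n (Suc n))) \<omega>"
    by (rule sum_lessThan_telescope')
  finally have "(\<Sum>i<Suc n. indicator (cell s u n i) \<omega>) = (indicator (stay s s) \<omega> - indicator (stay s u) \<omega> :: real)"
    by simp
  moreover have "leave s u = stay s s - stay s u" by (auto simp: leave_def stay_def)
  moreover have "stay s u \<subseteq> stay s s" by (rule stay_antimono) (use assms in simp)
  ultimately show ?thesis by (auto simp: indicator_def)
qed

lemma grid_sum_bound:
  assumes "0 \<le> s" "s \<le> u" "\<And>k. \<bar>\<phi> k\<bar> \<le> B"
  shows "\<bar>grid_sum s u \<phi> n \<omega>\<bar> \<le> B"
proof -
  have B: "B \<ge> 0" using assms(3)[of 0] by simp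
  have "\<bar>grid_sum s u \<phi> n \<omega>\<bar> \<le> (\<Sum>i<Suc n. \<bar>indicator (cell s u n i) \<omega> * \<phi> (Z (pt s u n (Suc i)) \<omega>)\<bar>)"
    unfolding grid_sum_def by (rule sum_abs)
  also have "\<dots> \<le> (\<Sum>i<Suc n. indicator (cell s u n i) \<omega> * B)"
    by (rule sum_mono) (use assms(3) in \<open>auto split: split_indicator\<close>)
  also have "\<dots> = indicator (leave s u) \<omega> * B"
    unfolding sum_distrib_right[symmetric] sum_cell[OF assms(1,2)] ..
  also have "\<dots> \<le> B" using B by (auto split: split_indicator)
  finally show ?thesis .
qed

text \<open>The grid point that follows the first change of state tends to the time of that change from the
right, and the path is constant on a right neighbourhood of it. Hence the observed state is eventually
the state entered.\<close>

lemma grid_sum_tendsto: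
  assumes s: "0 \<le> s" "s \<le> u" and w: "\<omega> \<in> space M"
  shows "(\<lambda>n. grid_sum s u \<phi> n \<omega>) \<longlonglongrightarrow> indicator (leave s u) \<omega> * \<phi> (\<kappa> s \<omega>)"
proof (cases "\<omega> \<in> leave s u")
  case True
  then obtain r where r: "r \<le> u" "exits s \<omega> r" using leave_iff[OF s(1) w] by auto
  then have sr: "s < r" by (simp add: exits_def)
  obtain e where e: "e > 0" "\<And>u. r \<le> u \<Longrightarrow> u < r + e \<Longrightarrow> Z u \<omega> = Z r \<omega>"
    using right_const[OF w, of r] s sr by auto
  have "eventually (\<lambda>n. (u - s) * inverse (real (Suc n)) < e) sequentially"
    by (rule order_tendstoD(2)[OF tendsto_mult_right_zero[OF LIMSEQ_inverse_real_of_nat] e(1)])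
  then have "eventually (\<lambda>n. grid_sum s u \<phi> n \<omega> = \<phi> (\<kappa> s \<omega>)) sequentially"
  proof eventually_elim
    case (elim n)
    \<comment> \<open>\<open>m\<close> is the index of the first grid point not before the first change of state.\<close>
    define m where "m = (LEAST i. r \<le> pt s u n i)"
    have ex: "r \<le> pt s u n (Suc n)" using r by simp
    have m1: "r \<le> pt s u n m" unfolding m_def by (rule LeastI[of _ "Suc n"]) (rule ex)
    have m2: "m \<le> Suc n" unfolding m_def by (rule Least_le) (rule ex)
    have m3: "pt s u n j < r" if "j < m" for j
      using not_less_Least[of j "\<lambda>i. r \<le> pt s u n i"] that by (simp add: m_def)
    have "m \<noteq> 0" using m1 sr by (intro notI) simp
    then obtain i where i: "m = Suc i" using not0_implies_Suc by blast
    have "pt s u n m = pt s u n i + (u - s) * inverse (real (Suc n))"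
      unfolding i by (rule pt_step)
    moreover have "pt s u n i < r" by (rule m3) (simp add: i)
    ultimately have "pt s u n m < r + e" using elim by linarith
    then have Zm: "Z (pt s u n m) \<omega> = \<kappa> s \<omega>" using e(2)[OF m1] kappa_eq[OF r(2)] by metis
    have "\<omega> \<in> cell s u n j \<longleftrightarrow> j = i" for j
    proof -
      have "\<omega> \<in> cell s u n j \<longleftrightarrow> pt s u n j < r \<and> r \<le> pt s u n (Suc j)"
        unfolding cell_def using stay_iff[OF r(2) w] pt_ge[OF s(2)] by auto
      also have "\<dots> \<longleftrightarrow> j = i"
      proof
        assume *: "pt s u n j < r \<and> r \<le> pt s u n (Suc j)"
        then have "\<not> Suc j < m" using m3[of "Suc j"] by auto
        moreover have "\<not> m \<le> j" using pt_mono[OF s(2), of m j n] m1 * by auto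
        ultimately show "j = i" using i by simp
      qed (use m1 m3 i in auto)
      finally show ?thesis .
    qed
    then have "grid_sum s u \<phi> n \<omega> = (\<Sum>j<Suc n. if j = i then \<phi> (Z (pt s u n (Suc j)) \<omega>) else 0)"
      unfolding grid_sum_def by (intro sum.cong) (auto simp: indicator_def)
    also have "\<dots> = \<phi> (\<kappa> s \<omega>)" using m2 i Zm by (subst sum.delta) auto
    finally show ?case .
  qed
  then show ?thesis using True by (simp add: tendsto_eventually)
next
  case False
  have "\<omega> \<notin> cell s u n i" if "i < Suc n" for n i
  proof -
    have "indicator (cell s u n i) \<omega> \<le> (\<Sum>i<Suc n. indicator (cell s u n i) \<omega> :: real)"
      by (rule member_le_sum) (use that in auto)
    then show ?thesis using sum_cell[OF s, of n \<omega>] False by (auto simp: indicator_def split: if_splits)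
  qed
  then have "grid_sum s u \<phi> n \<omega> = 0" for n unfolding grid_sum_def by (intro sum.neutral) auto
  then show ?thesis using False by simp
qed

lemma grid_sum_measurable:
  assumes "0 \<le> s" "s \<le> u" shows "grid_sum s u \<phi> n \<in> borel_measurable M"
  unfolding grid_sum_def
proof (rule borel_measurable_sum)
  fix i
  have "0 \<le> pt s u n (Suc i)" using pt_ge[OF assms(2)] assms(1) by (rule order.trans[rotated])
  note [measurable] = Z_measurable[OF this] filtration_sets[OF cell_sets[OF assms]]
  show "(\<lambda>\<omega>. indicator (cell s u n i) \<omega> * \<phi> (Z (pt s u n (Suc i)) \<omega>)) \<in> borel_measurable M"
    by measurable
qed

lemma kappa_measurable:
  assumes "0 \<le> s" "s \<le> u"
  shows "(\<lambda>\<omega>. indicator (leave s u) \<omega> * \<phi> (\<kappa> s \<omega>) :: real) \<in> borel_measurable M"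
  by (rule borel_measurable_LIMSEQ_real[OF grid_sum_tendsto[OF assms] grid_sum_measurable[OF assms]])

lemma grid_sum_integrable:
  assumes "0 \<le> s" "s \<le> u" "\<And>k. \<bar>\<phi> k\<bar> \<le> B"
  shows "integrable M (grid_sum s u \<phi> n)"
  by (rule integrable_const_bound[where B=B]) (use grid_sum_bound[OF assms] grid_sum_measurable assms in auto)

lemma grid_sum_integral_tendsto:
  assumes "0 \<le> s" "s \<le> u" "\<And>k. \<bar>\<phi> k\<bar> \<le> B"
  shows "(\<lambda>n. \<integral>\<omega>. grid_sum s u \<phi> n \<omega> \<partial>M) \<longlonglongrightarrow> (\<integral>\<omega>. indicator (leave s u) \<omega> * \<phi> (\<kappa> s \<omega>) \<partial>M)"
  by (rule integral_dominated_convergence[where w="\<lambda>_. B"])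
     (use kappa_measurable grid_sum_measurable grid_sum_tendsto grid_sum_bound[OF assms] assms in auto)

end

section \<open>The law of the first change of state\<close>

context theta_process begin

definition alone :: "real \<Rightarrow> real" where
  "alone s = prob {\<omega>\<in>space M. Z s \<omega> = 1}"

lemma alone_measurable: "0 \<le> s \<Longrightarrow> {\<omega>\<in>space M. Z s \<omega> = 1} \<in> sets M"
  by (rule filtration_sets[OF filtration_event[of s s]]) auto

lemma kappa_event:
  assumes "0 \<le> s" "s \<le> u"
  shows "{\<omega>\<in>leave s u. \<kappa> s \<omega> = k} \<in> sets M"
proof -
  note [measurable] = kappa_measurable[OF assms, of "\<lambda>j. if j = k then 1 else 0"]
  have "{\<omega>\<in>space M. indicator (leave s u) \<omega> * (if \<kappa> s \<omega> = k then 1 else 0) = (1::real)} \<in> sets M"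
    by measurable
  also have "{\<omega>\<in>space M. indicator (leave s u) \<omega> * (if \<kappa> s \<omega> = k then 1 else 0) = (1::real)}
      = {\<omega>\<in>leave s u. \<kappa> s \<omega> = k}"
    by (auto simp: leave_def indicator_def)
  finally show ?thesis .
qed

text \<open>The rate hypothesis, with the conditioning on \<open>Z s = 1\<close> removed. For \<open>k = 1\<close> both sides vanish,
so that the formula can be summed over all \<open>k\<close>.\<close>

lemma emeasure_jump:
  assumes s: "0 \<le> s" "s \<le> u"
  shows "emeasure M {\<omega>\<in>leave s u. \<kappa> s \<omega> = k}
     = ennreal (alone s * Lint (\<lambda>r. exp (- (L r - L s)) * pmf (p r) k) s u)"
proof (cases "k = 1")
  case True
  have "\<kappa> s \<omega> \<noteq> k" if "\<omega> \<in> leave s u" for \<omega>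
  proof -
    have "\<omega> \<in> space M" using that by (simp add: leave_def)
    from leave_iff[OF s(1) this, of u] that obtain r where "exits s \<omega> r" by auto
    then show ?thesis using kappa_eq[of s \<omega> r] True by (simp add: exits_def)
  qed
  then have empty: "{\<omega>\<in>leave s u. \<kappa> s \<omega> = k} = {}" by auto
  have "Lint (\<lambda>r. exp (- (L r - L s)) * pmf (p r) k) s u = Lint (\<lambda>_. 0) s u"
    unfolding Lint_def True
    by (rule set_lebesgue_integral_cong) (use s offspring_not_1 in auto)
  then show ?thesis unfolding empty by (simp add: Lint_def)
next
  case False
  have eq: "{\<omega>\<in>space M. dies_with_offspring Z s u k \<omega> \<and> Z s \<omega> = 1} = {\<omega>\<in>leave s u. \<kappa> s \<omega> = k}" (is "?A = ?B")
  proof (intro set_eqI iffI)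
    fix \<omega> assume "\<omega> \<in> ?A"
    then obtain r where "\<omega> \<in> space M" "exits s \<omega> r" "r \<le> u" "Z r \<omega> = k"
      using False unfolding dies_with_offspring_def exits_def by auto
    then show "\<omega> \<in> ?B" using leave_iff[OF s(1)] kappa_eq by auto
  next
    fix \<omega> assume w: "\<omega> \<in> ?B"
    then have "\<omega> \<in> space M" "Z s \<omega> = 1" by (auto simp: leave_def)
    moreover obtain r where "exits s \<omega> r" "r \<le> u"
      using w leave_iff[OF s(1) calculation(1), of u] by auto
    ultimately show "\<omega> \<in> ?A" using w kappa_eq[of s \<omega> r]
      unfolding dies_with_offspring_def exits_def by auto
  qed
  have "(LINT r:{s..u}|lborel. lam r * exp (- Lam_incr lam s r) * pmf (p r) k) =
      Lint (\<lambda>r. exp (- (L r - L s)) * pmf (p r) k) s u" (is "?l = ?Lint")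
    unfolding Lint_def by (rule set_lebesgue_integral_cong) (use s Lam_incr_eq in auto)
  moreover have "\<P>(\<omega> in M. dies_with_offspring Z s u k \<omega> \<bar> Z s \<omega> = 1) = ?l"
    using rates s False unfolding individual_rates_def by blast
  ultimately have c: "prob ?B / alone s = ?Lint"
    unfolding cond_prob_def eq alone_def by simp
  have "prob ?B = alone s * ?Lint"
  proof (cases "alone s = 0")
    case True
    have "prob ?B \<le> alone s" unfolding alone_def
      by (rule finite_measure_mono[OF _ alone_measurable[OF s(1)]]) (auto simp: leave_def)
    then show ?thesis using True measure_nonneg[of M ?B] by simp
  qed (use c in \<open>simp add: field_simps\<close>)
  then show ?thesis by (simp add: emeasure_eq_measure)
qed

text \<open>Summing \<open>emeasure_jump\<close> over \<open>k\<close> gives the joint law of the time of the first change of state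
and of the state entered: the time has density \<open>exp (- (L r - L s)) lam r\<close>, and given that it is \<open>r\<close> the new state has law \<open>p r\<close>.\<close>

lemma jump_law:
  assumes s: "0 \<le> s" "s \<le> u"
  shows "(\<integral>\<^sup>+\<omega>. indicator (leave s u) \<omega> * \<phi> (\<kappa> s \<omega>) \<partial>M) =
    ennreal (alone s) * (\<integral>\<^sup>+r\<in>{s..u}. ennreal (exp (- (L r - L s)) * lam r) * (\<integral>\<^sup>+k. \<phi> k \<partial>measure_pmf (p r)) \<partial>lborel)"
proof -
  let ?g = "\<lambda>k r. exp (- (L r - L s)) * pmf (p r) k"
  have adm: "admissible (?g k)" for k
    by (intro admissible_mult admissible_exp_L pmf_admissible)
  let ?f = "\<lambda>k r. ennreal (?g k r * lam r) * indicator {s..u} r"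
  have m: "?f k \<in> borel_measurable lborel" for k
  proof -
    have "(\<lambda>r. ennreal (indicator {s..u} r *\<^sub>R (?g k r * lam r))) \<in> borel_measurable lborel"
      using admissible_integrable[OF adm s(1), of u k] unfolding set_integrable_def by simp
    also have "(\<lambda>r. ennreal (indicator {s..u} r *\<^sub>R (?g k r * lam r))) = ?f k"
      by (auto simp: fun_eq_iff split: split_indicator)
    finally show ?thesis .
  qed
  have a0: "alone s \<ge> 0" by (simp add: alone_def)
  have "(\<integral>\<^sup>+\<omega>. indicator (leave s u) \<omega> * \<phi> (\<kappa> s \<omega>) \<partial>M) = (\<Sum>k. \<phi> k * emeasure M {\<omega>\<in>leave s u. \<kappa> s \<omega> = k})"
    by (rule nn_integral_nat_valued) (rule kappa_event[OF s])
  also have "\<dots> = (\<Sum>k. \<integral>\<^sup>+r. ennreal (alone s) * (\<phi> k * ?f k r) \<partial>lborel)"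
  proof (rule suminf_cong)
    fix k
    have "emeasure M {\<omega>\<in>leave s u. \<kappa> s \<omega> = k} = ennreal (alone s) * ennreal (Lint (?g k) s u)"
      unfolding emeasure_jump[OF s] using a0 by (simp add: ennreal_mult')
    also have "ennreal (Lint (?g k) s u) = (\<integral>\<^sup>+r. ?f k r \<partial>lborel)"
      using Lint_eq_nn_integral[OF adm _ s(1), of k u] by simp
    finally show "\<phi> k * emeasure M {\<omega>\<in>leave s u. \<kappa> s \<omega> = k} = (\<integral>\<^sup>+r. ennreal (alone s) * (\<phi> k * ?f k r) \<partial>lborel)"
      using m by (simp add: nn_integral_cmult mult_ac)
  qed
  also have "\<dots> = (\<integral>\<^sup>+r. (\<Sum>k. ennreal (alone s) * (\<phi> k * ?f k r)) \<partial>lborel)"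
    by (rule nn_integral_suminf[symmetric]) (use m in measurable)
  also have "\<dots> = (\<integral>\<^sup>+r. ennreal (alone s) * (\<Sum>k. \<phi> k * ?f k r) \<partial>lborel)"
    by simp
  also have "\<dots> = ennreal (alone s) * (\<integral>\<^sup>+r. (\<Sum>k. \<phi> k * ?f k r) \<partial>lborel)"
    by (rule nn_integral_cmult) (use m in measurable)
  also have "(\<integral>\<^sup>+r. (\<Sum>k. \<phi> k * ?f k r) \<partial>lborel) =
    (\<integral>\<^sup>+r\<in>{s..u}. ennreal (exp (- (L r - L s)) * lam r) * (\<integral>\<^sup>+k. \<phi> k \<partial>measure_pmf (p r)) \<partial>lborel)"
  proof (rule nn_integral_cong)
    fix r
    show "(\<Sum>k. \<phi> k * ?f k r) = (ennreal (exp (- (L r - L s)) * lam r) * (\<integral>\<^sup>+k. \<phi> k \<partial>measure_pmf (p r))) * indicator {s..u} r"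
    proof (cases "r \<in> {s..u}")
      case True
      then have "0 \<le> lam r" using lam_nonneg s by auto
      then have "\<phi> k * ?f k r = ennreal (exp (- (L r - L s)) * lam r) * (ennreal (pmf (p r) k) * \<phi> k)" for k
        using True by (simp add: ennreal_mult mult_ac)
      then show ?thesis using True by (simp add: nn_integral_pmf_nat)
    qed simp
  qed
  finally show ?thesis .
qed

lemma prob_leave:
  assumes s: "0 \<le> s" "s \<le> u"
  shows "prob (leave s u) = alone s * (1 - exp (- (L u - L s)))"
proof -
  have "ennreal (prob (leave s u)) = (\<integral>\<^sup>+\<omega>. indicator (leave s u) \<omega> * 1 \<partial>M)"
    using leave_sets[OF s] by (simp add: emeasure_eq_measure)
  also have "\<dots> = ennreal (alone s) * ennreal (Lint (\<lambda>r. exp (- (L r - L s))) s u)"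
    unfolding jump_law[OF s, of "\<lambda>_. 1"] using Lint_eq_nn_integral[OF admissible_exp_L _ s(1), of s u] by simp
  also have "Lint (\<lambda>r. exp (- (L r - L s))) s u = 1 - exp (- (L u - L s))" by (rule Lint_exp_L[OF s])
  also have "ennreal (alone s) * ennreal (1 - exp (- (L u - L s))) = ennreal (alone s * (1 - exp (- (L u - L s))))"
    by (rule ennreal_mult[symmetric]) (use L_mono[OF s] in \<open>auto simp: alone_def\<close>)
  finally show ?thesis
    by (rule ennreal_inj[THEN iffD1, rotated 2]) (use L_mono[OF s] in \<open>auto simp: alone_def\<close>)
qed

lemma indicator_alone:
  "s \<le> u \<Longrightarrow> \<omega> \<in> space M \<Longrightarrow> indicator {\<omega>\<in>space M. Z s \<omega> = 1} \<omega> = (indicator (stay s u) \<omega> + indicator (leave s u) \<omega> :: real)"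
  by (auto simp: leave_def stay_def indicator_def)

lemma prob_stay:
  assumes s: "0 \<le> s" "s \<le> u"
  shows "prob (stay s u) = alone s * exp (- (L u - L s))"
proof -
  have "{\<omega>\<in>space M. Z s \<omega> = 1} = stay s u \<union> leave s u" "stay s u \<inter> leave s u = {}"
    using s by (auto simp: leave_def stay_def)
  then have "alone s = prob (stay s u) + prob (leave s u)"
    unfolding alone_def using stay_sets[OF s] leave_sets[OF s] by (simp add: finite_measure_Union)
  then show ?thesis using prob_leave[OF s] by (simp add: algebra_simps)
qed

text \<open>The initial individual may survive up to time \<open>s\<close> without reproducing. So conditioning on
\<open>Z s = 1\<close> is possible at all times, and this is what determines \<open>F s t\<close>.\<close>

lemma alone_pos:
  assumes "0 \<le> s" shows "0 < alone s"
proof -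
  have "alone 0 = 1" unfolding alone_def
    by (rule prob_eq_1[THEN iffD2]) (use Z_0 alone_measurable[of 0] in auto)
  then have "exp (- L s) = prob (stay 0 s)" using prob_stay[of 0 s] assms by (simp add: L_0)
  also have "\<dots> \<le> alone s" unfolding alone_def
    by (rule finite_measure_mono[OF _ alone_measurable[OF assms]]) (use assms in \<open>auto simp: stay_def\<close>)
  finally show ?thesis by (meson exp_gt_zero less_le_trans)
qed

lemma jump_pgf:
  assumes s: "0 \<le> s" "s \<le> u" and x: "x \<in> {0..1}"
  shows "(\<integral>\<omega>. indicator (leave s u) \<omega> * x ^ \<kappa> s \<omega> \<partial>M) = alone s * Lint (\<lambda>r. exp (- (L r - L s)) * h r x) s u"
proof -
  have h0: "h r x \<ge> 0" if "r \<ge> 0" for r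
    using pgf_bounds[OF x, of "p r"] offspring_pgf[OF that x] by simp
  have adm: "admissible (\<lambda>r. exp (- (L r - L s)) * h r x)"
    by (intro admissible_mult admissible_exp_L h_admissible)
  have i: "integrable M (\<lambda>\<omega>. indicator (leave s u) \<omega> * x ^ \<kappa> s \<omega>)"
    by (rule integrable_const_bound[where B=1])
      (use kappa_measurable[OF s] x in \<open>auto simp: power_le_one split: split_indicator\<close>)
  have "ennreal (\<integral>\<omega>. indicator (leave s u) \<omega> * x ^ \<kappa> s \<omega> \<partial>M) = (\<integral>\<^sup>+\<omega>. indicator (leave s u) \<omega> * ennreal (x ^ \<kappa> s \<omega>) \<partial>M)"
    using x by (subst nn_integral_eq_integral[OF i, symmetric])
      (auto simp: ennreal_mult' ennreal_indicator)
  also have "\<dots> = ennreal (alone s) * (\<integral>\<^sup>+r\<in>{s..u}. ennreal (exp (- (L r - L s)) * h r x * lam r) \<partial>lborel)"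
    unfolding jump_law[OF s, of "\<lambda>k. ennreal (x ^ k)"]
  proof (rule arg_cong[where f="\<lambda>y. _ * y"], rule nn_integral_cong)
    fix r
    show "ennreal (exp (- (L r - L s)) * lam r) * (\<integral>\<^sup>+ k. ennreal (x ^ k) \<partial>measure_pmf (p r)) * indicator {s..u} r =
         ennreal (exp (- (L r - L s)) * h r x * lam r) * indicator {s..u} r"
    proof (cases "r \<in> {s..u}")
      case True
      then have "0 \<le> r" using s by auto
      then have "0 \<le> lam r" "(\<integral>\<^sup>+ k. ennreal (x ^ k) \<partial>measure_pmf (p r)) = ennreal (h r x)"
        using lam_nonneg s x by (auto simp: ennreal_pgf[symmetric] offspring_pgf)
      then show ?thesis using h0[OF \<open>0 \<le> r\<close>] by (simp add: mult_ac flip: ennreal_mult)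
    qed simp
  qed
  also have "(\<integral>\<^sup>+r\<in>{s..u}. ennreal (exp (- (L r - L s)) * h r x * lam r) \<partial>lborel) = ennreal (Lint (\<lambda>r. exp (- (L r - L s)) * h r x) s u)"
    by (rule Lint_eq_nn_integral[OF adm _ s(1)]) (use h0 in auto)
  finally show ?thesis
    using Lint_nonneg[OF adm s(1), of u] h0 s x alone_pos[OF s(1)]
    by (auto simp: integral_nonneg_AE simp flip: ennreal_mult)
qed

text \<open>This bounds the probability of a second change of state when each of the \<open>\<kappa>\<close> new individuals
changes with probability at most \<open>d\<close>; it is where the bound on the mean offspring number enters.\<close>

lemma jump_mean:
  assumes s: "0 \<le> s" "s \<le> u" and d: "0 \<le> d"
  shows "(\<integral>\<omega>. indicator (leave s u) \<omega> * min 1 (d * real (\<kappa> s \<omega>)) \<partial>M) \<le> alone s * (d * ((1 + 1 / \<theta>) * (L u - L s)))"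
proof -
  have i: "integrable M (\<lambda>\<omega>. indicator (leave s u) \<omega> * min 1 (d * real (\<kappa> s \<omega>)))"
    by (rule integrable_const_bound[where B=1])
      (use kappa_measurable[OF s, of "\<lambda>k. min 1 (d * real k)"] d in \<open>auto split: split_indicator\<close>)
  have "ennreal (\<integral>\<omega>. indicator (leave s u) \<omega> * min 1 (d * real (\<kappa> s \<omega>)) \<partial>M) =
      (\<integral>\<^sup>+\<omega>. indicator (leave s u) \<omega> * ennreal (min 1 (d * real (\<kappa> s \<omega>))) \<partial>M)"
    using d by (subst nn_integral_eq_integral[OF i, symmetric])
      (auto simp: ennreal_mult' ennreal_indicator)
  also have "\<dots> \<le> ennreal (alone s) * (\<integral>\<^sup>+r\<in>{s..u}. ennreal (d * (1 + 1 / \<theta>) * lam r) \<partial>lborel)"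
    unfolding jump_law[OF s, of "\<lambda>k. ennreal (min 1 (d * real k))"]
  proof (rule mult_left_mono, rule nn_integral_mono)
    fix r
    show "ennreal (exp (- (L r - L s)) * lam r) * (\<integral>\<^sup>+ k. ennreal (min 1 (d * real k)) \<partial>measure_pmf (p r)) * indicator {s..u} r
         \<le> ennreal (d * (1 + 1 / \<theta>) * lam r) * indicator {s..u} r"
    proof (cases "r \<in> {s..u}")
      case True
      then have r: "0 \<le> r" "0 \<le> lam r" "L s \<le> L r" using s lam_nonneg L_mono by auto
      have "(\<integral>\<^sup>+ k. ennreal (min 1 (d * real k)) \<partial>measure_pmf (p r)) \<le> (\<integral>\<^sup>+ k. ennreal d * ennreal (real k) \<partial>measure_pmf (p r))"
        using d by (intro nn_integral_mono) (simp flip: ennreal_mult)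
      also have "\<dots> \<le> ennreal d * ennreal (a r)"
        using offspring_mean[OF r(1)] by (simp add: nn_integral_cmult mult_left_mono)
      also have "\<dots> \<le> ennreal (d * (1 + 1 / \<theta>))"
        using d a_range[OF r(1)] by (auto simp flip: ennreal_mult intro!: ennreal_leI mult_left_mono)
      finally have 1: "(\<integral>\<^sup>+ k. ennreal (min 1 (d * real k)) \<partial>measure_pmf (p r)) \<le> ennreal (d * (1 + 1 / \<theta>))" .
      have "exp (- (L r - L s)) * lam r \<le> 1 * lam r" using r by (intro mult_right_mono) auto
      then have "ennreal (exp (- (L r - L s)) * lam r) \<le> ennreal (lam r)" by (simp add: ennreal_leI)
      from mult_mono[OF this 1] show ?thesis using True r d theta
        by (simp add: mult.commute flip: ennreal_mult)
    qed simp
  qed simp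
  also have "(\<integral>\<^sup>+r\<in>{s..u}. ennreal (d * (1 + 1 / \<theta>) * lam r) \<partial>lborel) = ennreal (Lint (\<lambda>_. d * (1 + 1 / \<theta>)) s u)"
    by (rule Lint_eq_nn_integral[OF admissible_const _ s(1)]) (use d theta in auto)
  also have "Lint (\<lambda>_. d * (1 + 1 / \<theta>)) s u = d * ((1 + 1 / \<theta>) * (L u - L s))"
    using Lint_const[OF s] by simp
  also have "ennreal (alone s) * ennreal (d * ((1 + 1 / \<theta>) * (L u - L s))) = ennreal (alone s * (d * ((1 + 1 / \<theta>) * (L u - L s))))"
    using d theta L_mono[OF s] alone_pos[OF s(1)] by (simp add: ennreal_mult)
  finally show ?thesis using d theta L_mono[OF s] alone_pos[OF s(1)] by (subst (asm) ennreal_le_iff) auto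
qed

end

section \<open>Short-time behaviour of the generating function\<close>

context theta_process begin

lemma alone_filtration: "0 \<le> s \<Longrightarrow> s \<le> u \<Longrightarrow> {\<omega>\<in>space M. Z s \<omega> = 1} \<in> sets (nat_filtration M Z u)"
  by (rule filtration_event) auto

lemma F_eq_expectation:
  assumes s: "0 \<le> s" "s \<le> t" and x: "x \<in> {0..1}"
  shows "(\<integral>\<omega>. indicator {\<omega>\<in>space M. Z s \<omega> = 1} \<omega> * x ^ Z t \<omega> \<partial>M) = alone s * F s t x"
proof -
  have "(\<integral>\<omega>. indicator {\<omega>\<in>space M. Z s \<omega> = 1} \<omega> * x ^ Z t \<omega> \<partial>M) =
        (\<integral>\<omega>. indicator {\<omega>\<in>space M. Z s \<omega> = 1} \<omega> * F s t x ^ Z s \<omega> \<partial>M)"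
    by (rule markov_pgf[OF s alone_filtration x]) (use s in auto)
  also have "\<dots> = (\<integral>\<omega>. indicator {\<omega>\<in>space M. Z s \<omega> = 1} \<omega> * F s t x \<partial>M)"
    by (rule Bochner_Integration.integral_cong) (auto simp: indicator_def)
  also have "\<dots> = alone s * F s t x"
    using alone_measurable[OF s(1)] by (simp add: alone_def)
  finally show ?thesis .
qed

text \<open>The semigroup property, from the Markov property at \<open>u\<close> applied on the event \<open>Z s = 1\<close>.\<close>

lemma F_compose:
  assumes s: "0 \<le> s" "s \<le> u" "u \<le> t" and x: "x \<in> {0..1}"
  shows "F s t x = F s u (F u t x)"
proof -
  have u: "0 \<le> u" "s \<le> t" using s by auto
  have "alone s * F s t x = alone s * F s u (F u t x)"
    using markov_pgf[OF u(1) s(3) alone_filtration[OF s(1,2)] x]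
    unfolding F_eq_expectation[OF s(1) u(2) x] F_eq_expectation[OF s(1,2) F_bounds[OF x]] .
  then show ?thesis using alone_pos[OF s(1)] by simp
qed

lemma expectation_pgf:
  assumes t: "0 \<le> t" and x: "x \<in> {0..1}"
  shows "(\<integral>\<omega>. x ^ Z t \<omega> \<partial>M) = F 0 t x"
proof -
  have m: "(\<lambda>\<omega>. x ^ Z t \<omega>) \<in> borel_measurable M"
    by (rule measurable_compose[OF Z_measurable[OF t]]) simp
  have "(\<integral>\<omega>. x ^ Z t \<omega> \<partial>M) = (\<integral>\<omega>. indicator {\<omega>\<in>space M. Z 0 \<omega> = 1} \<omega> * x ^ Z t \<omega> \<partial>M)"
  proof (rule integral_cong_AE)
    show "(\<lambda>\<omega>. indicator {\<omega>\<in>space M. Z 0 \<omega> = 1} \<omega> * x ^ Z t \<omega>) \<in> borel_measurable M"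
      using alone_measurable[of 0] m by simp
    show "AE \<omega> in M. x ^ Z t \<omega> = indicator {\<omega>\<in>space M. Z 0 \<omega> = 1} \<omega> * x ^ Z t \<omega>"
      using Z_0 AE_space by eventually_elim simp
  qed (rule m)
  also have "alone 0 = 1" unfolding alone_def
    by (rule prob_eq_1[THEN iffD2]) (use Z_0 alone_measurable[of 0] in auto)
  then have "(\<integral>\<omega>. indicator {\<omega>\<in>space M. Z 0 \<omega> = 1} \<omega> * x ^ Z t \<omega> \<partial>M) = F 0 t x"
    using F_eq_expectation[of 0 t x] t x by simp
  finally show ?thesis .
qed

lemma split_alone:
  assumes s: "0 \<le> s" "s \<le> u" and x: "x \<in> {0..1}"
  shows "alone s * F s u x = x * prob (stay s u) + (\<integral>\<omega>. indicator (leave s u) \<omega> * x ^ Z u \<omega> \<partial>M)"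
proof -
  note i = power_integrable[OF _ x]
  have "alone s * F s u x = (\<integral>\<omega>. indicator {\<omega>\<in>space M. Z s \<omega> = 1} \<omega> * x ^ Z u \<omega> \<partial>M)"
    by (rule F_eq_expectation[OF s x, symmetric])
  also have "\<dots> = (\<integral>\<omega>. indicator (stay s u) \<omega> * x ^ Z u \<omega> + indicator (leave s u) \<omega> * x ^ Z u \<omega> \<partial>M)"
    by (rule Bochner_Integration.integral_cong)
       (simp_all only: indicator_alone[OF s(2)] distrib_right)
  also have "\<dots> = (\<integral>\<omega>. indicator (stay s u) \<omega> * x ^ Z u \<omega> \<partial>M) + (\<integral>\<omega>. indicator (leave s u) \<omega> * x ^ Z u \<omega> \<partial>M)"
    by (rule Bochner_Integration.integral_add) (use s stay_sets leave_sets in \<open>auto intro!: i\<close>)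
  also have "(\<integral>\<omega>. indicator (stay s u) \<omega> * x ^ Z u \<omega> \<partial>M) = (\<integral>\<omega>. indicator (stay s u) \<omega> * x \<partial>M)"
  proof (rule Bochner_Integration.integral_cong)
    show "indicator (stay s u) \<omega> * x ^ Z u \<omega> = indicator (stay s u) \<omega> * x" for \<omega>
      by (cases "\<omega> \<in> stay s u") (use s in \<open>simp_all add: stay_def\<close>)
  qed simp
  also have "\<dots> = x * prob (stay s u)" using stay_sets[OF s] by simp
  finally show ?thesis .
qed

lemma leave_power_bounds:
  assumes s: "0 \<le> s" "s \<le> u" and x: "x \<in> {0..1}"
  shows "(\<integral>\<omega>. indicator (leave s u) \<omega> * x ^ Z u \<omega> \<partial>M) \<in> {0..prob (leave s u)}"
proof -
  have "(\<integral>\<omega>. indicator (leave s u) \<omega> * x ^ Z u \<omega> \<partial>M) \<le> (\<integral>\<omega>. indicator (leave s u) \<omega> \<partial>M)"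
    by (rule integral_mono) (use s x leave_sets[OF s] in \<open>auto intro!: power_integrable simp: power_le_one less_top[symmetric] split: split_indicator\<close>)
  moreover have "0 \<le> (\<integral>\<omega>. indicator (leave s u) \<omega> * x ^ Z u \<omega> \<partial>M)"
    by (rule integral_nonneg_AE) (use x in auto)
  ultimately show ?thesis using leave_sets[OF s] by simp
qed

text \<open>The outer terms assume that all paths leaving state 1 contribute 0 or 1, respectively.\<close>

lemma F_between:
  assumes s: "0 \<le> s" "s \<le> u" and x: "x \<in> {0..1}"
  shows "x * exp (- (L u - L s)) \<le> F s u x" "F s u x \<le> x * exp (- (L u - L s)) + (1 - exp (- (L u - L s)))"
proof -
  have "alone s * (x * exp (- (L u - L s))) \<le> alone s * F s u x"
     "alone s * F s u x \<le> alone s * (x * exp (- (L u - L s)) + (1 - exp (- (L u - L s))))"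
    using split_alone[OF s x] leave_power_bounds[OF s x] prob_stay[OF s] prob_leave[OF s]
    by (auto simp: algebra_simps)
  then show "x * exp (- (L u - L s)) \<le> F s u x" "F s u x \<le> x * exp (- (L u - L s)) + (1 - exp (- (L u - L s)))"
    using alone_pos[OF s(1)] by auto
qed

lemma F_near:
  assumes s: "0 \<le> s" "s \<le> u" and x: "x \<in> {0..1}"
  shows "\<bar>F s u x - x\<bar> \<le> L u - L s"
proof -
  let ?e = "exp (- (L u - L s))"
  have e: "1 - ?e \<le> L u - L s" using exp_ge_add_one_self[of "- (L u - L s)"] by linarith
  have "?e \<le> 1" using L_mono[OF s] by simp
  then have "x * (1 - ?e) \<le> 1 - ?e" "0 \<le> x * (1 - ?e)" using x by (auto intro: mult_left_le_one_le)
  then show ?thesis using F_between[OF s x] e by (simp add: algebra_simps abs_le_iff)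
qed

text \<open>On the event that state 1 is left before \<open>u\<close>, replacing \<open>Z u\<close> by the state entered changes the
expectation only to second order. If the first change falls into the cell ending at the grid point \<open>r\<close>,
the Markov property at \<open>r\<close> replaces \<open>x\<close> by \<open>F r u x\<close>, which is within \<open>L u - L s\<close> of \<open>x\<close>; so the
\<open>k\<close>-th powers differ by at most \<open>min 1 (k (L u - L s))\<close>. This bound passes to the limit of
fine grids.\<close>

lemma second_jump_estimate:
  assumes s: "0 \<le> s" "s \<le> u" and x: "x \<in> {0..1}"
  shows "\<bar>(\<integral>\<omega>. indicator (leave s u) \<omega> * x ^ Z u \<omega> \<partial>M) - (\<integral>\<omega>. indicator (leave s u) \<omega> * x ^ \<kappa> s \<omega> \<partial>M)\<bar>
    \<le> alone s * ((1 + 1 / \<theta>) * (L u - L s)^2)"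
proof -
  let ?d = "L u - L s"
  \<comment> \<open>\<open>\<psi> k\<close> bounds the difference of the \<open>k\<close>-th powers of two numbers in \<open>[0, 1]\<close> at distance at most
\<open>?d\<close>.\<close>
  define \<psi> where "\<psi> = (\<lambda>k. min 1 (?d * real k))"
  have d: "0 \<le> ?d" using L_mono[OF s] by simp
  have psi: "\<bar>\<psi> k\<bar> \<le> 1" for k using d by (simp add: \<psi>_def)
  have pow: "\<bar>x ^ k\<bar> \<le> 1" for k using x by (simp add: power_le_one)
  let ?E = "\<integral>\<omega>. indicator (leave s u) \<omega> * x ^ Z u \<omega> \<partial>M"
  have bound: "\<bar>?E - (\<integral>\<omega>. grid_sum s u (\<lambda>k. x ^ k) n \<omega> \<partial>M)\<bar> \<le> (\<integral>\<omega>. grid_sum s u \<psi> n \<omega> \<partial>M)" for n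
  proof -
    let ?t = "\<lambda>i. pt s u n (Suc i)" and ?c = "cell s u n"
    let ?y = "\<lambda>i. F (?t i) u x"
    let ?A = "\<lambda>\<omega>. \<Sum>i<Suc n. indicator (?c i) \<omega> * ?y i ^ Z (?t i) \<omega>"
    have t: "0 \<le> ?t i" for i using pt_ge[OF s(2), of n "Suc i"] s by linarith
    have tu: "?t i \<le> u" if "i < Suc n" for i using pt_le[OF s(2)] that by auto
    have c: "?c i \<in> sets M" for i using cell_sets[OF s] by (rule filtration_sets)
    have "?E = (\<integral>\<omega>. (\<Sum>i<Suc n. indicator (?c i) \<omega> * x ^ Z u \<omega>) \<partial>M)"
      by (simp only: sum_distrib_right[symmetric] sum_cell[OF s])
    also have "\<dots> = (\<Sum>i<Suc n. \<integral>\<omega>. indicator (?c i) \<omega> * x ^ Z u \<omega> \<partial>M)"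
      by (rule Bochner_Integration.integral_sum) (use s x c in \<open>auto intro!: power_integrable\<close>)
    also have "\<dots> = (\<Sum>i<Suc n. \<integral>\<omega>. indicator (?c i) \<omega> * ?y i ^ Z (?t i) \<omega> \<partial>M)"
      by (rule sum.cong) (use t tu x cell_sets[OF s] in \<open>auto intro!: markov_pgf\<close>)
    also have "\<dots> = (\<integral>\<omega>. ?A \<omega> \<partial>M)"
      by (rule Bochner_Integration.integral_sum[symmetric]) (use t F_bounds[OF x] c in \<open>auto intro!: power_integrable\<close>)
    finally have E: "?E = (\<integral>\<omega>. ?A \<omega> \<partial>M)" .
    have iy: "integrable M (\<lambda>\<omega>. \<Sum>i<Suc n. indicator (?c i) \<omega> * ?y i ^ Z (?t i) \<omega>)"
      by (intro Bochner_Integration.integrable_sum power_integrable t F_bounds x c)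
    have iS: "integrable M (grid_sum s u (\<lambda>k. x ^ k) n)" "integrable M (grid_sum s u \<psi> n)"
      using grid_sum_integrable[OF s] pow psi by blast+
    have diff: "?E - (\<integral>\<omega>. grid_sum s u (\<lambda>k. x ^ k) n \<omega> \<partial>M) =
        (\<integral>\<omega>. ?A \<omega> - grid_sum s u (\<lambda>k. x ^ k) n \<omega> \<partial>M)"
      unfolding E by (rule Bochner_Integration.integral_diff[OF iy iS(1), symmetric])
    show ?thesis unfolding diff
    proof (rule order.trans[OF integral_abs_bound integral_mono])
      show "integrable M (\<lambda>\<omega>. \<bar>?A \<omega> - grid_sum s u (\<lambda>k. x ^ k) n \<omega>\<bar>)"
        by (rule integrable_abs[OF Bochner_Integration.integrable_diff[OF iy iS(1)]])
      show "integrable M (grid_sum s u \<psi> n)" by (rule iS)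
      fix \<omega>
      have "\<bar>?A \<omega> - grid_sum s u (\<lambda>k. x ^ k) n \<omega>\<bar> =
        \<bar>\<Sum>i<Suc n. indicator (?c i) \<omega> * (?y i ^ Z (?t i) \<omega> - x ^ Z (?t i) \<omega>)\<bar>"
        unfolding grid_sum_def sum_subtractf[symmetric] right_diff_distrib ..
      also have "\<dots> \<le> (\<Sum>i<Suc n. \<bar>indicator (?c i) \<omega> * (?y i ^ Z (?t i) \<omega> - x ^ Z (?t i) \<omega>)\<bar>)"
        by (rule sum_abs)
      also have "\<dots> \<le> grid_sum s u \<psi> n \<omega>" unfolding grid_sum_def
      proof (rule sum_mono)
        fix i assume "i \<in> {..<Suc n}"
        then have tu: "?t i \<le> u" using tu by auto
        have y: "?y i \<in> {0..1}" by (rule F_bounds[OF x])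
        have "\<bar>?y i ^ k - x ^ k\<bar> \<le> \<psi> k" for k
        proof -
          have "\<bar>?y i ^ k - x ^ k\<bar> \<le> real k * \<bar>?y i - x\<bar>"
            using norm_power_diff[of "?y i" x k] x y by simp
          also have "\<bar>?y i - x\<bar> \<le> ?d"
            using F_near[OF t tu x] L_mono[OF s(1) pt_ge[OF s(2)], of n "Suc i"] by linarith
          finally have "\<bar>?y i ^ k - x ^ k\<bar> \<le> real k * ?d" by (simp add: mult_left_mono)
          moreover have "0 \<le> ?y i ^ k" "?y i ^ k \<le> 1" "0 \<le> x ^ k" "x ^ k \<le> 1"
            using x y by (auto simp: power_le_one)
          ultimately show ?thesis by (simp add: \<psi>_def mult.commute abs_le_iff)
        qed
        then show "\<bar>indicator (?c i) \<omega> * (?y i ^ Z (?t i) \<omega> - x ^ Z (?t i) \<omega>)\<bar> \<le> indicator (?c i) \<omega> * \<psi> (Z (?t i) \<omega>)"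
          by (simp add: abs_mult split: split_indicator)
      qed
      finally show "\<bar>?A \<omega> - grid_sum s u (\<lambda>k. x ^ k) n \<omega>\<bar> \<le> grid_sum s u \<psi> n \<omega>" .
    qed
  qed
  have "(\<lambda>n. \<integral>\<omega>. grid_sum s u (\<lambda>k. x ^ k) n \<omega> \<partial>M) \<longlonglongrightarrow> (\<integral>\<omega>. indicator (leave s u) \<omega> * x ^ \<kappa> s \<omega> \<partial>M)"
    by (rule grid_sum_integral_tendsto[OF s pow])
  then have lim: "(\<lambda>n. \<bar>?E - (\<integral>\<omega>. grid_sum s u (\<lambda>k. x ^ k) n \<omega> \<partial>M)\<bar>) \<longlonglongrightarrow>
      \<bar>?E - (\<integral>\<omega>. indicator (leave s u) \<omega> * x ^ \<kappa> s \<omega> \<partial>M)\<bar>"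
    by (intro tendsto_rabs tendsto_diff tendsto_const)
  have "\<bar>?E - (\<integral>\<omega>. indicator (leave s u) \<omega> * x ^ \<kappa> s \<omega> \<partial>M)\<bar> \<le> (\<integral>\<omega>. indicator (leave s u) \<omega> * \<psi> (\<kappa> s \<omega>) \<partial>M)"
    by (rule LIMSEQ_le[OF lim grid_sum_integral_tendsto[OF s psi]], intro exI[of _ 0] allI impI bound)
  also have "\<dots> \<le> alone s * (?d * ((1 + 1 / \<theta>) * ?d))"
    unfolding \<psi>_def by (rule jump_mean[OF s d])
  finally show ?thesis by (simp add: power2_eq_square mult_ac)
qed

text \<open>The integrated backward equation to first order: the individual survives with probability about
\<open>1 - (L u - L s)\<close>, and otherwise its offspring, with generating function \<open>h r\<close>, remain unchanged up to \<open>u\<close>.\<close>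

lemma F_expansion:
  assumes s: "0 \<le> s" "s \<le> u" and x: "x \<in> {0..1}"
  shows "\<bar>F s u x - (x - x * (L u - L s) + Lint (\<lambda>r. h r x) s u)\<bar> \<le> (3 + 1 / \<theta>) * (L u - L s)^2"
proof -
  let ?d = "L u - L s" and ?e = "\<lambda>r. exp (- (L r - L s))"
  have d: "0 \<le> ?d" using L_mono[OF s] by simp
  have h: "h r x \<in> {0..1}" if "0 \<le> r" for r
    using pgf_bounds[OF x, of "p r"] offspring_pgf[OF that x] by simp
  have "alone s * \<bar>F s u x - (x * ?e u + Lint (\<lambda>r. ?e r * h r x) s u)\<bar> \<le> alone s * ((1 + 1 / \<theta>) * ?d^2)"
    using second_jump_estimate[OF s x] alone_pos[OF s(1)]
    unfolding jump_pgf[OF s x] abs_mult_pos'[OF less_imp_le[OF alone_pos[OF s(1)]]]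
    by (simp add: right_diff_distrib distrib_left split_alone[OF s x] prob_stay[OF s] mult_ac)
  then have 1: "\<bar>F s u x - (x * ?e u + Lint (\<lambda>r. ?e r * h r x) s u)\<bar> \<le> (1 + 1 / \<theta>) * ?d^2"
    using alone_pos[OF s(1)] by simp
  have "\<bar>x * ?e u - x * (1 - ?d)\<bar> \<le> 1 * ?d^2"
    unfolding right_diff_distrib[symmetric] abs_mult using x exp_minus_second_order[OF d]
    by (intro mult_mono) auto
  then have 2: "\<bar>x * ?e u - (x - x * ?d)\<bar> \<le> ?d^2" by (simp add: algebra_simps)
  have "Lint (\<lambda>r. ?e r * h r x) s u = Lint (\<lambda>r. h r x + (?e r + -1) * h r x) s u"
    by (simp add: algebra_simps)
  also have "\<dots> = Lint (\<lambda>r. h r x) s u + Lint (\<lambda>r. (?e r + -1) * h r x) s u"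
    by (intro Lint_add admissible_mult admissible_add admissible_const admissible_exp_L h_admissible s)
  also have "\<bar>Lint (\<lambda>r. (?e r + -1) * h r x) s u\<bar> \<le> ?d * ?d"
  proof (rule Lint_bound[OF _ s])
    fix r assume r: "s \<le> r" "r \<le> u"
    then have "L s \<le> L r" "L r \<le> L u" using L_mono s by auto
    moreover from this have "?e r \<le> 1" by simp
    ultimately have "\<bar>?e r + -1\<bar> \<le> ?d" using exp_ge_add_one_self[of "-(L r - L s)"] by linarith
    then have "\<bar>(?e r + -1) * h r x\<bar> \<le> ?d * 1" unfolding abs_mult using h[of r] s r d
      by (intro mult_mono) auto
    then show "\<bar>(?e r + -1) * h r x\<bar> \<le> ?d" by simp
  qed (intro admissible_mult admissible_add admissible_const admissible_exp_L h_admissible)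
  ultimately have 3: "\<bar>Lint (\<lambda>r. ?e r * h r x) s u - Lint (\<lambda>r. h r x) s u\<bar> \<le> ?d^2"
    by (simp add: power2_eq_square)
  show ?thesis using 1 2 3 unfolding distrib_right by linarith
qed

end

section \<open>The explicit generating function\<close>

context rate begin

lemma has_increments_Lint:
  assumes X: "has_increments L t X H" and adm: "admissible X"
  shows "has_increments L t (Lint X 0) (\<lambda>s u. - (X u * (L u - L s)))"
proof -
  have mono: "mono_on {0..t} L" by (rule L_mono_on) auto
  obtain K where K: "\<And>s u. 0 \<le> s \<Longrightarrow> s \<le> u \<Longrightarrow> u \<le> t \<Longrightarrow> \<bar>X s - X u\<bar> \<le> K * (L u - L s)" "K \<ge> 0"
    using has_increments_imp_lipschitz[OF mono X] by metis
  obtain C where C: "\<And>u. 0 \<le> u \<Longrightarrow> u \<le> t \<Longrightarrow> \<bar>X u\<bar> \<le> C"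
    using adm unfolding admissible_def by (meson atLeastAtMost_iff)
  show ?thesis
  proof (rule has_incrementsI[OF mono])
    fix s u assume su: "0 \<le> s" "s \<le> u" "u \<le> t"
    have "\<bar>Lint X s u - X u * (L u - L s)\<bar> \<le> K * (L u - L s) * (L u - L s)"
    proof (rule Lint_near_const[OF adm su(1,2)])
      fix r assume r: "s \<le> r" "r \<le> u"
      have "\<bar>X r - X u\<bar> \<le> K * (L u - L r)" using r su by (intro K) auto
      also have "\<dots> \<le> K * (L u - L s)" using L_mono[of s r] r su K(2) by (intro mult_left_mono) auto
      finally show "\<bar>X r - X u\<bar> \<le> K * (L u - L s)" .
    qed
    then show "\<bar>Lint X 0 s - Lint X 0 u - - (X u * (L u - L s))\<bar> \<le> K * (L u - L s)^2"
      using Lint_split[OF adm, of 0 s u] su by (simp add: power2_eq_square mult_ac abs_minus_commute)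
    show "\<bar>- (X u * (L u - L s))\<bar> \<le> C * (L u - L s)"
      using C[of u] L_mono[of s u] su by (simp add: abs_mult mult_right_mono)
  qed
qed

end

context theta_process begin

text \<open>\<open>B\<close> is the logarithm of the mean and \<open>E\<close> is \<open>\<mu>\<^sup>-\<^sup>\<theta>\<close>, so that \<open>V\<close> is \<open>\<theta> / (1 + \<theta>)\<close> times \<open>R\<close>; these
identities are \<open>mu_eq\<close>, \<open>E_powr\<close> and \<open>V_eq\<close> below. The formulas involve only the parameters, since the
mean is computed after the generating function.\<close>

definition B :: "real \<Rightarrow> real" where "B t = Lint a 0 t - L t"

definition E :: "real \<Rightarrow> real" where "E t = exp (- \<theta> * B t)"

definition R :: "real \<Rightarrow> real" where "R t = Lint E 0 t"

lemma B_diff: "0 \<le> s \<Longrightarrow> s \<le> u \<Longrightarrow> B u - B s = Lint a s u - (L u - L s)"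
  using Lint_split[OF a_admissible, of 0 s u] by (simp add: B_def)

lemma Lint_a_bounds:
  assumes "0 \<le> s" "s \<le> u" shows "0 \<le> Lint a s u" "Lint a s u \<le> (1 + 1 / \<theta>) * (L u - L s)"
proof -
  show "0 \<le> Lint a s u" by (rule Lint_nonneg[OF a_admissible assms(1)]) (use a_range assms in auto)
  have "Lint a s u \<le> Lint (\<lambda>_. 1 + 1 / \<theta>) s u"
    by (rule Lint_mono[OF a_admissible admissible_const assms(1)]) (use a_range assms in auto)
  then show "Lint a s u \<le> (1 + 1 / \<theta>) * (L u - L s)" using Lint_const[OF assms] by simp
qed

lemma B_0 [simp]: "B 0 = 0"
  using Lint_self[OF a_admissible] by (simp add: B_def L_0)

lemma B_bound: "0 \<le> t \<Longrightarrow> \<bar>B t\<bar> \<le> (2 + 1 / \<theta>) * L t"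
  using B_diff[of 0 t] Lint_a_bounds[of 0 t] L_nonneg[of t] by (simp add: L_0 distrib_right)

lemma B_le: "0 \<le> t \<Longrightarrow> B t \<le> L t / \<theta>"
  using Lint_a_bounds[of 0 t] by (simp add: B_def L_0 distrib_right)

lemma B_continuous: "continuous_on {0..} B"
  unfolding B_def by (intro continuous_intros Lint_continuous a_admissible L_continuous)

lemma E_admissible: "admissible E"
  unfolding E_def by (rule admissible_continuous) (intro continuous_intros B_continuous)

lemma E_pos: "E t > 0" by (simp add: E_def)

lemma R_mono: "0 \<le> s \<Longrightarrow> s \<le> t \<Longrightarrow> R s \<le> R t"
  using Lint_split[OF E_admissible, of 0 s t] Lint_nonneg[OF E_admissible, of s t] E_pos
  by (simp add: R_def less_imp_le)

lemma R_nonneg: "0 \<le> t \<Longrightarrow> 0 \<le> R t"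
  using Lint_nonneg[OF E_admissible, of 0 t] E_pos by (simp add: R_def less_imp_le)

lemma R_0: "R 0 = 0" by (simp add: R_def Lint_self E_admissible)

lemma F_refl: "0 \<le> t \<Longrightarrow> x \<in> {0..1} \<Longrightarrow> F t t x = x"
  using F_near[of t t x] by simp

lemma one_minus_F_range:
  assumes s: "0 \<le> s" "s \<le> t" and x: "x \<in> {0..1}"
  shows "1 - F s t x \<in> {(1 - x) * exp (- L t)..1}"
proof -
  have "(1 - x) * exp (- L t) \<le> (1 - x) * exp (- (L t - L s))"
    using L_nonneg[OF s(1)] x by (intro mult_left_mono) auto
  also have "\<dots> \<le> 1 - F s t x" using F_between(2)[OF s x] by (simp add: algebra_simps)
  finally show ?thesis using F_bounds[OF x, of s t] by simp
qed

lemma has_increments_B: "has_increments L t B (\<lambda>s u. - (Lint a s u - (L u - L s)))"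
proof (rule has_incrementsI[where C=0 and D="2 + 1 / \<theta>"])
  show "mono_on {0..t} L" by (rule L_mono_on) auto
  fix s u assume su: "0 \<le> s" "s \<le> u" "u \<le> t"
  show "\<bar>B s - B u - - (Lint a s u - (L u - L s))\<bar> \<le> 0 * (L u - L s)\<^sup>2" using B_diff[OF su(1,2)] by simp
  show "\<bar>- (Lint a s u - (L u - L s))\<bar> \<le> (2 + 1 / \<theta>) * (L u - L s)"
    using Lint_a_bounds[OF su(1,2)] L_mono[OF su(1,2)] by (simp add: distrib_right)
qed

text \<open>The expansion \<open>F_expansion\<close> at \<open>F u t x\<close>, combined with the semigroup property; the special
offspring law makes the first-order term a Bernoulli right-hand side.\<close>

lemma has_increments_F:
  assumes x: "x \<in> {0..1}"
  shows "has_increments L t (\<lambda>s. 1 - F s t x)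
    (\<lambda>s u. (1 - F u t x) * (Lint a s u - (L u - L s)) - Lint a s u / (1 + \<theta>) * (1 - F u t x) powr (1 + \<theta>))"
proof (rule has_incrementsI)
  show "mono_on {0..t} L" by (rule L_mono_on) auto
  fix s u assume su: "0 \<le> s" "s \<le> u" "u \<le> t"
  let ?y = "F u t x" let ?d = "L u - L s"
  have y: "?y \<in> {0..1}" by (rule F_bounds[OF x])
  have "Lint (\<lambda>r. h r ?y) s u = Lint (\<lambda>r. 1 + (- (1 - ?y) + (1 - ?y) powr (1 + \<theta>) / (1 + \<theta>)) * a r) s u"
    by (simp add: h_def algebra_simps)
  also have "\<dots> = ?d + (- (1 - ?y) + (1 - ?y) powr (1 + \<theta>) / (1 + \<theta>)) * Lint a s u"
    using su by (simp add: Lint_add Lint_cmult L_diff admissible_const admissible_mult a_admissible)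
  finally have "1 - F s t x - (1 - ?y) - ((1 - ?y) * (Lint a s u - ?d) - Lint a s u / (1 + \<theta>) * (1 - ?y) powr (1 + \<theta>))
      = - (F s u ?y - (?y - ?y * ?d + Lint (\<lambda>r. h r ?y) s u))"
    using F_compose[OF su x] by (simp add: algebra_simps)
  then show "\<bar>1 - F s t x - (1 - ?y) - ((1 - ?y) * (Lint a s u - ?d) - Lint a s u / (1 + \<theta>) * (1 - ?y) powr (1 + \<theta>))\<bar>
      \<le> (3 + 1 / \<theta>) * ?d^2"
    using F_expansion[OF su(1,2) y] by simp
  have Lint: "0 \<le> Lint a s u" "Lint a s u \<le> (1 + 1 / \<theta>) * ?d" "0 \<le> ?d"
    using Lint_a_bounds[OF su(1,2)] L_mono[OF su(1,2)] by auto
  have "\<bar>(1 - ?y) * (Lint a s u - ?d)\<bar> \<le> 1 * ((2 + 1 / \<theta>) * ?d)"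
    unfolding abs_mult using y Lint by (intro mult_mono) (auto simp: distrib_right)
  moreover have "\<bar>Lint a s u / (1 + \<theta>) * (1 - ?y) powr (1 + \<theta>)\<bar> \<le> ((1 + 1 / \<theta>) * ?d) * 1"
    unfolding abs_mult
  proof (rule mult_mono)
    have "\<bar>Lint a s u / (1 + \<theta>)\<bar> \<le> Lint a s u" using Lint(1) theta by (simp add: field_simps)
    then show "\<bar>Lint a s u / (1 + \<theta>)\<bar> \<le> (1 + 1 / \<theta>) * ?d" using Lint by linarith
    show "\<bar>(1 - ?y) powr (1 + \<theta>)\<bar> \<le> 1" using y theta by (simp add: powr_le1)
  qed (use Lint theta in auto)
  ultimately have "\<bar>(1 - ?y) * (Lint a s u - ?d) - Lint a s u / (1 + \<theta>) * (1 - ?y) powr (1 + \<theta>)\<bar>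
    \<le> (2 + 1 / \<theta>) * ?d + (1 + 1 / \<theta>) * ?d" by linarith
  also have "\<dots> = (3 + 2 / \<theta>) * ?d" by (simp add: algebra_simps)
  finally show "\<bar>(1 - ?y) * (Lint a s u - ?d) - Lint a s u / (1 + \<theta>) * (1 - ?y) powr (1 + \<theta>)\<bar>
    \<le> (3 + 2 / \<theta>) * ?d" .
qed

text \<open>Put \<open>f s = 1 - F s t x\<close> and take increments backwards, from \<open>u\<close> to \<open>s\<close>. To first order the
logarithm of \<open>f exp B\<close> has increment \<open>- a f\<^sup>\<theta> / (1 + \<theta>) d\<Lambda>\<close>, hence
\<open>(f exp B)\<^sup>-\<^sup>\<theta>\<close> has increment \<open>\<theta> a E / (1 + \<theta>) d\<Lambda>\<close>. The increment of \<open>E\<close> is \<open>\<theta> (a - 1) E d\<Lambda>\<close>, and that of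
\<open>R\<close> is \<open>- E d\<Lambda>\<close>. So a linear combination of the three has vanishing first-order increments and is
constant.\<close>

theorem explicit_pgf:
  assumes s: "0 \<le> s" "s \<le> t" and x: "0 \<le> x" "x < 1"
  shows "(1 - F s t x) powr (- \<theta>) * E s =
    (1 - x) powr (- \<theta>) * E t + (E s - E t) / (1 + \<theta>) + \<theta> / (1 + \<theta>) * (R t - R s)"
proof -
  have t: "0 \<le> t" and x': "x \<in> {0..1}" using s x by auto
  have mono: "mono_on {0..t} L" by (rule L_mono_on) auto
  define f where "f = (\<lambda>s. 1 - F s t x)"
  define c where "c = (1 - x) * exp (- L t)"
  have c: "0 < c" "c \<le> 1" using x L_nonneg[OF t] by (auto simp: c_def intro: mult_le_one)
  have f: "f s \<in> {c..1}" if "0 \<le> s" "s \<le> t" for s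
    unfolding f_def c_def by (rule one_minus_F_range[OF that x'])
  let ?H = "\<lambda>s u. f u * (Lint a s u - (L u - L s)) - Lint a s u / (1 + \<theta>) * f u powr (1 + \<theta>)"
  have 1: "has_increments L t f ?H" unfolding f_def by (rule has_increments_F[OF x'])
  have 2: "has_increments L t (\<lambda>s. ln (f s)) (\<lambda>s u. inverse (f u) * ?H s u)"
    by (rule has_increments_ln[OF mono 1 f c])
  let ?X = "\<lambda>s. ln (f s) + B s" and ?K = "\<lambda>s u. inverse (f u) * ?H s u + - (Lint a s u - (L u - L s))"
  have 3: "has_increments L t ?X ?K"
    by (rule has_increments_add[OF 2 has_increments_B])
  have B: "\<bar>B s\<bar> \<le> (2 + 1 / \<theta>) * L t" if "0 \<le> s" "s \<le> t" for s
    using B_bound[OF that(1)] mult_left_mono[OF L_mono[OF that], of "2 + 1 / \<theta>"] theta by simp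
  have X: "\<bar>?X s\<bar> \<le> \<bar>ln c\<bar> + (2 + 1 / \<theta>) * L t" if "0 \<le> s" "s \<le> t" for s
  proof -
    have "ln c \<le> ln (f s)" "ln (f s) \<le> 0" using f[OF that] c by auto
    then show ?thesis using B[OF that] by linarith
  qed
  have k: "\<bar>- \<theta>\<bar> \<le> 1" using theta by simp
  have E: "has_increments L t E (\<lambda>s u. - \<theta> * E u * (- (Lint a s u - (L u - L s))))"
    unfolding E_def by (rule has_increments_exp[OF mono has_increments_B B k])
  let ?D = "\<lambda>s. (exp (- \<theta> * ?X s) + (- 1 / (1 + \<theta>)) * E s) + \<theta> / (1 + \<theta>) * Lint E 0 s"
  have "?D s = ?D t"
  proof (rule has_increments_0_imp_const[OF t _ mono _ _ s])
    show "continuous_on {0..t} L" using L_continuous by (rule continuous_on_subset) auto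
    show "has_increments L t ?D (\<lambda>s u. (- \<theta> * exp (- \<theta> * ?X u) * ?K s u +
       (- 1 / (1 + \<theta>)) * (- \<theta> * E u * (- (Lint a s u - (L u - L s))))) + \<theta> / (1 + \<theta>) * (- (E u * (L u - L s))))"
      by (intro has_increments_add has_increments_cmult has_increments_Lint[OF E E_admissible]
          has_increments_exp[OF mono 3 X k] E)
    fix s u assume su: "0 \<le> s" "s \<le> u" "u \<le> t"
    have fu: "f u > 0" using f[of u] su c by auto
    have K: "?K s u = - (Lint a s u / (1 + \<theta>) * f u powr \<theta>)"
    proof -
      \<comment> \<open>Dividing the Bernoulli right-hand side by \<open>f\<close> and adding the increment of \<open>B\<close> removes the linear
term.\<close>
      have key: "inverse z * (z * \<alpha> - \<beta> * (z * w)) + - \<alpha> = - (\<beta> * w)" if "z \<noteq> 0" for z w \<alpha> \<beta> :: real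
        using that by (simp add: field_simps)
      have "f u powr (1 + \<theta>) = f u * f u powr \<theta>" using fu by (simp add: powr_add)
      then show ?thesis by (simp only:) (rule key, use fu in simp)
    qed
    have "exp (- \<theta> * ?X u) * f u powr \<theta> = E u"
      using fu by (simp add: E_def powr_def distrib_left flip: exp_add)
    then have "- \<theta> * exp (- \<theta> * ?X u) * ?K s u = \<theta> * (Lint a s u / (1 + \<theta>)) * E u"
      unfolding K by (simp add: mult_ac)
    then show "(- \<theta> * exp (- \<theta> * ?X u) * ?K s u +
       (- 1 / (1 + \<theta>)) * (- \<theta> * E u * (- (Lint a s u - (L u - L s))))) + \<theta> / (1 + \<theta>) * (- (E u * (L u - L s))) = 0"
      using theta by (simp add: field_simps)
  qed
  moreover have exv: "exp (- \<theta> * ?X v) = f v powr (- \<theta>) * E v" if "0 \<le> v" "v \<le> t" for v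
    using f[OF that] c by (simp add: E_def powr_def distrib_left algebra_simps flip: exp_add)
  moreover have ft: "f t = 1 - x" unfolding f_def using F_refl[OF t x'] by simp
  ultimately have D: "?D s = ?D t" by blast
  have ex: "exp (- \<theta> * ?X s) = f s powr (- \<theta>) * E s"
      "exp (- \<theta> * ?X t) = (1 - x) powr (- \<theta>) * E t"
    using exv[OF s] exv[OF t order.refl] unfolding ft .
  have "f s powr (- \<theta>) * E s + (- 1 / (1 + \<theta>)) * E s + \<theta> / (1 + \<theta>) * R s =
     (1 - x) powr (- \<theta>) * E t + (- 1 / (1 + \<theta>)) * E t + \<theta> / (1 + \<theta>) * R t"
    using D unfolding R_def ex .
  then show ?thesis unfolding f_def by (simp add: diff_divide_distrib right_diff_distrib)
qed

end

section \<open>Almost sure convergence of bounded martingales\<close>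

text \<open>A martingale with values in \<open>[0, 1]\<close> and right-continuous paths, indexed by \<open>[T, \<infinity>)\<close>. Boundedness
makes it bounded in \<open>L\<^sup>2\<close>, so orthogonality of increments suffices for convergence.\<close>

locale bounded_martingale = prob_space M for M :: "'w measure" +
  fixes Fl :: "real \<Rightarrow> 'w measure" and Y :: "real \<Rightarrow> 'w \<Rightarrow> real" and T :: real
  assumes subalgebra: "subalgebra M (Fl s)"
    and increasing: "s \<le> t \<Longrightarrow> sets (Fl s) \<subseteq> sets (Fl t)"
    and adapted: "T \<le> t \<Longrightarrow> Y t \<in> borel_measurable (Fl t)"
    and bounded: "T \<le> t \<Longrightarrow> \<omega> \<in> space M \<Longrightarrow> Y t \<omega> \<in> {0..1}"
    and martingale: "T \<le> s \<Longrightarrow> s \<le> t \<Longrightarrow> A \<in> sets (Fl s) \<Longrightarrow>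
      (\<integral>\<omega>. indicator A \<omega> * Y t \<omega> \<partial>M) = (\<integral>\<omega>. indicator A \<omega> * Y s \<omega> \<partial>M)"
    and right_continuous: "T \<le> t \<Longrightarrow> \<omega> \<in> space M \<Longrightarrow> continuous (at_right t) (\<lambda>u. Y u \<omega>)"
begin

lemma measurable_mono: "s \<le> t \<Longrightarrow> f \<in> borel_measurable (Fl s) \<Longrightarrow> f \<in> borel_measurable (Fl t)"
  for f :: "'w \<Rightarrow> real"
  by (rule measurable_from_subalg[of _ "Fl s"])
     (use increasing subalgebra in \<open>auto simp: subalgebra_def\<close>)

lemma measurable_M: "f \<in> borel_measurable (Fl s) \<Longrightarrow> f \<in> borel_measurable M" for f :: "'w \<Rightarrow> real"
  by (rule measurable_from_subalg[OF subalgebra])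

lemma bounded_integrable:
  fixes f :: "'w \<Rightarrow> real"
  assumes "f \<in> borel_measurable M" "\<And>\<omega>. \<omega> \<in> space M \<Longrightarrow> \<bar>f \<omega>\<bar> \<le> C"
  shows "integrable M f"
  by (rule integrable_const_bound[where B=C]) (use assms in auto)

lemma Y_measurable: "T \<le> t \<Longrightarrow> Y t \<in> borel_measurable M"
  using adapted measurable_M by blast

lemma Y_integrable: "T \<le> t \<Longrightarrow> integrable M (Y t)"
  by (rule bounded_integrable[where C=1]) (use bounded Y_measurable in force)+

text \<open>\<open>Y s\<close> is a version of the conditional expectation of \<open>Y t\<close>.\<close>

lemma orthogonal:
  assumes st: "T \<le> s" "s \<le> t" and X: "X \<in> borel_measurable (Fl s)" "\<And>\<omega>. \<omega> \<in> space M \<Longrightarrow> \<bar>X \<omega>\<bar> \<le> C"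
  shows "(\<integral>\<omega>. X \<omega> * Y t \<omega> \<partial>M) = (\<integral>\<omega>. X \<omega> * Y s \<omega> \<partial>M)"
proof -
  have t: "T \<le> t" using st by simp
  interpret S: finite_measure_subalgebra M "Fl s" by unfold_locales (rule subalgebra)
  have ce: "AE \<omega> in M. real_cond_exp M (Fl s) (Y t) \<omega> = Y s \<omega>"
  proof (rule S.real_cond_exp_charact)
    fix A assume "A \<in> sets (Fl s)"
    then show "(\<integral>\<omega>\<in>A. Y t \<omega> \<partial>M) = (\<integral>\<omega>\<in>A. Y s \<omega> \<partial>M)"
      using martingale[OF st] by (simp add: set_lebesgue_integral_def)
  qed (use st t Y_integrable adapted in auto)
  have XM: "X \<in> borel_measurable M" by (rule measurable_M[OF X(1)])
  have "integrable M (\<lambda>\<omega>. X \<omega> * Y t \<omega>)"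
  proof (rule bounded_integrable[where C="C"])
    fix \<omega> assume w: "\<omega> \<in> space M"
    show "\<bar>X \<omega> * Y t \<omega>\<bar> \<le> C"
      using mult_mono[of "\<bar>X \<omega>\<bar>" C "\<bar>Y t \<omega>\<bar>" 1] X(2)[OF w] bounded[OF t w] by (simp add: abs_mult)
  qed (use XM Y_measurable[OF t] in simp)
  then have "(\<integral>\<omega>. X \<omega> * Y t \<omega> \<partial>M) = (\<integral>\<omega>. X \<omega> * real_cond_exp M (Fl s) (Y t) \<omega> \<partial>M)"
    using S.real_cond_exp_intg(2)[OF _ X(1) Y_measurable[OF t]] by simp
  also have "\<dots> = (\<integral>\<omega>. X \<omega> * Y s \<omega> \<partial>M)"
    by (rule integral_cong_AE) (use ce XM Y_measurable[OF st(1)] in \<open>auto intro: measurable_M\<close>)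
  finally show ?thesis .
qed

lemma Pythagoras:
  assumes st: "T \<le> r" "r \<le> s" "s \<le> t" and A: "A \<in> sets (Fl s)"
  shows "(\<integral>\<omega>. indicator A \<omega> * (Y t \<omega> - Y r \<omega>)^2 \<partial>M) =
     (\<integral>\<omega>. indicator A \<omega> * (Y s \<omega> - Y r \<omega>)^2 \<partial>M) + (\<integral>\<omega>. indicator A \<omega> * (Y t \<omega> - Y s \<omega>)^2 \<partial>M)"
proof -
  have T: "T \<le> s" "T \<le> t" using st by auto
  have AM [measurable]: "A \<in> sets M" using A subalgebra by (auto simp: subalgebra_def)
  note [measurable] = Y_measurable[OF st(1)] Y_measurable[OF T(1)] Y_measurable[OF T(2)]
  let ?X = "\<lambda>\<omega>. indicator A \<omega> * (Y s \<omega> - Y r \<omega>)"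
  have XF: "?X \<in> borel_measurable (Fl s)"
    using A adapted[OF T(1)] measurable_mono[OF st(2) adapted[OF st(1)]] by simp
  have b: "\<bar>?X \<omega>\<bar> \<le> 1" if "\<omega> \<in> space M" for \<omega>
    using bounded[OF st(1) that] bounded[OF T(1) that] by (auto split: split_indicator)
  have i: "integrable M (\<lambda>\<omega>. indicator A \<omega> * (Y u \<omega> - Y v \<omega>)^2)" if "T \<le> u" "T \<le> v" for u v
  proof (rule bounded_integrable[where C=1])
    show "(\<lambda>\<omega>. indicator A \<omega> * (Y u \<omega> - Y v \<omega>)^2) \<in> borel_measurable M"
      using Y_measurable that by simp
    fix \<omega> assume w: "\<omega> \<in> space M"
    have "\<bar>Y u \<omega> - Y v \<omega>\<bar> \<le> 1" using bounded[OF that(1) w] bounded[OF that(2) w] by auto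
    then have "(Y u \<omega> - Y v \<omega>)^2 \<le> 1" by (simp add: abs_square_le_1)
    then show "\<bar>indicator A \<omega> * (Y u \<omega> - Y v \<omega>)^2\<bar> \<le> 1" by (auto split: split_indicator)
  qed
  have iX: "integrable M (\<lambda>\<omega>. ?X \<omega> * Y u \<omega>)" if "T \<le> u" for u
  proof (rule bounded_integrable[where C=1])
    show "(\<lambda>\<omega>. ?X \<omega> * Y u \<omega>) \<in> borel_measurable M" using Y_measurable[OF that] by simp
    fix \<omega> assume w: "\<omega> \<in> space M"
    show "\<bar>?X \<omega> * Y u \<omega>\<bar> \<le> 1"
      using mult_mono[OF b[OF w], of "\<bar>Y u \<omega>\<bar>" 1] bounded[OF that w] by (simp add: abs_mult)
  qed
  have "(\<integral>\<omega>. indicator A \<omega> * (Y t \<omega> - Y r \<omega>)^2 \<partial>M) =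
    (\<integral>\<omega>. (indicator A \<omega> * (Y s \<omega> - Y r \<omega>)^2 + indicator A \<omega> * (Y t \<omega> - Y s \<omega>)^2)
       + 2 * (?X \<omega> * Y t \<omega> - ?X \<omega> * Y s \<omega>) \<partial>M)"
    by (rule Bochner_Integration.integral_cong) (auto simp: power2_eq_square algebra_simps)
  also have "\<dots> = (\<integral>\<omega>. indicator A \<omega> * (Y s \<omega> - Y r \<omega>)^2 \<partial>M) + (\<integral>\<omega>. indicator A \<omega> * (Y t \<omega> - Y s \<omega>)^2 \<partial>M)
      + 2 * ((\<integral>\<omega>. ?X \<omega> * Y t \<omega> \<partial>M) - (\<integral>\<omega>. ?X \<omega> * Y s \<omega> \<partial>M))"
    using i[OF T(1) st(1)] i[OF T(2) T(1)] iX[OF T(1)] iX[OF T(2)]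
    by (simp add: Bochner_Integration.integral_add Bochner_Integration.integral_diff
       del: right_diff_distrib left_diff_distrib mult.assoc)
  finally show ?thesis using orthogonal[OF T(1) st(3) XF b] by simp
qed

definition oscillation :: "real \<Rightarrow> real \<Rightarrow> real" where
  "oscillation s t = (\<integral>\<omega>. (Y t \<omega> - Y s \<omega>)^2 \<partial>M)"

lemma square_integrable: "T \<le> s \<Longrightarrow> T \<le> t \<Longrightarrow> integrable M (\<lambda>\<omega>. (Y t \<omega> - Y s \<omega>)^2)"
proof (rule bounded_integrable[where C=1])
  assume st: "T \<le> s" "T \<le> t"
  then show "(\<lambda>\<omega>. (Y t \<omega> - Y s \<omega>)^2) \<in> borel_measurable M" using Y_measurable by simp
  fix \<omega> assume w: "\<omega> \<in> space M"
  have "\<bar>Y t \<omega> - Y s \<omega>\<bar> \<le> 1" using bounded[OF st(1) w] bounded[OF st(2) w] by auto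
  then show "\<bar>(Y t \<omega> - Y s \<omega>)^2\<bar> \<le> 1" by (simp add: abs_square_le_1)
qed

lemma oscillation_bounds: "T \<le> s \<Longrightarrow> T \<le> t \<Longrightarrow> oscillation s t \<in> {0..1}"
proof -
  assume st: "T \<le> s" "T \<le> t"
  have "oscillation s t \<le> (\<integral>\<omega>. 1 \<partial>M)" unfolding oscillation_def
  proof (rule integral_mono[OF square_integrable[OF st]])
    fix \<omega> assume w: "\<omega> \<in> space M"
    have "\<bar>Y t \<omega> - Y s \<omega>\<bar> \<le> 1" using bounded[OF st(1) w] bounded[OF st(2) w] by auto
    then show "(Y t \<omega> - Y s \<omega>)^2 \<le> 1" by (simp add: abs_square_le_1)
  qed simp
  then show ?thesis by (simp add: oscillation_def prob_space)
qed

lemma oscillation_add: "T \<le> r \<Longrightarrow> r \<le> s \<Longrightarrow> s \<le> t \<Longrightarrow> oscillation r t = oscillation r s + oscillation s t"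
proof -
  assume *: "T \<le> r" "r \<le> s" "s \<le> t"
  have sp: "space M \<in> sets (Fl s)" using sets.top[of "Fl s"] subalgebra[of s] unfolding subalgebra_def by metis
  have "(\<integral>\<omega>. indicator (space M) \<omega> * g \<omega> \<partial>M) = (\<integral>\<omega>. g \<omega> \<partial>M)" for g :: "'w \<Rightarrow> real"
    by (rule Bochner_Integration.integral_cong) auto
  then show ?thesis using Pythagoras[OF * sp] unfolding oscillation_def by simp
qed

text \<open>The squared \<open>L\<^sup>2\<close>-distances add up along increasing times and are bounded by 1, so they are
small from some time on.\<close>

lemma oscillation_vanishes:
  assumes e: "e > 0"
  obtains s where "T \<le> s" "\<And>t. s \<le> t \<Longrightarrow> oscillation s t \<le> e"
proof -
  define S where "S = (SUP t\<in>{T..}. oscillation T t)"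
  have bdd: "bdd_above (oscillation T ` {T..})"
    by (rule bdd_aboveI[of _ 1]) (use oscillation_bounds in auto)
  obtain s where s: "T \<le> s" "S - e < oscillation T s"
    using less_cSUP_iff[OF _ bdd, of "S - e"] e unfolding S_def by auto
  have "oscillation s t \<le> e" if "s \<le> t" for t
  proof -
    have "oscillation T t \<le> S" unfolding S_def by (rule cSUP_upper[OF _ bdd]) (use s that in auto)
    then show ?thesis using oscillation_add[of T s t] s that by simp
  qed
  then show ?thesis using that s by blast
qed

text \<open>Kolmogorov's inequality. Decompose the event according to the first \<open>u \<in> D\<close> at which the
deviation exceeds \<open>c\<close>; on that part the deviation at \<open>u\<close> is at least \<open>c\<close>, and continuing to \<open>t\<close> can
only increase the second moment.\<close>

lemma maximal_inequality:
  assumes D: "finite D" "D \<subseteq> {s..t}" and s: "T \<le> s" and c: "0 < c"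
  shows "c^2 * prob {\<omega>\<in>space M. \<exists>u\<in>D. \<bar>Y u \<omega> - Y s \<omega>\<bar> > c} \<le> oscillation s t"
proof -
  define A where "A = (\<lambda>u. {\<omega>\<in>space M. \<bar>Y u \<omega> - Y s \<omega>\<bar> > c \<and> (\<forall>v\<in>{v\<in>D. v < u}. \<not> \<bar>Y v \<omega> - Y s \<omega>\<bar> > c)})"
  have AF: "A u \<in> sets (Fl u)" if u: "u \<in> D" for u
  proof -
    have m: "Y v \<in> borel_measurable (Fl u)" if "T \<le> v" "v \<le> u" for v
      using measurable_mono[OF that(2) adapted[OF that(1)]] .
    have [measurable]: "Y u \<in> borel_measurable (Fl u)" "Y s \<in> borel_measurable (Fl u)"
      using u D s by (auto intro!: m)
    have mv: "Measurable.pred (Fl u) (\<lambda>\<omega>. \<not> \<bar>Y v \<omega> - Y s \<omega>\<bar> > c)" if "v \<in> {v\<in>D. v < u}" for v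
    proof -
      have [measurable]: "Y v \<in> borel_measurable (Fl u)" using that D s by (intro m) auto
      show ?thesis by measurable
    qed
    have fin: "finite {v\<in>D. v < u}" using D by simp
    have "Measurable.pred (Fl u) (\<lambda>\<omega>. \<forall>v\<in>{v\<in>D. v < u}. \<not> \<bar>Y v \<omega> - Y s \<omega>\<bar> > c)"
      by (rule pred_intros_finite(3)[OF fin]) (use mv in auto)
    then have "{\<omega>\<in>space (Fl u). \<bar>Y u \<omega> - Y s \<omega>\<bar> > c \<and> (\<forall>v\<in>{v\<in>D. v < u}. \<not> \<bar>Y v \<omega> - Y s \<omega>\<bar> > c)} \<in> sets (Fl u)"
      by measurable
    then show ?thesis using subalgebra[of u] unfolding A_def by (simp add: subalgebra_def)
  qed
  have AM: "A u \<in> sets M" if "u \<in> D" for u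
    using AF[OF that] subalgebra[of u] by (auto simp: subalgebra_def)
  have disj: "disjoint_family_on A D"
    unfolding disjoint_family_on_def A_def by (auto simp: neq_iff)
  have union: "{\<omega>\<in>space M. \<exists>u\<in>D. \<bar>Y u \<omega> - Y s \<omega>\<bar> > c} = (\<Union>u\<in>D. A u)" (is "?l = ?r")
  proof (intro set_eqI iffI)
    fix \<omega> assume w: "\<omega> \<in> ?l"
    define D' where "D' = {u\<in>D. \<bar>Y u \<omega> - Y s \<omega>\<bar> > c}"
    have D': "finite D'" "D' \<noteq> {}" using D w by (auto simp: D'_def)
    have "Min D' \<in> D'" by (rule Min_in[OF D'])
    moreover have "\<not> \<bar>Y v \<omega> - Y s \<omega>\<bar> > c" if "v \<in> D" "v < Min D'" for v
    proof
      assume "\<bar>Y v \<omega> - Y s \<omega>\<bar> > c"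
      then have "v \<in> D'" using that by (simp add: D'_def)
      then show False using Min_le[OF D'(1), of v] that by simp
    qed
    ultimately show "\<omega> \<in> ?r" using w unfolding A_def D'_def by blast
  qed (auto simp: A_def)
  let ?g = "\<lambda>\<omega>. (Y t \<omega> - Y s \<omega>)^2"
  have iA: "integrable M (\<lambda>\<omega>. indicator (A u) \<omega> * (Y v \<omega> - Y s \<omega>)^2)" if "u \<in> D" "T \<le> v" for u v
    using integrable_real_mult_indicator[OF AM[OF that(1)] square_integrable[OF s that(2)]] by (simp add: mult.commute)
  have ge: "c^2 * prob (A u) \<le> (\<integral>\<omega>. indicator (A u) \<omega> * ?g \<omega> \<partial>M)" if u: "u \<in> D" for u
  proof -
    have u': "s \<le> u" "u \<le> t" "T \<le> u" using D u s by auto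
    have "c^2 * prob (A u) = (\<integral>\<omega>. indicator (A u) \<omega> * c^2 \<partial>M)" using AM[OF u] by simp
    also have "\<dots> \<le> (\<integral>\<omega>. indicator (A u) \<omega> * (Y u \<omega> - Y s \<omega>)^2 \<partial>M)"
    proof (rule integral_mono)
      show "integrable M (\<lambda>\<omega>. indicator (A u) \<omega> * c^2)" using AM[OF u] by (simp add: less_top[symmetric])
      fix \<omega>
      have "c^2 \<le> (Y u \<omega> - Y s \<omega>)^2" if "\<omega> \<in> A u"
        using that c by (intro power2_le_iff_abs_le[THEN iffD2] abs_le_square_iff[THEN iffD1]) (auto simp: A_def)
      then show "indicator (A u) \<omega> * c^2 \<le> indicator (A u) \<omega> * (Y u \<omega> - Y s \<omega>)^2"
        by (auto split: split_indicator)
    qed (rule iA[OF u u'(3)])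
    also have "\<dots> \<le> (\<integral>\<omega>. indicator (A u) \<omega> * ?g \<omega> \<partial>M)"
      using Pythagoras[OF s u'(1,2) AF[OF u]] by simp
    finally show ?thesis .
  qed
  show ?thesis
  proof (cases "s \<le> t")
    case True
    then have Tt: "T \<le> t" using s by simp
    have "c^2 * prob ?l = (\<Sum>u\<in>D. c^2 * prob (A u))"
      unfolding union sum_distrib_left[symmetric]
      by (subst finite_measure_finite_Union[OF D(1) _ disj]) (use AM in auto)
    also have "\<dots> \<le> (\<Sum>u\<in>D. \<integral>\<omega>. indicator (A u) \<omega> * ?g \<omega> \<partial>M)" by (rule sum_mono[OF ge])
    also have "\<dots> = (\<integral>\<omega>. (\<Sum>u\<in>D. indicator (A u) \<omega> * ?g \<omega>) \<partial>M)"
      by (rule Bochner_Integration.integral_sum[symmetric]) (rule iA[OF _ Tt])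
    also have "\<dots> \<le> oscillation s t" unfolding oscillation_def
    proof (rule integral_mono[OF _ square_integrable[OF s Tt]])
      show "integrable M (\<lambda>\<omega>. \<Sum>u\<in>D. indicator (A u) \<omega> * ?g \<omega>)"
        by (rule Bochner_Integration.integrable_sum) (rule iA[OF _ Tt])
      fix \<omega>
      have "(\<Sum>u\<in>D. indicator (A u) \<omega> :: real) = indicator (\<Union>u\<in>D. A u) \<omega>"
        by (rule indicator_UN_disjoint[OF D(1) disj, symmetric])
      also have "\<dots> \<le> 1" by (simp add: indicator_le_1)
      finally have "(\<Sum>u\<in>D. indicator (A u) \<omega>) * ?g \<omega> \<le> 1 * ?g \<omega>" by (rule mult_right_mono) simp
      then show "(\<Sum>u\<in>D. indicator (A u) \<omega> * ?g \<omega>) \<le> ?g \<omega>" by (simp add: sum_distrib_right)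
    qed
    finally show ?thesis .
  next
    case False
    then have "D = {}" using D by auto
    then show ?thesis by (simp add: oscillation_def)
  qed
qed

lemma countable_maximal_inequality:
  assumes D: "countable D" "D \<subseteq> {s..}" and s: "T \<le> s" and c: "0 < c"
    and osc: "\<And>t. s \<le> t \<Longrightarrow> oscillation s t \<le> e"
  shows "c^2 * prob {\<omega>\<in>space M. \<exists>u\<in>D. \<bar>Y u \<omega> - Y s \<omega>\<bar> > c} \<le> e"
proof (cases "D = {}")
  case True
  then show ?thesis using osc[of s] oscillation_bounds[OF s s] by auto
next
  case False
  define A where "A = (\<lambda>n. {\<omega>\<in>space M. \<exists>u\<in>from_nat_into D ` {..<n}. \<bar>Y u \<omega> - Y s \<omega>\<bar> > c})"
  have range: "from_nat_into D n \<in> D" for n using from_nat_into[OF False] .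
  have meas: "A n \<in> sets M" for n
  proof -
    have [measurable]: "Y (from_nat_into D i) \<in> borel_measurable M" "Y s \<in> borel_measurable M" for i
      using range[of i] D s by (auto intro!: Y_measurable)
    have "A n = (\<Union>i<n. {\<omega>\<in>space M. \<bar>Y (from_nat_into D i) \<omega> - Y s \<omega>\<bar> > c})" by (auto simp: A_def)
    also have "\<dots> \<in> sets M" by measurable
    finally show ?thesis .
  qed
  have "incseq A" unfolding A_def incseq_def by fastforce
  then have "(\<lambda>n. prob (A n)) \<longlonglongrightarrow> prob (\<Union>n. A n)"
    using meas by (intro finite_Lim_measure_incseq) auto
  then have lim: "(\<lambda>n. c^2 * prob (A n)) \<longlonglongrightarrow> c^2 * prob (\<Union>n. A n)" by (intro tendsto_intros)
  have "c^2 * prob (A n) \<le> e" for n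
  proof -
    let ?D = "from_nat_into D ` {..<n}"
    define t where "t = Max (insert s ?D)"
    have fin: "finite (insert s ?D)" by simp
    have t: "s \<le> t" unfolding t_def by (rule Max_ge[OF fin]) simp
    have "?D \<subseteq> {s..t}"
      using Max_ge[OF fin] range D(2) unfolding t_def by fastforce
    from maximal_inequality[OF _ this s c] show ?thesis using osc[OF t] unfolding A_def by simp
  qed
  then have "c^2 * prob (\<Union>n. A n) \<le> e" using LIMSEQ_le_const2[OF lim] by blast
  moreover have "(\<Union>n. A n) = {\<omega>\<in>space M. \<exists>u\<in>D. \<bar>Y u \<omega> - Y s \<omega>\<bar> > c}"
  proof -
    have "\<exists>n. u \<in> from_nat_into D ` {..<n}" if "u \<in> D" for u
      using from_nat_into_surj[OF D(1) that] by blast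
    then show ?thesis using range unfolding A_def by blast
  qed
  ultimately show ?thesis by simp
qed

lemma rational_bound:
  assumes w: "\<omega> \<in> space M" and s: "T \<le> s" and b: "\<And>q. q \<in> \<rat> \<inter> {s..} \<Longrightarrow> \<bar>Y q \<omega> - y\<bar> \<le> c" and u: "s \<le> u"
  shows "\<bar>Y u \<omega> - y\<bar> \<le> c"
proof (rule ccontr)
  assume "\<not> \<bar>Y u \<omega> - y\<bar> \<le> c"
  moreover have "((\<lambda>v. \<bar>Y v \<omega> - y\<bar>) \<longlongrightarrow> \<bar>Y u \<omega> - y\<bar>) (at_right u)"
    using right_continuous[OF _ w, of u] s u by (auto simp: continuous_within intro!: tendsto_intros)
  ultimately have "eventually (\<lambda>v. c < \<bar>Y v \<omega> - y\<bar>) (at_right u)"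
    by (intro order_tendstoD(1)) auto
  then obtain b' where b': "b' > u" "\<And>v. u < v \<Longrightarrow> v < b' \<Longrightarrow> c < \<bar>Y v \<omega> - y\<bar>"
    unfolding eventually_at_right_field by auto
  obtain q where "q \<in> \<rat>" "u < q" "q < b'" using Rats_dense_in_real[OF b'(1)] by auto
  then show False using b[of q] b'(2)[of q] u by auto
qed

text \<open>By right-continuity the oscillation after time \<open>s\<close> is controlled by countably many times, hence
by the maximal inequality. It exceeds a given \<open>c\<close> for all \<open>s\<close> with probability 0, so almost every path
is Cauchy.\<close>

theorem almost_surely_convergent:
  "AE \<omega> in M. \<exists>l. ((\<lambda>t. Y t \<omega>) \<longlongrightarrow> l) at_top"
proof -
  define Bad where "Bad = (\<lambda>c n. {\<omega>\<in>space M. \<exists>u\<in>\<rat> \<inter> {T + real n..}. \<bar>Y u \<omega> - Y (T + real n) \<omega>\<bar> > c})"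
  have meas: "Bad c n \<in> sets M" for c n
  proof -
    have [measurable]: "Y u \<in> borel_measurable M" if "u \<in> \<rat> \<inter> {T + real n..}" for u
      using that by (intro Y_measurable) auto
    have [measurable]: "Y (T + real n) \<in> borel_measurable M" by (rule Y_measurable) simp
    have cnt: "countable (\<rat> \<inter> {T + real n..})" using countable_rat by auto
    have "{\<omega>\<in>space M. \<bar>Y u \<omega> - Y (T + real n) \<omega>\<bar> > c} \<in> sets M" if "u \<in> \<rat> \<inter> {T + real n..}" for u
      using Y_measurable[of u] that by measurable
    then have "(\<Union>u\<in>\<rat> \<inter> {T + real n..}. {\<omega>\<in>space M. \<bar>Y u \<omega> - Y (T + real n) \<omega>\<bar> > c}) \<in> sets M"
      using cnt by (intro sets.countable_UN') auto
    moreover have "Bad c n = (\<Union>u\<in>\<rat> \<inter> {T + real n..}. {\<omega>\<in>space M. \<bar>Y u \<omega> - Y (T + real n) \<omega>\<bar> > c})"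
      by (auto simp: Bad_def)
    ultimately show ?thesis by simp
  qed
  have "AE \<omega> in M. \<exists>n. \<omega> \<notin> Bad c n" if c: "c > 0" for c
  proof -
    have "prob (\<Inter>n. Bad c n) \<le> e" if e: "e > 0" for e
    proof -
      obtain s where s: "T \<le> s" "\<And>t. s \<le> t \<Longrightarrow> oscillation s t \<le> c^2 * e"
        using oscillation_vanishes[of "c^2 * e"] c e by (auto simp: zero_less_mult_iff)
      obtain n where n: "s - T \<le> real n" using real_arch_simple by blast
      have osc: "oscillation (T + real n) t \<le> c^2 * e" if "T + real n \<le> t" for t
      proof -
        have "oscillation s t = oscillation s (T + real n) + oscillation (T + real n) t"
          by (rule oscillation_add[OF s(1)]) (use n that in auto)
        moreover have "0 \<le> oscillation s (T + real n)" by (simp add: oscillation_def)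
        moreover have "oscillation s t \<le> c^2 * e" by (rule s(2)) (use n that in simp)
        ultimately show ?thesis by linarith
      qed
      have "c^2 * prob (Bad c n) \<le> c^2 * e" unfolding Bad_def
        by (rule countable_maximal_inequality[OF _ _ _ c osc]) (use countable_rat in auto)
      then have "prob (Bad c n) \<le> e" using c by simp
      moreover have "prob (\<Inter>n. Bad c n) \<le> prob (Bad c n)"
        by (rule finite_measure_mono) (use meas in auto)
      ultimately show ?thesis by linarith
    qed
    then have "prob (\<Inter>n. Bad c n) \<le> 0" by (rule field_le_epsilon[of _ 0, simplified])
    then have "prob (\<Inter>n. Bad c n) = 0" using measure_nonneg[of M] by (simp add: order_antisym)
    moreover have "(\<Inter>n. Bad c n) \<in> sets M" using meas by auto
    ultimately have "AE \<omega> in M. \<omega> \<notin> (\<Inter>n. Bad c n)"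
      by (intro AE_not_in) (auto simp: null_sets_def emeasure_eq_measure)
    then show ?thesis by simp
  qed
  then have "AE \<omega> in M. \<forall>k. \<exists>n. \<omega> \<notin> Bad (inverse (real (Suc k))) n"
    by (subst AE_all_countable) simp
  then show ?thesis using AE_space
  proof eventually_elim
    case (elim \<omega>)
    have osc: "\<exists>n. \<forall>u\<ge>T + real n. \<bar>Y u \<omega> - Y (T + real n) \<omega>\<bar> \<le> c" if c: "c > 0" for c
    proof -
      obtain k where k: "inverse (real (Suc k)) < c" using reals_Archimedean[OF c] by blast
      obtain n where n: "\<omega> \<notin> Bad (inverse (real (Suc k))) n" using elim by blast
      have "\<bar>Y u \<omega> - Y (T + real n) \<omega>\<bar> \<le> inverse (real (Suc k))" if "T + real n \<le> u" for u
        by (rule rational_bound[OF elim(2) _ _ that]) (use n elim(2) in \<open>auto simp: Bad_def not_less\<close>)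
      then show ?thesis using k by (meson less_imp_le order.trans)
    qed
    have "Cauchy (\<lambda>n. Y (T + real n) \<omega>)"
    proof (rule CauchyI)
      fix e :: real assume e: "e > 0"
      obtain n where n: "\<forall>u\<ge>T + real n. \<bar>Y u \<omega> - Y (T + real n) \<omega>\<bar> \<le> e / 3" using osc[of "e / 3"] e by auto
      have "norm (Y (T + real i) \<omega> - Y (T + real j) \<omega>) < e" if "i \<ge> n" "j \<ge> n" for i j
      proof -
        have "\<bar>Y (T + real i) \<omega> - Y (T + real n) \<omega>\<bar> \<le> e / 3" "\<bar>Y (T + real j) \<omega> - Y (T + real n) \<omega>\<bar> \<le> e / 3"
          using n that by auto
        then show ?thesis using e unfolding real_norm_def by linarith
      qed
      then show "\<exists>M. \<forall>i\<ge>M. \<forall>j\<ge>M. norm (Y (T + real i) \<omega> - Y (T + real j) \<omega>) < e" by blast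
    qed
    then obtain l where l: "(\<lambda>n. Y (T + real n) \<omega>) \<longlonglongrightarrow> l"
      using Cauchy_convergent convergent_def by blast
    have "((\<lambda>t. Y t \<omega>) \<longlongrightarrow> l) at_top"
    proof (rule tendstoI)
      fix e :: real assume e: "e > 0"
      obtain n where n: "\<forall>u\<ge>T + real n. \<bar>Y u \<omega> - Y (T + real n) \<omega>\<bar> \<le> e / 4" using osc[of "e / 4"] e by auto
      have "\<bar>l - Y (T + real n) \<omega>\<bar> \<le> e / 4"
        by (rule LIMSEQ_le_const2[OF tendsto_rabs[OF tendsto_diff[OF l tendsto_const]]])
           (use n in \<open>auto intro!: exI[of _ n]\<close>)
      then have "dist (Y u \<omega>) l < e" if "u \<ge> T + real n" for u
        using n[rule_format, OF that] e unfolding dist_real_def by linarith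
      then show "eventually (\<lambda>t. dist (Y t \<omega>) l < e) at_top"
        using eventually_at_top_linorder by blast
    qed
    then show ?case by blast
  qed
qed

end

section \<open>Mean, extinction and the supercritical regime\<close>

lemma mono_tendsto_SUP_ennreal:
  fixes f :: "real \<Rightarrow> ennreal"
  assumes "mono f" shows "(f \<longlongrightarrow> (SUP t. f t)) at_top"
proof (rule increasing_tendsto)
  show "eventually (\<lambda>t. f t \<le> (SUP t. f t)) at_top" by (simp add: SUP_upper)
  fix x assume "x < (SUP t. f t)"
  then obtain t where "x < f t" by (auto simp: less_SUP_iff)
  then have "x < f u" if "t \<le> u" for u using monoD[OF assms that] by (rule less_le_trans)
  then show "eventually (\<lambda>t. x < f t) at_top" using eventually_at_top_linorder by blast
qed

lemma Lim_at_top_mono_ennreal: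
  fixes f :: "real \<Rightarrow> ennreal"
  assumes "mono f" shows "Lim at_top f = (SUP t. f t)"
  by (rule tendsto_Lim[OF _ mono_tendsto_SUP_ennreal[OF assms]]) simp

lemma powr_eq_imp_eq_powr:
  fixes y :: real
  assumes "y > 0" "k \<noteq> 0" "y powr (- k) = w" shows "y = w powr (- 1 / k)"
  using assms by (auto simp: powr_powr)

lemma powr_neg_inverse:
  fixes w :: real
  assumes "w > 0" "k \<noteq> 0" shows "(w powr (- 1 / k)) powr (- k) = w"
  using assms by (simp add: powr_powr)

context theta_process begin

lemma E_0 [simp]: "E 0 = 1" by (simp add: E_def)

lemma pgf_0:
  assumes t: "0 \<le> t" and x: "0 \<le> x" "x < 1"
  shows "1 - F 0 t x = ((1 - x) powr (- \<theta>) * E t + (1 - E t) / (1 + \<theta>) + \<theta> / (1 + \<theta>) * R t) powr (- 1 / \<theta>)"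
proof (rule powr_eq_imp_eq_powr)
  have "1 - F 0 t x \<in> {(1 - x) * exp (- L t)..1}" by (rule one_minus_F_range) (use t x in auto)
  moreover have "(1 - x) * exp (- L t) > 0" using x by simp
  ultimately show "1 - F 0 t x > 0" by simp
  show "(1 - F 0 t x) powr (- \<theta>) = (1 - x) powr (- \<theta>) * E t + (1 - E t) / (1 + \<theta>) + \<theta> / (1 + \<theta>) * R t"
    using explicit_pgf[of 0 t x] t x by (simp add: R_0)
qed (use theta in simp)

lemma E_powr: "E t powr (- 1 / \<theta>) = exp (B t)" "exp (B t) powr (- \<theta>) = E t"
  using theta by (simp_all add: E_def exp_powr_real mult.commute)

text \<open>Multiplying the explicit formula by \<open>(1 - x)\<^sup>\<theta>\<close> leaves \<open>E t\<close> plus a term that vanishes as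
\<open>x\<close> tends to 1.\<close>

lemma pgf_slope_tendsto_mean:
  assumes t: "0 \<le> t"
  shows "(\<lambda>n. (1 - F 0 t (1 - inverse (real (Suc n)))) / inverse (real (Suc n))) \<longlonglongrightarrow> exp (B t)"
proof -
  let ?e = "\<lambda>n. inverse (real (Suc n))"
  let ?c = "(1 - E t) / (1 + \<theta>) + \<theta> / (1 + \<theta>) * R t"
  have lim: "(\<lambda>n. E t + ?e n powr \<theta> * ?c) \<longlonglongrightarrow> E t + 0 * ?c"
    by (intro tendsto_intros tendsto_zero_powrI[OF LIMSEQ_inverse_real_of_nat tendsto_const]) (use theta in auto)
  then have "(\<lambda>n. (E t + ?e n powr \<theta> * ?c) powr (- 1 / \<theta>)) \<longlonglongrightarrow> (E t + 0 * ?c) powr (- 1 / \<theta>)"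
    by (rule tendsto_powr[OF _ tendsto_const]) (use E_pos[of t] in auto)
  then have l: "(\<lambda>n. (E t + ?e n powr \<theta> * ?c) powr (- 1 / \<theta>)) \<longlonglongrightarrow> exp (B t)"
    unfolding mult_zero_left add_0_right E_powr .
  have "eventually (\<lambda>n. 0 < E t + ?e n powr \<theta> * ?c) sequentially"
    using order_tendstoD(1)[OF lim, of 0] E_pos[of t] by simp
  then have "eventually (\<lambda>n. (E t + ?e n powr \<theta> * ?c) powr (- 1 / \<theta>) = (1 - F 0 t (1 - ?e n)) / ?e n) sequentially"
  proof eventually_elim
    case (elim n)
    have e: "0 < ?e n" "?e n \<le> 1" by (simp_all add: field_simps)
    have e1: "?e n powr (- \<theta>) * ?e n powr \<theta> = 1" using e by (simp flip: powr_add)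
    have "1 - F 0 t (1 - ?e n) = (?e n powr (- \<theta>) * E t + (1 - E t) / (1 + \<theta>) + \<theta> / (1 + \<theta>) * R t) powr (- 1 / \<theta>)"
      using pgf_0[OF t, of "1 - ?e n"] e by simp
    also have "?e n powr (- \<theta>) * E t + (1 - E t) / (1 + \<theta>) + \<theta> / (1 + \<theta>) * R t = ?e n powr (- \<theta>) * (E t + ?e n powr \<theta> * ?c)"
      unfolding distrib_left[of "?e n powr (- \<theta>)"] mult.assoc[symmetric] e1 by simp
    also have "\<dots> powr (- 1 / \<theta>) = ?e n * (E t + ?e n powr \<theta> * ?c) powr (- 1 / \<theta>)"
      using elim e theta by (subst powr_mult) (auto simp: powr_powr)
    finally show ?case using e by simp
  qed
  then show ?thesis by (rule Lim_transform_eventually[OF l])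
qed

text \<open>The difference quotient of \<open>x ^ Z t\<close> at 1 is the partial geometric sum, which increases to
\<open>Z t\<close>, so monotone convergence applies.\<close>

lemma mean_Z:
  assumes t: "0 \<le> t"
  shows "integrable M (\<lambda>\<omega>. real (Z t \<omega>))" "(\<integral>\<omega>. real (Z t \<omega>) \<partial>M) = exp (B t)"
proof -
  let ?x = "\<lambda>n. 1 - inverse (real (Suc n))"
  let ?f = "\<lambda>n \<omega>. \<Sum>j<Z t \<omega>. ?x n ^ j"
  have x: "0 \<le> ?x n" "?x n < 1" for n by (simp_all add: field_simps)
  have xx: "?x n \<in> {0..1}" for n using x[of n] by auto
  have x_mono: "?x m \<le> ?x n" if "m \<le> n" for m n using that by (simp add: field_simps)
  have f: "?f n \<omega> = (1 - ?x n ^ Z t \<omega>) / inverse (real (Suc n))" for n \<omega>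
    by (subst one_diff_power_eq) simp
  have ip: "integrable M (\<lambda>\<omega>. ?x n ^ Z t \<omega>)" for n
    using power_integrable[OF t xx sets.top, of n] by (rule Bochner_Integration.integrable_cong[THEN iffD1, rotated 2]) auto
  have i: "integrable M (?f n)" for n unfolding f using ip by (intro Bochner_Integration.integrable_divide Bochner_Integration.integrable_diff) auto
  have "(\<integral>\<omega>. ?f n \<omega> \<partial>M) = (1 - F 0 t (?x n)) / inverse (real (Suc n))" for n
    unfolding f using ip[of n] expectation_pgf[OF t xx[of n]] by (simp add: prob_space del: of_nat_Suc)
  then have lim: "(\<lambda>n. \<integral>\<omega>. ?f n \<omega> \<partial>M) \<longlonglongrightarrow> exp (B t)" using pgf_slope_tendsto_mean[OF t] by simp
  have mono: "AE \<omega> in M. mono (\<lambda>n. ?f n \<omega>)"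
    using x x_mono by (intro AE_I2 monoI sum_mono power_mono) auto
  have "(\<lambda>n. ?f n \<omega>) \<longlonglongrightarrow> (\<Sum>j<Z t \<omega>. (1 - 0) ^ j)" for \<omega>
    by (intro tendsto_intros LIMSEQ_inverse_real_of_nat)
  then have pw: "AE \<omega> in M. (\<lambda>n. ?f n \<omega>) \<longlonglongrightarrow> real (Z t \<omega>)" by simp
  have m: "(\<lambda>\<omega>. real (Z t \<omega>)) \<in> borel_measurable M"
    by (rule measurable_compose[OF Z_measurable[OF t]]) simp
  show "integrable M (\<lambda>\<omega>. real (Z t \<omega>))"
    by (rule integrable_monotone_convergence[OF i mono pw lim m])
  show "(\<integral>\<omega>. real (Z t \<omega>) \<partial>M) = exp (B t)"
    by (rule integral_monotone_convergence[OF i mono pw lim m])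
qed

lemma mu_eq: "0 \<le> t \<Longrightarrow> mu M Z t = exp (B t)"
  unfolding mu_def by (rule mean_Z)

lemma V_eq: "V M \<theta> lam Z t = ennreal (\<theta> / (1 + \<theta>) * R t)"
proof (cases "0 \<le> t")
  case True
  have eq: "(\<integral>\<^sup>+u\<in>{0..t}. ennreal (mu M Z u powr (- \<theta>) * lam u) \<partial>lborel) = (\<integral>\<^sup>+u\<in>{0..t}. ennreal (E u * lam u) \<partial>lborel)"
  proof (rule nn_integral_cong)
    fix u
    show "ennreal (mu M Z u powr (- \<theta>) * lam u) * indicator {0..t} u = ennreal (E u * lam u) * indicator {0..t} u"
    proof (cases "u \<in> {0..t}")
      case True
      then show ?thesis by (simp only: mu_eq E_powr atLeastAtMost_iff)
    qed simp
  qed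
  have R: "(\<integral>\<^sup>+u\<in>{0..t}. ennreal (E u * lam u) \<partial>lborel) = ennreal (R t)"
    unfolding R_def by (rule Lint_eq_nn_integral[OF E_admissible]) (use E_pos in \<open>auto intro: less_imp_le\<close>)
  show ?thesis unfolding V_def eq R
    by (rule ennreal_mult[symmetric]) (use theta R_nonneg[OF True] in auto)
qed (simp add: V_def R_def Lint_def set_lebesgue_integral_def)

lemma V_mono: "mono (V M \<theta> lam Z)"
proof (rule monoI)
  fix s t :: real assume "s \<le> t"
  then have "(\<integral>\<^sup>+u\<in>{0..s}. f u \<partial>lborel) \<le> (\<integral>\<^sup>+u\<in>{0..t}. f u \<partial>lborel)" for f :: "real \<Rightarrow> ennreal"
    by (intro nn_integral_mono) (auto split: split_indicator)
  then show "V M \<theta> lam Z s \<le> V M \<theta> lam Z t" unfolding V_def by (rule mult_left_mono) simp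
qed

text \<open>The explicit formula at \<open>x = 0\<close>, together with \<open>1 - F s t 0 \<le> 1\<close>.\<close>

lemma E_le:
  assumes s: "0 \<le> s" "s \<le> t" shows "E s \<le> E t + (R t - R s)"
proof -
  have "1 - F s t 0 \<in> {(1 - 0) * exp (- L t)..1}" by (rule one_minus_F_range[OF s]) simp
  moreover have "0 < (1 - 0) * exp (- L t)" by simp
  ultimately have "0 < 1 - F s t 0" "1 - F s t 0 \<le> 1" unfolding atLeastAtMost_iff by linarith+
  then have "1 \<le> (1 - F s t 0) powr (- \<theta>)"
    using theta powr_mono2'[of "- \<theta>" "1 - F s t 0" 1] by simp
  then have "1 * E s \<le> (1 - F s t 0) powr (- \<theta>) * E s" using E_pos[of s] by (intro mult_right_mono) auto
  then have "E s \<le> E t + (E s - E t) / (1 + \<theta>) + \<theta> / (1 + \<theta>) * (R t - R s)"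
    using explicit_pgf[OF s, of 0] by simp
  then have "(1 + \<theta>) * E s \<le> (1 + \<theta>) * (E t + (E s - E t) / (1 + \<theta>) + \<theta> / (1 + \<theta>) * (R t - R s))"
    using theta by (intro mult_left_mono) auto
  also have "\<dots> = (1 + \<theta>) * E t + (E s - E t) + \<theta> * (R t - R s)"
    using theta by (simp add: distrib_left)
  finally have "\<theta> * E s \<le> \<theta> * (E t + (R t - R s))" by (simp add: algebra_simps)
  then show ?thesis using theta by simp
qed

lemma Lam_lim_eq: "Lam_lim lam = (SUP t. ennreal (L t))"
proof -
  have "mono (Lam lam)"
    unfolding Lam_def by (rule monoI, rule nn_integral_mono) (auto split: split_indicator)
  then show ?thesis unfolding Lam_lim_def by (simp only: Lim_at_top_mono_ennreal Lam_eq)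
qed

lemma Lam_lim_infinite_iff: "Lam_lim lam = \<infinity> \<longleftrightarrow> (\<forall>C. \<exists>t\<ge>0. C < L t)"
proof
  assume *: "Lam_lim lam = \<infinity>"
  show "\<forall>C. \<exists>t\<ge>0. C < L t"
  proof (rule allI, rule ccontr)
    fix C assume "\<not> (\<exists>t\<ge>0. C < L t)"
    then have "L t \<le> C" if "0 \<le> t" for t using that by (meson not_less)
    moreover have "L t = 0" if "t < 0" for t using that by (simp add: L_def Lint_def set_lebesgue_integral_def)
    ultimately have "L t \<le> max C 0" for t by (cases "0 \<le> t") force+
    then have "Lam_lim lam \<le> ennreal (max C 0)" unfolding Lam_lim_eq by (intro SUP_least ennreal_leI)
    then show False using * by (simp add: top_unique)
  qed
next
  assume *: "\<forall>C. \<exists>t\<ge>0. C < L t"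
  show "Lam_lim lam = \<infinity>"
  proof (rule ccontr)
    assume "Lam_lim lam \<noteq> \<infinity>"
    then obtain C where C: "Lam_lim lam = ennreal C" "0 \<le> C" by (cases "Lam_lim lam") auto
    obtain t where t: "0 \<le> t" "C < L t" using * by blast
    have "ennreal (L t) \<le> ennreal C" using C(1) unfolding Lam_lim_eq by (metis SUP_upper UNIV_I)
    then show False using t C by simp
  qed
qed

lemma V_lim_eq: "V_lim M \<theta> lam Z = (SUP t. ennreal (\<theta> / (1 + \<theta>) * R t))"
  unfolding V_lim_def Lim_at_top_mono_ennreal[OF V_mono] V_eq ..

lemma V_lim_finite_iff: "V_lim M \<theta> lam Z < \<infinity> \<longleftrightarrow> (\<exists>C. \<forall>t\<ge>0. R t \<le> C)"
proof
  assume "V_lim M \<theta> lam Z < \<infinity>"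
  then obtain C where C: "V_lim M \<theta> lam Z = ennreal C" "0 \<le> C" by (cases "V_lim M \<theta> lam Z") auto
  have "R t \<le> (1 + \<theta>) / \<theta> * C" for t
  proof -
    have "ennreal (\<theta> / (1 + \<theta>) * R t) \<le> ennreal C" using C(1) unfolding V_lim_eq by (metis SUP_upper UNIV_I)
    then have "\<theta> / (1 + \<theta>) * R t \<le> C" using C(2) by (simp add: ennreal_le_iff)
    then show ?thesis using theta by (simp add: field_simps)
  qed
  then show "\<exists>C. \<forall>t\<ge>0. R t \<le> C" by blast
next
  assume "\<exists>C. \<forall>t\<ge>0. R t \<le> C"
  then obtain C where C: "\<And>t. t \<ge> 0 \<Longrightarrow> R t \<le> C" by blast
  have "ennreal (\<theta> / (1 + \<theta>) * R t) \<le> ennreal (\<theta> / (1 + \<theta>) * max C 0)" for t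
  proof (rule ennreal_leI, rule mult_left_mono)
    have "R t = 0" if "t < 0" using that by (simp add: R_def Lint_def set_lebesgue_integral_def)
    then show "R t \<le> max C 0" using C[of t] by (cases "0 \<le> t") auto
  qed (use theta in simp)
  then have "V_lim M \<theta> lam Z \<le> ennreal (\<theta> / (1 + \<theta>) * max C 0)" unfolding V_lim_eq by (rule SUP_least)
  then show "V_lim M \<theta> lam Z < \<infinity>" by (simp add: le_less_trans)
qed

lemma extinct_prob:
  assumes t: "0 \<le> t"
  shows "prob {\<omega>\<in>space M. Z t \<omega> = 0} = 1 - (\<theta> / (1 + \<theta>) * E t + 1 / (1 + \<theta>) + \<theta> / (1 + \<theta>) * R t) powr (- 1 / \<theta>)"
proof -
  have ev: "{\<omega>\<in>space M. Z t \<omega> = 0} \<in> sets M"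
    by (rule filtration_sets[OF filtration_event[of t t]]) (use t in auto)
  have "F 0 t 0 = (\<integral>\<omega>. 0 ^ Z t \<omega> \<partial>M)" by (rule expectation_pgf[OF t, symmetric]) simp
  also have "\<dots> = (\<integral>\<omega>. indicator {\<omega>\<in>space M. Z t \<omega> = 0} \<omega> \<partial>M)"
    by (rule Bochner_Integration.integral_cong) (auto simp: indicator_def)
  also have "\<dots> = prob {\<omega>\<in>space M. Z t \<omega> = 0}" using ev by simp
  finally have "prob {\<omega>\<in>space M. Z t \<omega> = 0} = F 0 t 0" by simp
  also have "F 0 t 0 = 1 - (1 powr (- \<theta>) * E t + (1 - E t) / (1 + \<theta>) + \<theta> / (1 + \<theta>) * R t) powr (- 1 / \<theta>)"
    using pgf_0[OF t, of 0] by simp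
  also have "1 powr (- \<theta>) * E t + (1 - E t) / (1 + \<theta>) = \<theta> / (1 + \<theta>) * E t + 1 / (1 + \<theta>)"
    using theta by (simp add: field_simps)
  finally show ?thesis .
qed

lemma eventually_nonneg: "eventually (\<lambda>t::real. 0 \<le> t) at_top"
  by (rule eventually_ge_at_top)

lemma mu_at_top_iff: "filterlim (mu M Z) at_top at_top \<longleftrightarrow> (E \<longlongrightarrow> 0) at_top"
proof
  assume "filterlim (mu M Z) at_top at_top"
  then have "((\<lambda>t. mu M Z t powr (- \<theta>)) \<longlongrightarrow> 0) at_top"
    by (rule tendsto_neg_powr[rotated]) (use theta in auto)
  then show "(E \<longlongrightarrow> 0) at_top"
    by (rule Lim_transform_eventually, intro eventually_mono[OF eventually_nonneg])
       (simp only: mu_eq E_powr)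
next
  assume E: "(E \<longlongrightarrow> 0) at_top"
  show "filterlim (mu M Z) at_top at_top"
  proof (rule filterlim_at_top_gt[where c=0, THEN iffD2, rule_format])
    fix K :: real assume K: "0 < K"
    have "eventually (\<lambda>t. E t < K powr (- \<theta>)) at_top" using order_tendstoD(2)[OF E] K by simp
    then show "eventually (\<lambda>t. K \<le> mu M Z t) at_top" using eventually_nonneg
    proof eventually_elim
      case (elim t)
      then have "- \<theta> * B t < - \<theta> * ln K" using K by (simp add: E_def powr_def)
      then have "ln K < B t" using theta by simp
      then have "exp (ln K) < exp (B t)" by simp
      then show ?case using K mu_eq[OF elim(2)] by simp
    qed
  qed
qed

lemma R_tendsto:
  assumes "V_lim M \<theta> lam Z < \<infinity>"
  shows "((\<lambda>t. \<theta> / (1 + \<theta>) * R t) \<longlongrightarrow> enn2real (V_lim M \<theta> lam Z)) at_top"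
    and "0 \<le> t \<Longrightarrow> \<theta> / (1 + \<theta>) * R t \<le> enn2real (V_lim M \<theta> lam Z)"
proof -
  have "((\<lambda>t. ennreal (\<theta> / (1 + \<theta>) * R t)) \<longlongrightarrow> V_lim M \<theta> lam Z) at_top"
    using mono_tendsto_SUP_ennreal[OF V_mono] unfolding V_eq V_lim_eq .
  then have "((\<lambda>t. enn2real (ennreal (\<theta> / (1 + \<theta>) * R t))) \<longlongrightarrow> enn2real (V_lim M \<theta> lam Z)) at_top"
    using assms by (intro tendsto_enn2real) auto
  then show "((\<lambda>t. \<theta> / (1 + \<theta>) * R t) \<longlongrightarrow> enn2real (V_lim M \<theta> lam Z)) at_top"
  proof (rule Lim_transform_eventually, intro eventually_mono[OF eventually_nonneg] enn2real_ennreal)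
    show "0 \<le> \<theta> / (1 + \<theta>) * R t" if "0 \<le> t" for t using R_nonneg[OF that] theta by simp
  qed
  assume t: "0 \<le> t"
  have "ennreal (\<theta> / (1 + \<theta>) * R t) \<le> V_lim M \<theta> lam Z" unfolding V_lim_eq by (rule SUP_upper) simp
  then have "enn2real (ennreal (\<theta> / (1 + \<theta>) * R t)) \<le> enn2real (V_lim M \<theta> lam Z)"
    using assms by (intro enn2real_mono) auto
  then show "\<theta> / (1 + \<theta>) * R t \<le> enn2real (V_lim M \<theta> lam Z)"
    using R_nonneg[OF t] theta by simp
qed

text \<open>By \<open>E_le\<close>, if \<open>E s\<close> exceeded the remaining integral of \<open>E\<close> over \<open>(s, \<infinity>)\<close> by \<open>d > 0\<close>, then \<open>E\<close> would
stay above \<open>d\<close> after \<open>s\<close>, and that integral would be infinite because \<open>\<Lambda> = \<infinity>\<close>. So \<open>E s\<close> is at most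
the tail of a convergent integral.\<close>

lemma E_tendsto_0:
  assumes V: "V_lim M \<theta> lam Z < \<infinity>" and Lam: "Lam_lim lam = \<infinity>"
  shows "(E \<longlongrightarrow> 0) at_top"
proof -
  let ?k = "(1 + \<theta>) / \<theta>" let ?V = "enn2real (V_lim M \<theta> lam Z)"
  have R: "R t \<le> ?k * ?V" if "0 \<le> t" for t
    using R_tendsto(2)[OF V that] theta by (simp add: field_simps)
  have lim: "((\<lambda>t. ?k * ?V - R t) \<longlongrightarrow> ?k * ?V - ?k * ?V) at_top"
  proof (intro tendsto_intros)
    have "((\<lambda>t. ?k * (\<theta> / (1 + \<theta>) * R t)) \<longlongrightarrow> ?k * ?V) at_top"
      by (intro tendsto_intros R_tendsto(1)[OF V])
    then show "(R \<longlongrightarrow> ?k * ?V) at_top" using theta by simp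
  qed
  have le: "E s \<le> ?k * ?V - R s" if s: "0 \<le> s" for s
  proof (rule ccontr)
    \<comment> \<open>\<open>?k * ?V\<close> is the limit of \<open>R\<close>, so \<open>?k * ?V - R s\<close> is the integral of \<open>E\<close> over \<open>(s, \<infinity>)\<close>.\<close>
    define d where "d = E s - (?k * ?V - R s)"
    assume "\<not> ?thesis"
    then have d: "d > 0" by (simp add: d_def)
    obtain t0 where t0: "t0 \<ge> 0" "L s + (?k * ?V - R s) / d < L t0" using Lam Lam_lim_infinite_iff by blast
    define t where "t = max s t0"
    have t: "s \<le> t" "0 \<le> t" "L s + (?k * ?V - R s) / d < L t"
      using s t0 L_mono[of t0 t] by (auto simp: t_def)
    have Ed: "d \<le> E u" if "s \<le> u" for u
    proof -
      have "0 \<le> u" using s that by simp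
      then show ?thesis using E_le[OF s that] R[of u] by (simp add: d_def)
    qed
    have "d * (L t - L s) \<le> Lint E s t"
      using Lint_mono[OF admissible_const E_admissible s, of t d] Ed Lint_const[OF s t(1)] by simp
    also have "\<dots> = R t - R s" using Lint_split[OF E_admissible _ s t(1)] by (simp add: R_def)
    also have "\<dots> \<le> ?k * ?V - R s" using R[OF t(2)] by simp
    finally have "L t - L s \<le> (?k * ?V - R s) / d" using d by (simp add: field_simps)
    then show False using t(3) by simp
  qed
  show ?thesis
  proof (rule real_tendsto_sandwich[OF _ _ tendsto_const])
    show "eventually (\<lambda>t. 0 \<le> E t) at_top" by (intro always_eventually allI less_imp_le E_pos)
    show "eventually (\<lambda>t. E t \<le> ?k * ?V - R t) at_top" using eventually_nonneg by eventually_elim (rule le)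
    show "((\<lambda>t. ?k * ?V - R t) \<longlongrightarrow> 0) at_top" using lim by simp
  qed
qed

lemma ext_prob_eq:
  assumes V: "V_lim M \<theta> lam Z < \<infinity>" and E: "(E \<longlongrightarrow> 0) at_top"
  shows "ext_prob M Z = 1 - (enn2real (V_lim M \<theta> lam Z) + 1 / (1 + \<theta>)) powr (- 1 / \<theta>)"
  unfolding ext_prob_def
proof (rule tendsto_Lim)
  let ?K = "\<lambda>t. \<theta> / (1 + \<theta>) * E t + 1 / (1 + \<theta>) + \<theta> / (1 + \<theta>) * R t"
  let ?V = "enn2real (V_lim M \<theta> lam Z)"
  have "?V \<ge> 0" by simp
  moreover have "1 / (1 + \<theta>) > 0" using theta by simp
  ultimately have pos: "\<theta> / (1 + \<theta>) * 0 + 1 / (1 + \<theta>) + ?V \<noteq> 0" by linarith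
  have "((\<lambda>t. 1 - (?K t) powr (- 1 / \<theta>)) \<longlongrightarrow>
     1 - (\<theta> / (1 + \<theta>) * 0 + 1 / (1 + \<theta>) + ?V) powr (- 1 / \<theta>)) at_top"
    by (intro tendsto_intros E R_tendsto(1)[OF V] disjI1 pos)
  then have "((\<lambda>t. 1 - (?K t) powr (- 1 / \<theta>)) \<longlongrightarrow>
     1 - (?V + 1 / (1 + \<theta>)) powr (- 1 / \<theta>)) at_top" by (simp add: add.commute)
  then show "((\<lambda>t. \<P>(\<omega> in M. Z t \<omega> = 0)) \<longlongrightarrow> 1 - (?V + 1 / (1 + \<theta>)) powr (- 1 / \<theta>)) at_top"
    by (rule Lim_transform_eventually, intro eventually_mono[OF eventually_nonneg])
       (simp only: extinct_prob)
qed simp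

text \<open>If \<open>V\<close> were infinite, the base of the power in \<open>extinct_prob\<close> would tend to infinity and
extinction would be certain.\<close>

lemma V_finite_if_supercritical:
  assumes "supercritical M Z" shows "V_lim M \<theta> lam Z < \<infinity>"
proof (rule ccontr)
  let ?K = "\<lambda>t. \<theta> / (1 + \<theta>) * E t + 1 / (1 + \<theta>) + \<theta> / (1 + \<theta>) * R t"
  assume "\<not> ?thesis"
  then have unb: "\<exists>t\<ge>0. C < R t" for C using V_lim_finite_iff by (meson not_le)
  have "filterlim R at_top at_top"
  proof (rule filterlim_at_top[THEN iffD2, rule_format])
    fix C
    obtain t where t: "t \<ge> 0" "C < R t" using unb by blast
    then have "C \<le> R u" if "t \<le> u" for u using R_mono[of t u] that by simp
    then show "eventually (\<lambda>t. C \<le> R t) at_top" using eventually_at_top_linorder by blast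
  qed
  then have "filterlim (\<lambda>t. \<theta> / (1 + \<theta>) * R t) at_top at_top"
    by (rule filterlim_tendsto_pos_mult_at_top[OF tendsto_const, rotated]) (use theta in simp)
  then have "filterlim (\<lambda>t. ?K t) at_top at_top"
  proof (rule filterlim_at_top_mono)
    have "\<theta> / (1 + \<theta>) * R t \<le> ?K t" for t
      using theta E_pos[of t] by (simp add: less_imp_le)
    then show "eventually (\<lambda>t. \<theta> / (1 + \<theta>) * R t \<le> ?K t) at_top"
      by simp
  qed
  then have "((\<lambda>t. (?K t) powr (- 1 / \<theta>)) \<longlongrightarrow> 0) at_top"
    by (rule tendsto_neg_powr[rotated]) (use theta in simp)
  then have "((\<lambda>t. 1 - (?K t) powr (- 1 / \<theta>)) \<longlongrightarrow> 1 - 0) at_top"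
    by (intro tendsto_intros)
  then have "((\<lambda>t. \<P>(\<omega> in M. Z t \<omega> = 0)) \<longlongrightarrow> 1 - 0) at_top"
    by (rule Lim_transform_eventually, intro eventually_mono[OF eventually_nonneg])
       (simp only: extinct_prob)
  then have "ext_prob M Z = 1" unfolding ext_prob_def by (intro tendsto_Lim) auto
  then show False using assms by (simp add: supercritical_def)
qed

text \<open>Since \<open>a - 1 \<le> 1 / \<theta>\<close>, the mean grows at most like \<open>exp (\<Lambda> / \<theta>)\<close>.\<close>

lemma Lam_infinite_if_supercritical:
  assumes "supercritical M Z" shows "Lam_lim lam = \<infinity>"
  unfolding Lam_lim_infinite_iff
proof
  fix C
  have "eventually (\<lambda>t. exp (C / \<theta>) < mu M Z t) at_top"
    using assms unfolding supercritical_def filterlim_at_top_dense by blast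
  then have "eventually (\<lambda>t. exp (C / \<theta>) < mu M Z t \<and> 0 \<le> t) at_top"
    using eventually_nonneg by eventually_elim simp
  then obtain t where t: "exp (C / \<theta>) < mu M Z t" "0 \<le> t"
    using eventually_happens'[OF trivial_limit_at_top_linorder] by blast
  then have "C / \<theta> < L t / \<theta>" using B_le[OF t(2)] by (simp add: mu_eq)
  then show "\<exists>t\<ge>0. C < L t" using t theta by (auto simp: divide_less_cancel)
qed

theorem supercritical_iff: "supercritical M Z \<longleftrightarrow> V_lim M \<theta> lam Z < \<infinity> \<and> Lam_lim lam = \<infinity>"
proof
  assume *: "V_lim M \<theta> lam Z < \<infinity> \<and> Lam_lim lam = \<infinity>"
  then have E: "(E \<longlongrightarrow> 0) at_top" using E_tendsto_0 by blast
  have "enn2real (V_lim M \<theta> lam Z) + 1 / (1 + \<theta>) > 0"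
    using theta by (intro add_nonneg_pos) auto
  then have "ext_prob M Z < 1" using ext_prob_eq[OF _ E] * by simp
  then show "supercritical M Z" using E by (simp add: supercritical_def mu_at_top_iff)
qed (use V_finite_if_supercritical Lam_infinite_if_supercritical in blast)

end

section \<open>The almost sure limit and its Laplace transform\<close>

context theta_process begin

lemma mu_pos: "0 \<le> t \<Longrightarrow> 0 < mu M Z t"
  by (simp add: mu_eq)

lemma Z_adapted:
  assumes "0 \<le> t" shows "Z t \<in> measurable (nat_filtration M Z t) (count_space UNIV)"
proof (rule measurableI)
  fix A :: "nat set"
  have "{\<omega>\<in>space M. Z t \<omega> \<in> A} = Z t -` A \<inter> space (nat_filtration M Z t)" by auto
  then show "Z t -` A \<inter> space (nat_filtration M Z t) \<in> sets (nat_filtration M Z t)"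
    using filtration_event[OF assms order.refl, of "\<lambda>k. k \<in> A"] by simp
qed simp

text \<open>Fatou's lemma: the normalised process has mean 1 at all times.\<close>

lemma limit_finite:
  "AE \<omega> in M. \<not> filterlim (\<lambda>n. real (Z (real n) \<omega>) / mu M Z (real n)) at_top sequentially"
proof -
  let ?u = "\<lambda>n \<omega>. ennreal (real (Z (real n) \<omega>) / mu M Z (real n))"
  have m [measurable]: "(\<lambda>\<omega>. real (Z (real n) \<omega>)) \<in> borel_measurable M" for n
    by (rule measurable_compose[OF Z_measurable]) auto
  have "(\<integral>\<^sup>+\<omega>. ?u n \<omega> \<partial>M) = 1" for n
  proof -
    have "(\<integral>\<^sup>+\<omega>. ?u n \<omega> \<partial>M) = ennreal (\<integral>\<omega>. real (Z (real n) \<omega>) / mu M Z (real n) \<partial>M)"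
      by (rule nn_integral_eq_integral) (use mean_Z(1)[of "real n"] mu_pos[of "real n"] in auto)
    also have "(\<integral>\<omega>. real (Z (real n) \<omega>) / mu M Z (real n) \<partial>M) = 1"
      using mu_pos[of "real n"] by (simp add: mu_def)
    finally show ?thesis by simp
  qed
  then have "(\<integral>\<^sup>+\<omega>. liminf (\<lambda>n. ?u n \<omega>) \<partial>M) \<le> 1"
    using nn_integral_liminf[of ?u M] by (simp add: Liminf_const)
  then have "(\<integral>\<^sup>+\<omega>. liminf (\<lambda>n. ?u n \<omega>) \<partial>M) \<noteq> \<infinity>" by (auto simp: top_unique)
  then have "AE \<omega> in M. liminf (\<lambda>n. ?u n \<omega>) \<noteq> \<infinity>"
    by (intro nn_integral_PInf_AE) auto
  then show ?thesis
  proof eventually_elim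
    case (elim \<omega>)
    show ?case
    proof
      assume "filterlim (\<lambda>n. real (Z (real n) \<omega>) / mu M Z (real n)) at_top sequentially"
      then have "(\<lambda>n. ?u n \<omega>) \<longlonglongrightarrow> top" by (simp add: ennreal_tendsto_top_eq_at_top)
      then have "liminf (\<lambda>n. ?u n \<omega>) = top" by (intro lim_imp_Liminf) auto
      then show False using elim by simp
    qed
  qed
qed

text \<open>The function \<open>y\<close> solves \<open>F s t (y t) = y s\<close> with the normalisation \<open>\<mu>\<^sub>t (1 - y t) \<longlongrightarrow> 1\<close>: by the
explicit formula \<open>(1 - F s t (y t))\<^sup>-\<^sup>\<theta> E s\<close> is \<open>1 + V - V s + E s / (1 + \<theta>)\<close>. So \<open>y t ^ Z t\<close> is a bounded
martingale. Its limit is positive because a limit 0 would force \<open>Z t / \<mu>\<^sub>t\<close> to diverge.\<close>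

lemma almost_sure_limit:
  assumes V: "V_lim M \<theta> lam Z < \<infinity>" and Lam: "Lam_lim lam = \<infinity>"
  shows "\<exists>W\<in>borel_measurable M. AE \<omega> in M. ((\<lambda>t. real (Z t \<omega>) / mu M Z t) \<longlongrightarrow> W \<omega>) at_top"
proof -
  define k where "k = \<theta> / (1 + \<theta>)"
  \<comment> \<open>\<open>v t\<close> is the tail \<open>V - V t\<close>, and \<open>g t\<close> is \<open>(1 - y t)\<^sup>-\<^sup>\<theta>\<close>.\<close>
  define v where "v = (\<lambda>t. enn2real (V_lim M \<theta> lam Z) - k * R t)"
  define g where "g = (\<lambda>t. (1 + v t + E t / (1 + \<theta>)) / E t)"
  define y where "y = (\<lambda>t. 1 - g t powr (- 1 / \<theta>))"
  have E0: "(E \<longlongrightarrow> 0) at_top" by (rule E_tendsto_0[OF V Lam])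
  have v0: "0 \<le> v t" if "0 \<le> t" for t using R_tendsto(2)[OF V that] by (simp add: v_def k_def)
  have "(v \<longlongrightarrow> enn2real (V_lim M \<theta> lam Z) - enn2real (V_lim M \<theta> lam Z)) at_top"
    unfolding v_def k_def by (intro tendsto_intros R_tendsto(1)[OF V])
  then have vlim: "(v \<longlongrightarrow> 0) at_top" by simp
  have "eventually (\<lambda>t. E t < 1) at_top" using order_tendstoD(2)[OF E0, of 1] by simp
  then obtain T0 where T0: "\<And>t. T0 \<le> t \<Longrightarrow> E t < 1" unfolding eventually_at_top_linorder by blast
  \<comment> \<open>Only from \<open>T\<close> on is \<open>y t\<close> known to lie in \<open>(0, 1)\<close>; this suffices for a limit at infinity.\<close>
  define T where "T = max T0 0"
  have T: "0 \<le> T" "\<And>t. T \<le> t \<Longrightarrow> E t < 1" using T0 by (auto simp: T_def)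
  have gE: "g t * E t = 1 + v t + E t / (1 + \<theta>)" for t using E_pos[of t] by (simp add: g_def)
  have g1: "1 < g t" if t: "T \<le> t" for t
  proof -
    have "E t < 1 + v t + E t / (1 + \<theta>)"
    proof -
      have "0 < E t / (1 + \<theta>)" using E_pos[of t] theta by simp
      then show ?thesis using T(2)[OF t] v0[of t] t T(1) by linarith
    qed
    then show ?thesis using E_pos[of t] by (simp add: g_def)
  qed
  have y01: "0 < y t" "y t < 1" if t: "T \<le> t" for t
  proof -
    have "g t powr (- 1 / \<theta>) < 1 powr (- 1 / \<theta>)"
      using g1[OF t] theta by (intro powr_less_mono2_neg) auto
    then show "0 < y t" by (simp add: y_def)
    show "y t < 1" using g1[OF t] by (simp add: y_def)
  qed
  have yg: "(1 - y t) powr (- \<theta>) = g t" if t: "T \<le> t" for t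
    unfolding y_def using powr_neg_inverse[of "g t" \<theta>] g1[OF t] theta by simp
  have Fy: "F s t (y t) = y s" if st: "T \<le> s" "s \<le> t" for s t
  proof -
    have t: "T \<le> t" using st by simp
    have "(1 - F s t (y t)) powr (- \<theta>) * E s = g t * E t + (E s - E t) / (1 + \<theta>) + k * (R t - R s)"
      using explicit_pgf[of s t "y t"] st T(1) y01[OF t] yg[OF t] by (simp add: k_def)
    also have "\<dots> = g s * E s" unfolding gE by (simp add: v_def algebra_simps diff_divide_distrib)
    finally have "(1 - F s t (y t)) powr (- \<theta>) = g s" using E_pos[of s] by simp
    moreover have "0 < 1 - F s t (y t)"
    proof -
      have "1 - F s t (y t) \<in> {(1 - y t) * exp (- L t)..1}"
        by (rule one_minus_F_range) (use st T(1) y01[OF t] in auto)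
      moreover have "0 < (1 - y t) * exp (- L t)" using y01[OF t] by simp
      ultimately show ?thesis unfolding atLeastAtMost_iff by linarith
    qed
    ultimately have "1 - F s t (y t) = g s powr (- 1 / \<theta>)"
      using powr_eq_imp_eq_powr theta by (metis less_numeral_extra(3))
    then show ?thesis by (simp add: y_def)
  qed
  have ycont: "continuous_on {T..} y"
  proof -
    have E: "continuous_on {T..} E" unfolding E_def
      by (intro continuous_intros continuous_on_subset[OF B_continuous]) (use T in auto)
    have "continuous_on {T..} R" unfolding R_def
      by (intro continuous_on_subset[OF Lint_continuous[OF E_admissible]]) (use T in auto)
    then have "continuous_on {T..} v" unfolding v_def by (intro continuous_intros)
    then have g: "continuous_on {T..} g" unfolding g_def
      using E E_pos theta by (intro continuous_intros) (auto simp: less_imp_neq[symmetric])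
    have "\<forall>t\<in>{T..}. g t \<noteq> 0" using g1 by force
    then show ?thesis unfolding y_def by (intro continuous_intros g) auto
  qed
  interpret Y: bounded_martingale M "nat_filtration M Z" "\<lambda>t \<omega>. y t ^ Z t \<omega>" T
  proof unfold_locales
    show "subalgebra M (nat_filtration M Z s)" for s by (rule filtration_subalgebra)
    show "sets (nat_filtration M Z s) \<subseteq> sets (nat_filtration M Z t)" if "s \<le> t" for s t
      by (rule filtration_mono[OF that])
    show "(\<lambda>\<omega>. y t ^ Z t \<omega>) \<in> borel_measurable (nat_filtration M Z t)" if "T \<le> t" for t
      by (rule measurable_compose[OF Z_adapted]) (use that T in auto)
    show "y t ^ Z t \<omega> \<in> {0..1}" if "T \<le> t" for t \<omega>
      using y01[OF that] by (simp add: power_le_one)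
    show "(\<integral>\<omega>. indicator A \<omega> * y t ^ Z t \<omega> \<partial>M) = (\<integral>\<omega>. indicator A \<omega> * y s ^ Z s \<omega> \<partial>M)"
      if "T \<le> s" "s \<le> t" "A \<in> sets (nat_filtration M Z s)" for s t A
      using markov_pgf[of s t A "y t"] Fy[OF that(1,2)] y01[of t] that T(1) by simp
    show "continuous (at_right t) (\<lambda>u. y u ^ Z u \<omega>)" if t: "T \<le> t" and w: "\<omega> \<in> space M" for t \<omega>
    proof -
      have "continuous (at t within {T..}) y"
        using ycont t by (auto simp: continuous_on_eq_continuous_within)
      then have "continuous (at_right t) y" by (rule continuous_within_subset) (use t in auto)
      then have "((\<lambda>u. y u ^ Z t \<omega>) \<longlongrightarrow> y t ^ Z t \<omega>) (at_right t)"
        unfolding continuous_within by (intro tendsto_intros)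
      moreover have "eventually (\<lambda>u. Z u \<omega> = Z t \<omega>) (at_right t)"
        using right_continuous[OF w, of t] t T(1) by (simp add: continuous_within tendsto_discrete)
      then have "eventually (\<lambda>u. y u ^ Z t \<omega> = y u ^ Z u \<omega>) (at_right t)" by eventually_elim simp
      ultimately show ?thesis unfolding continuous_within by (rule Lim_transform_eventually)
    qed
  qed
  \<comment> \<open>The factor that relates \<open>Z t / \<mu>\<^sub>t\<close> to minus the logarithm of \<open>y t ^ Z t\<close>; it tends to 1.\<close>
  define c where "c = (\<lambda>t. - (mu M Z t * ln (y t)))"
  have ge: "eventually (\<lambda>t. T \<le> t) at_top" by (rule eventually_ge_at_top)
  have mu: "filterlim (mu M Z) at_top at_top" using E0 by (simp add: mu_at_top_iff)
  have lim1: "((\<lambda>t. mu M Z t * (1 - y t)) \<longlongrightarrow> 1) at_top"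
  proof -
    have "((\<lambda>t. (g t * E t) powr (- 1 / \<theta>)) \<longlongrightarrow> (1 + 0 + 0 / (1 + \<theta>)) powr (- 1 / \<theta>)) at_top"
      unfolding gE using theta by (intro tendsto_intros vlim E0; simp)
    then have "((\<lambda>t. (g t * E t) powr (- 1 / \<theta>)) \<longlongrightarrow> 1) at_top" by simp
    moreover have "eventually (\<lambda>t. (g t * E t) powr (- 1 / \<theta>) = mu M Z t * (1 - y t)) at_top"
      using ge
    proof eventually_elim
      case (elim t)
      have "(g t * E t) powr (- 1 / \<theta>) = g t powr (- 1 / \<theta>) * E t powr (- 1 / \<theta>)"
        by (rule powr_mult)
      then show ?case using elim T(1) mu_eq[of t] unfolding E_powr(1) by (simp add: y_def mult.commute)
    qed
    ultimately show ?thesis by (rule Lim_transform_eventually)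
  qed
  have ylim: "(y \<longlongrightarrow> 1) at_top"
  proof -
    have "((\<lambda>t. 1 - (mu M Z t * (1 - y t)) * inverse (mu M Z t)) \<longlongrightarrow> 1 - 1 * 0) at_top"
      by (intro tendsto_intros lim1 tendsto_inverse_0_at_top[OF mu])
    then have "((\<lambda>t. 1 - (mu M Z t * (1 - y t)) * inverse (mu M Z t)) \<longlongrightarrow> 1) at_top"
      by simp
    moreover have "eventually (\<lambda>t. 1 - (mu M Z t * (1 - y t)) * inverse (mu M Z t) = y t) at_top"
      using ge
    proof eventually_elim
      case (elim t)
      then have "mu M Z t \<noteq> 0" using mu_pos[of t] T(1) by simp
      then show ?case by (simp add: field_simps)
    qed
    ultimately show ?thesis by (rule Lim_transform_eventually)
  qed
  have clim: "(c \<longlongrightarrow> 1) at_top"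
  proof (rule real_tendsto_sandwich)
    show "((\<lambda>t. mu M Z t * (1 - y t)) \<longlongrightarrow> 1) at_top" by (rule lim1)
    have "((\<lambda>t. mu M Z t * (1 - y t) / y t) \<longlongrightarrow> 1 / 1) at_top" by (intro tendsto_intros lim1 ylim) simp
    then show "((\<lambda>t. mu M Z t * (1 - y t) / y t) \<longlongrightarrow> 1) at_top" by simp
    show "eventually (\<lambda>t. mu M Z t * (1 - y t) \<le> c t) at_top" using ge
    proof eventually_elim
      case (elim t)
      have "1 - y t \<le> - ln (y t)" using ln_le_minus_one[of "y t"] y01[OF elim] by simp
      then have "mu M Z t * (1 - y t) \<le> mu M Z t * (- ln (y t))"
        using mu_pos[of t] elim T(1) by (intro mult_left_mono) auto
      then show ?case by (simp add: c_def)
    qed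
    show "eventually (\<lambda>t. c t \<le> mu M Z t * (1 - y t) / y t) at_top" using ge
    proof eventually_elim
      case (elim t)
      have "- ln (y t) \<le> (1 - y t) / y t"
      proof -
        have "- ln (y t) \<le> inverse (y t) - 1"
          using ln_le_minus_one[of "inverse (y t)"] y01[OF elim] by (simp add: ln_inverse)
        also have "\<dots> = (1 - y t) / y t" using y01[OF elim] by (simp add: field_simps)
        finally show ?thesis .
      qed
      then have "mu M Z t * (- ln (y t)) \<le> mu M Z t * ((1 - y t) / y t)"
        using mu_pos[of t] elim T(1) by (intro mult_left_mono) auto
      then show ?case by (simp add: c_def)
    qed
  qed
  have Zc: "real (Z t \<omega>) / mu M Z t = - ln (y t ^ Z t \<omega>) * inverse (c t)" if t: "T \<le> t" for t \<omega>
  proof -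
    have "ln (y t) < 0" using y01[OF t] by simp
    then show ?thesis using y01[OF t] by (simp add: c_def ln_realpow field_simps)
  qed
  have "AE \<omega> in M. \<exists>l. ((\<lambda>t. real (Z t \<omega>) / mu M Z t) \<longlongrightarrow> l) at_top"
    using Y.almost_surely_convergent limit_finite
  proof eventually_elim
    case (elim \<omega>)
    then obtain l where l: "((\<lambda>t. y t ^ Z t \<omega>) \<longlongrightarrow> l) at_top" by blast
    have ev: "eventually (\<lambda>t. - ln (y t ^ Z t \<omega>) * inverse (c t) = real (Z t \<omega>) / mu M Z t) at_top"
      using ge by eventually_elim (simp only: Zc)
    have pos: "eventually (\<lambda>t. 0 < y t ^ Z t \<omega>) at_top"
      using ge by eventually_elim (simp add: y01)
    have ci: "((\<lambda>t. inverse (c t)) \<longlongrightarrow> inverse 1) at_top" by (intro tendsto_intros clim) simp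
    have "0 \<le> l" by (rule tendsto_lowerbound[OF l]) (use pos in \<open>auto elim!: eventually_mono\<close>)
    show ?case
    proof (cases "l = 0")
      case False
      then have "0 < l" using \<open>0 \<le> l\<close> by simp
      then have "((\<lambda>t. - ln (y t ^ Z t \<omega>) * inverse (c t)) \<longlongrightarrow> - ln l * inverse 1) at_top"
        by (intro tendsto_intros l ci) auto
      then show ?thesis using Lim_transform_eventually[OF _ ev] by blast
    next
      case True
      have "filterlim (\<lambda>t. y t ^ Z t \<omega>) (at_right 0) at_top"
        unfolding filterlim_at
      proof
        show "eventually (\<lambda>t. y t ^ Z t \<omega> \<in> {0<..} \<and> y t ^ Z t \<omega> \<noteq> 0) at_top"
          using pos by eventually_elim (metis greaterThan_iff less_irrefl)
      qed (use l True in simp)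
      then have "filterlim (\<lambda>t. ln (y t ^ Z t \<omega>)) at_bot at_top"
        by (rule filterlim_compose[OF ln_at_0])
      then have "filterlim (\<lambda>t. - ln (y t ^ Z t \<omega>)) at_top at_top"
        by (simp add: filterlim_uminus_at_top)
      then have "filterlim (\<lambda>t. inverse (c t) * - ln (y t ^ Z t \<omega>)) at_top at_top"
        by (rule filterlim_tendsto_pos_mult_at_top[OF ci, rotated]) simp
      then have "filterlim (\<lambda>t. real (Z t \<omega>) / mu M Z t) at_top at_top"
        using ev by (subst filterlim_cong[OF refl refl, symmetric]) (auto simp: mult.commute)
      then have "filterlim (\<lambda>n. real (Z (real n) \<omega>) / mu M Z (real n)) at_top sequentially"
        by (rule filterlim_compose[OF _ filterlim_real_sequentially])
      then show ?thesis using elim(2) by simp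
    qed
  qed
  moreover define W where "W = (\<lambda>\<omega>. lim (\<lambda>n. real (Z (real n) \<omega>) / mu M Z (real n)))"
  have "W \<in> borel_measurable M" unfolding W_def
  proof (rule borel_measurable_lim_metric)
    fix n
    have [measurable]: "(\<lambda>\<omega>. real (Z (real n) \<omega>)) \<in> borel_measurable M"
      by (rule measurable_compose[OF Z_measurable]) auto
    show "(\<lambda>\<omega>. real (Z (real n) \<omega>) / mu M Z (real n)) \<in> borel_measurable M" by simp
  qed
  moreover have "((\<lambda>t. real (Z t \<omega>) / mu M Z t) \<longlongrightarrow> W \<omega>) at_top"
    if "((\<lambda>t. real (Z t \<omega>) / mu M Z t) \<longlongrightarrow> l) at_top" for \<omega> l
  proof -
    have "(\<lambda>n. real (Z (real n) \<omega>) / mu M Z (real n)) \<longlonglongrightarrow> l"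
      by (rule filterlim_compose[OF that filterlim_real_sequentially])
    then show ?thesis using that by (simp add: W_def limI)
  qed
  ultimately show ?thesis by (intro bexI[of _ W]) (auto elim!: eventually_mono)
qed

text \<open>By dominated convergence the transform is the limit of \<open>F 0 t (exp (- w / \<mu>\<^sub>t))\<close>, and
\<open>\<mu>\<^sub>t (1 - exp (- w / \<mu>\<^sub>t)) \<longlongrightarrow> w\<close>.\<close>

lemma Laplace_transform:
  assumes V: "V_lim M \<theta> lam Z < \<infinity>" and Lam: "Lam_lim lam = \<infinity>"
    and W [measurable]: "W \<in> borel_measurable M"
    and lim: "AE \<omega> in M. ((\<lambda>t. real (Z t \<omega>) / mu M Z t) \<longlongrightarrow> W \<omega>) at_top"
    and w: "0 < w"
  shows "(\<integral>\<omega>. exp (- w * W \<omega>) \<partial>M) =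
    1 - (enn2real (V_lim M \<theta> lam Z) + 1 / (1 + \<theta>) + w powr (- \<theta>)) powr (- 1 / \<theta>)"
proof -
  let ?V = "enn2real (V_lim M \<theta> lam Z)"
  have E0: "(E \<longlongrightarrow> 0) at_top" by (rule E_tendsto_0[OF V Lam])
  have mu: "filterlim (mu M Z) at_top at_top" using E0 by (simp add: mu_at_top_iff)
  let ?x = "\<lambda>t. exp (- (w / mu M Z t))"
  have x: "?x t \<in> {0..1}" "?x t < 1" if "0 \<le> t" for t using mu_pos[OF that] w by auto
  have 1: "(\<lambda>n. \<integral>\<omega>. exp (- w * (real (Z (real n) \<omega>) / mu M Z (real n))) \<partial>M) \<longlonglongrightarrow> (\<integral>\<omega>. exp (- w * W \<omega>) \<partial>M)"
  proof (rule integral_dominated_convergence[where w="\<lambda>_. 1"])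
    show "(\<lambda>\<omega>. exp (- w * (real (Z (real n) \<omega>) / mu M Z (real n)))) \<in> borel_measurable M" for n
      by (rule measurable_compose[OF Z_measurable]) auto
    show "AE \<omega> in M. (\<lambda>n. exp (- w * (real (Z (real n) \<omega>) / mu M Z (real n)))) \<longlonglongrightarrow> exp (- w * W \<omega>)"
      using lim
    proof eventually_elim
      case (elim \<omega>)
      have "(\<lambda>n. real (Z (real n) \<omega>) / mu M Z (real n)) \<longlonglongrightarrow> W \<omega>"
        by (rule filterlim_compose[OF elim filterlim_real_sequentially])
      then show ?case by (intro tendsto_intros)
    qed
    show "AE \<omega> in M. norm (exp (- w * (real (Z (real n) \<omega>) / mu M Z (real n)))) \<le> 1" for n
      using w mu_pos[of "real n"] by (auto intro!: AE_I2 mult_nonneg_nonneg)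
  qed auto
  have 2: "(\<integral>\<omega>. exp (- w * (real (Z t \<omega>) / mu M Z t)) \<partial>M) = F 0 t (?x t)" if t: "0 \<le> t" for t
  proof -
    have "exp (- w * (real (Z t \<omega>) / mu M Z t)) = ?x t ^ Z t \<omega>" for \<omega>
      by (simp flip: exp_of_nat_mult)
    then show ?thesis using expectation_pgf[OF t x(1)[OF t]] by simp
  qed
  have 3: "((\<lambda>t. (1 - ?x t) * mu M Z t) \<longlongrightarrow> w) at_top"
  proof (rule Lim_null[THEN iffD2], rule Lim_null_comparison)
    show "((\<lambda>t. w^2 * inverse (mu M Z t)) \<longlongrightarrow> 0) at_top"
      by (rule tendsto_mult_right_zero[OF tendsto_inverse_0_at_top[OF mu]])
    show "eventually (\<lambda>t. norm ((1 - ?x t) * mu M Z t - w) \<le> w^2 * inverse (mu M Z t)) at_top"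
      using eventually_nonneg
    proof eventually_elim
      case (elim t)
      let ?m = "mu M Z t"
      have m: "0 < ?m" using mu_pos[OF elim] .
      have "\<bar>?x t - (1 - w / ?m)\<bar> * ?m \<le> (w / ?m)^2 * ?m"
        using exp_minus_second_order[of "w / ?m"] w m by (intro mult_right_mono) auto
      moreover have "\<bar>?x t - (1 - w / ?m)\<bar> * ?m = \<bar>(1 - ?x t) * ?m - w\<bar>"
      proof -
        have "(1 - ?x t) * ?m - w = - ((?x t - (1 - w / ?m)) * ?m)" using m by (simp add: field_simps)
        then show ?thesis using m by (simp add: abs_mult)
      qed
      moreover have "(w / ?m)^2 * ?m = w^2 * inverse ?m" using m by (simp add: power2_eq_square field_simps)
      ultimately show ?case by simp
    qed
  qed
  have 4: "((\<lambda>t. 1 - (((1 - ?x t) * mu M Z t) powr (- \<theta>) + (1 - E t) / (1 + \<theta>) + \<theta> / (1 + \<theta>) * R t) powr (- 1 / \<theta>))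
     \<longlongrightarrow> 1 - (w powr (- \<theta>) + (1 - 0) / (1 + \<theta>) + ?V) powr (- 1 / \<theta>)) at_top"
  proof (intro tendsto_intros 3 E0 R_tendsto(1)[OF V] disjI1)
    have "0 < w powr (- \<theta>)" "0 < (1 - 0) / (1 + \<theta>)" "0 \<le> ?V" using w theta by auto
    then show "w powr (- \<theta>) + (1 - 0) / (1 + \<theta>) + ?V \<noteq> 0" by linarith
  qed (use w theta in auto)
  have "((\<lambda>t. F 0 t (?x t)) \<longlongrightarrow> 1 - (w powr (- \<theta>) + (1 - 0) / (1 + \<theta>) + ?V) powr (- 1 / \<theta>)) at_top"
  proof (rule Lim_transform_eventually[OF 4], rule eventually_mono[OF eventually_nonneg])
    fix t :: real assume t: "0 \<le> t"
    have "((1 - ?x t) * mu M Z t) powr (- \<theta>) = (1 - ?x t) powr (- \<theta>) * mu M Z t powr (- \<theta>)"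
      by (rule powr_mult)
    also have "mu M Z t powr (- \<theta>) = E t" using t by (simp only: mu_eq E_powr)
    finally have *: "((1 - ?x t) * mu M Z t) powr (- \<theta>) = (1 - ?x t) powr (- \<theta>) * E t" .
    show "1 - (((1 - ?x t) * mu M Z t) powr (- \<theta>) + (1 - E t) / (1 + \<theta>) + \<theta> / (1 + \<theta>) * R t) powr (- 1 / \<theta>) = F 0 t (?x t)"
      unfolding * using pgf_0[OF t, of "?x t"] x[OF t] by simp
  qed
  then have "(\<lambda>n. F 0 (real n) (?x (real n))) \<longlonglongrightarrow> 1 - (w powr (- \<theta>) + (1 - 0) / (1 + \<theta>) + ?V) powr (- 1 / \<theta>)"
    by (rule filterlim_compose[OF _ filterlim_real_sequentially])
  then have "(\<integral>\<omega>. exp (- w * W \<omega>) \<partial>M) = 1 - (w powr (- \<theta>) + (1 - 0) / (1 + \<theta>) + ?V) powr (- 1 / \<theta>)"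
    using LIMSEQ_unique[OF 1] 2 by simp
  then show ?thesis by (simp add: add_ac)
qed

end

theorem theorem2p2:
  fixes M :: "'w measure" and \<theta> :: real and lam a :: "real \<Rightarrow> real"
    and Z :: "real \<Rightarrow> 'w \<Rightarrow> nat"
  assumes "theta_positive_process M \<theta> lam a Z"
  shows "(supercritical M Z \<longleftrightarrow> V_lim M \<theta> lam Z < \<infinity> \<and> Lam_lim lam = \<infinity>) \<and>
    (V_lim M \<theta> lam Z < \<infinity> \<and> Lam_lim lam = \<infinity> \<longrightarrow>
       filterlim (mu M Z) at_top at_top \<and>
       ext_prob M Z = 1 - (enn2real (V_lim M \<theta> lam Z) + 1 / (1 + \<theta>)) powr (- 1 / \<theta>) \<and>
       (\<exists>W \<in> borel_measurable M.
          (AE \<omega> in M. ((\<lambda>t. real (Z t \<omega>) / mu M Z t) \<longlongrightarrow> W \<omega>) at_top) \<and>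
          (\<forall>w\<ge>0. (\<integral>\<omega>. exp (- w * W \<omega>) \<partial>M) =
             (if w = 0 then 1
              else 1 - (enn2real (V_lim M \<theta> lam Z) + 1 / (1 + \<theta>) + w powr (- \<theta>))
                         powr (- 1 / \<theta>)))))"
proof -
  note process = assms[unfolded theta_positive_process_def]
  have "markov_branching M Z" and rates: "\<exists>p. (\<forall>t\<ge>0. theta_offspring_law \<theta> (a t) (p t)) \<and> individual_rates M lam p Z"
    and "prob_space M"
    using process by simp_all
  from this(1) obtain G where G: "\<forall>s t j. 0 \<le> s \<and> s \<le> t \<longrightarrow>
        (AE \<omega> in M. real_cond_exp M (nat_filtration M Z s) (indicator {\<omega> \<in> space M. Z t \<omega> = j}) \<omega>
           = pmf (map_pmf sum_list (replicate_pmf (Z s \<omega>) (G s t))) j)"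
    unfolding markov_branching_def by (elim exE)
  from rates obtain p where p: "\<forall>t\<ge>0. theta_offspring_law \<theta> (a t) (p t)" "individual_rates M lam p Z"
    by (elim exE conjE)
  interpret prob_space M by fact
  interpret theta_process M lam \<theta> a Z G p
  proof unfold_locales
    show "AE \<omega> in M. real_cond_exp M (nat_filtration M Z s) (indicator {\<omega> \<in> space M. Z t \<omega> = j}) \<omega>
           = pmf (map_pmf sum_list (replicate_pmf (Z s \<omega>) (G s t))) j" if "0 \<le> s" "s \<le> t" for s t j
      using G that by simp
  qed (use process p in simp_all)
  show ?thesis
  proof (intro conjI impI supercritical_iff)
    assume *: "V_lim M \<theta> lam Z < \<infinity> \<and> Lam_lim lam = \<infinity>"
    then have E0: "(E \<longlongrightarrow> 0) at_top" using E_tendsto_0 by blast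
    show "filterlim (mu M Z) at_top at_top" using E0 by (simp add: mu_at_top_iff)
    show "ext_prob M Z = 1 - (enn2real (V_lim M \<theta> lam Z) + 1 / (1 + \<theta>)) powr (- 1 / \<theta>)"
      using ext_prob_eq[OF _ E0] * by blast
    obtain W where W: "W \<in> borel_measurable M" "AE \<omega> in M. ((\<lambda>t. real (Z t \<omega>) / mu M Z t) \<longlongrightarrow> W \<omega>) at_top"
      using almost_sure_limit * by blast
    show "\<exists>W \<in> borel_measurable M.
          (AE \<omega> in M. ((\<lambda>t. real (Z t \<omega>) / mu M Z t) \<longlongrightarrow> W \<omega>) at_top) \<and>
          (\<forall>w\<ge>0. (\<integral>\<omega>. exp (- w * W \<omega>) \<partial>M) =
             (if w = 0 then 1
              else 1 - (enn2real (V_lim M \<theta> lam Z) + 1 / (1 + \<theta>) + w powr (- \<theta>))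
                         powr (- 1 / \<theta>)))"
    proof (intro bexI[OF _ W(1)] conjI W(2) allI impI)
      fix w :: real assume "0 \<le> w"
      then show "(\<integral>\<omega>. exp (- w * W \<omega>) \<partial>M) =
             (if w = 0 then 1
              else 1 - (enn2real (V_lim M \<theta> lam Z) + 1 / (1 + \<theta>) + w powr (- \<theta>))
                         powr (- 1 / \<theta>))"
        using Laplace_transform[OF _ _ W, of w] * by (auto simp: prob_space)
    qed
  qed
qed

end
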